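(* Let $\lambda,\mu\in[0,1]$ and $\rho\in(0,1)$ be constants with $F(\lambda,\mu,\rho,1)>1+\epsilon$ for some constant $\epsilon>0$. Let $\pi_*$ be the law of a pair $(\mathbb X,\mathbb Y)$ of real random variables with $\mathbb E[\mathbb X]=\mathbb E[\mathbb Y]=0$, $\mathbb E[\mathbb X^2]=\mathbb E[\mathbb Y^2]=1$, $\mathbb E[\mathbb X\mathbb Y]=\rho$ and $\mathbb E[\mathbb X^4],\mathbb E[\mathbb Y^4]\le C$ for an absolute constant $C$. Let $\ell=\ell_n$ satisfy $\ell=\omega(1)$ and $\ell=o(\tfrac{\log n}{\log\log n})$. Fix any constant $0<c<1$ and put $\tau=c\cdot\mathbb E_{\mathbb P}[f_{\mathcal H}(\boldsymbol X,\boldsymbol Y)]$. Then, as $n\to\infty$, $$\mathbb P\big(f_{\mathcal H}(\boldsymbol X,\boldsymbol Y)\le\tau\big)+\mathbb Q\big(f_{\mathcal H}(\boldsymbol X,\boldsymbol Y)\ge\tau\big)=o(1).$$ In particular, the test that outputs $1$ if $f_{\mathcal H}(\boldsymbol X,\boldsymbol Y)\ge\tau$ and $0$ otherwise achieves strong detection between $\mathbb P$ and $\mathbb Q$.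
   Context: **The function $F$.** $F(\lambda,\mu,\rho,\gamma)=\max\Big\{\frac{\lambda^2}{\gamma},\frac{\mu^2}{\gamma},\frac{\lambda^2\rho^2}{\gamma-\lambda^2+\lambda^2\rho^2}+\frac{\mu^2\rho^2}{\gamma-\mu^2+\mu^2\rho^2}\Big\}$. **Model (correlated spiked Wigner).** The pairs $(x_i,y_i)_{1\le i\le n}$ are i.i.d. from $\pi_*$, $x=(x_i)$, $y=(y_i)\in\mathbb R^n$. $\boldsymbol W,\boldsymbol Z$ are independent (of each other and of $(x,y)$) $n\times n$ Wigner matrices: symmetric, with independent entries for $i\le j$ distributed as centered normals of variance $1+\mathbf 1_{i=j}$. $\mathbb P$ is the law of $(\boldsymbol X,\boldsymbol Y)$ with $\boldsymbol X=\frac{\lambda}{\sqrt n}xx^\top+\boldsymbol W$, $\boldsymbol Y=\frac{\mu}{\sqrt n}yy^\top+\boldsymbol Z$; $\mathbb Q$ is the law of $(\boldsymbol W,\boldsymbol Z)$. Strong detection by a $\{0,1\}$-valued algorithm $\mathcal A$ means $\mathbb P(\mathcal A(\boldsymbol X,\boldsymbol Y)=0)+\mathbb Q(\mathcal A(\boldsymbol X,\boldsymbol Y)=1)\to0$ as $n\to\infty$. **Decorated graphs.** A decorated graph $H$ is a simple graph with a map $E(H)\to\{\bullet,\circ\}$; $E_\bullet(H),E_\circ(H)$ are the sets of edges with decoration $\bullet,\circ$; $V_\bullet(H),V_\circ(H)$ are the sets of vertices incident to at least one edge of $E_\bullet(H)$, resp. $E_\circ(H)$; $\mathsf{diff}(H)=V_\bullet(H)\cap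 V_\circ(H)$. Isomorphisms of decorated graphs preserve edges and decorations; $[H]$ is the isomorphism class, $|\mathsf{Aut}(H)|$ the number of automorphisms. $\mathsf K_n$ is the complete graph on $[n]$; $S\subset\mathsf K_n$ ranges over decorated subgraphs. **Statistic.** $\mathcal H=\mathcal H(\ell)$ is the collection of isomorphism classes of decorated cycles of length $\ell$. Set $\Xi(H)=\lambda^{|E_\bullet(H)|}\mu^{|E_\circ(H)|}\rho^{|\mathsf{diff}(H)|}$, $\beta_{\mathcal H}=\sum_{[H]\in\mathcal H}\frac{\Xi(H)^2}{|\mathsf{Aut}(H)|}$, $f_S(\boldsymbol X,\boldsymbol Y)=\prod_{(i,j)\in E_\bullet(S)}\boldsymbol X_{i,j}\prod_{(i,j)\in E_\circ(S)}\boldsymbol Y_{i,j}$ and $$f_{\mathcal H}(\boldsymbol X,\boldsymbol Y)=\frac1{\sqrt{n^\ell\beta_{\mathcal H}}}\sum_{[H]\in\mathcal H}\Xi(H)\sum_{S\subset\mathsf K_n,\,S\cong H}f_S(\boldsymbol X,\boldsymbol Y).$$ *)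

theory Defs
  imports
    "HOL-Probability.Probability"
    "HOL-Library.Landau_Symbols"
    "HOL-Combinatorics.Permutations"
begin

definition F :: "real \<Rightarrow> real \<Rightarrow> real \<Rightarrow> real \<Rightarrow> real" where
  "F lam mu rho gam = Max {lam\<^sup>2 / gam, mu\<^sup>2 / gam,
     lam\<^sup>2 * rho\<^sup>2 / (gam - lam\<^sup>2 + lam\<^sup>2 * rho\<^sup>2)
       + mu\<^sup>2 * rho\<^sup>2 / (gam - mu\<^sup>2 + mu\<^sup>2 * rho\<^sup>2)}"


section \<open>Correlated spiked Wigner model\<close>

text \<open>An n by n matrix is a function on index pairs, extensional outside
  \<open>{..<n} \<times> {..<n}\<close>; the index set [n] is rendered as \<open>{..<n}\<close>.\<close>

type_synonym rmat = "nat \<times> nat \<Rightarrow> real"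

definition mat_space :: "nat \<Rightarrow> rmat measure" where
  "mat_space n = Pi\<^sub>M ({..<n} \<times> {..<n}) (\<lambda>_. borel)"

text \<open>The second argument of \<^const>\<open>normal_density\<close> is the standard deviation, not the
  variance.\<close>

definition wigner :: "nat \<Rightarrow> rmat measure" where
  "wigner n =
     distr (Pi\<^sub>M {(i, j). i \<le> j \<and> j < n}
              (\<lambda>(i, j). density lborel (normal_density 0 (sqrt (1 + (if i = j then 1 else 0))))))
       (mat_space n)
       (\<lambda>w. \<lambda>(i, j)\<in>{..<n} \<times> {..<n}. w (min i j, max i j))"

definition add_spike :: "real \<Rightarrow> nat \<Rightarrow> (nat \<Rightarrow> real) \<Rightarrow> rmat \<Rightarrow> rmat" where
  "add_spike lam n x W = (\<lambda>(i, j)\<in>{..<n} \<times> {..<n}. lam / sqrt (real n) * (x i * x j) + W (i, j))"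

text \<open>In both laws, the independence assumptions are expressed by product measures.\<close>

definition null_law :: "nat \<Rightarrow> (rmat \<times> rmat) measure" where
  "null_law n = wigner n \<Otimes>\<^sub>M wigner n"

definition planted_law ::
    "real \<Rightarrow> real \<Rightarrow> (real \<times> real) measure \<Rightarrow> nat \<Rightarrow> (rmat \<times> rmat) measure" where
  "planted_law lam mu prior n =
     distr (Pi\<^sub>M {..<n} (\<lambda>_. prior) \<Otimes>\<^sub>M (wigner n \<Otimes>\<^sub>M wigner n))
       (mat_space n \<Otimes>\<^sub>M mat_space n)
       (\<lambda>(xy, W, Z). (add_spike lam n (\<lambda>i. fst (xy i)) W, add_spike mu n (\<lambda>i. snd (xy i)) Z))"

definition strong_detection ::
    "(nat \<Rightarrow> 'a measure) \<Rightarrow> (nat \<Rightarrow> 'a measure) \<Rightarrow> (nat \<Rightarrow> 'a \<Rightarrow> nat) \<Rightarrow> bool" where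
  "strong_detection P Q A \<longleftrightarrow>
     (\<forall>n. A n \<in> P n \<rightarrow>\<^sub>M count_space {0, 1} \<and> A n \<in> Q n \<rightarrow>\<^sub>M count_space {0, 1}) \<and>
     (\<lambda>n. measure (P n) {\<omega> \<in> space (P n). A n \<omega> = 0}
        + measure (Q n) {\<omega> \<in> space (Q n). A n \<omega> = 1}) \<longlonglongrightarrow> 0"


section \<open>Decorated graphs\<close>

datatype decoration = Bullet | Circ

text \<open>The decoration map is partial on vertex sets; its domain is the edge set.\<close>

record 'a dgraph =
  verts :: "'a set"
  dec :: "'a set \<rightharpoonup> decoration"

definition edges :: "'a dgraph \<Rightarrow> 'a set set" where
  "edges H = dom (dec H)"

definition decorated_graph :: "'a dgraph \<Rightarrow> bool" where
  "decorated_graph H \<longleftrightarrow> finite (verts H) \<and> (\<forall>e\<in>edges H. e \<subseteq> verts H \<and> card e = 2)"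

definition edges_of :: "decoration \<Rightarrow> 'a dgraph \<Rightarrow> 'a set set" where
  "edges_of d H = {e. dec H e = Some d}"

definition verts_of :: "decoration \<Rightarrow> 'a dgraph \<Rightarrow> 'a set" where
  "verts_of d H = \<Union> (edges_of d H)"

definition diff :: "'a dgraph \<Rightarrow> 'a set" where
  "diff H = verts_of Bullet H \<inter> verts_of Circ H"

text \<open>Both sides of the equation are \<^const>\<open>None\<close> on non-edges, so adjacency and non-adjacency
  are preserved along with decorations.\<close>

definition dgraph_iso :: "('a \<Rightarrow> 'b) \<Rightarrow> 'a dgraph \<Rightarrow> 'b dgraph \<Rightarrow> bool" where
  "dgraph_iso h G H \<longleftrightarrow> bij_betw h (verts G) (verts H) \<and>
     (\<forall>u\<in>verts G. \<forall>v\<in>verts G. dec H {h u, h v} = dec G {u, v})"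

definition isomorphic :: "'a dgraph \<Rightarrow> 'b dgraph \<Rightarrow> bool" (infix "\<simeq>\<^sub>d" 50) where
  "G \<simeq>\<^sub>d H \<longleftrightarrow> (\<exists>h. dgraph_iso h G H)"

definition Aut :: "'a dgraph \<Rightarrow> ('a \<Rightarrow> 'a) set" where
  "Aut H = {h. h permutes verts H \<and> dgraph_iso h H H}"

text \<open>Every finite graph has a copy with vertices in \<^typ>\<open>nat\<close>, so isomorphism classes
  are taken over that type.\<close>

definition iso_class :: "nat dgraph \<Rightarrow> nat dgraph set" where
  "iso_class H = {G. decorated_graph G \<and> G \<simeq>\<^sub>d H}"

definition rep :: "nat dgraph set \<Rightarrow> nat dgraph" where
  "rep K = (SOME H. H \<in> K)"

definition decorated_cycle :: "nat \<Rightarrow> 'a dgraph \<Rightarrow> bool" where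
  "decorated_cycle l H \<longleftrightarrow> decorated_graph H \<and> l \<ge> 3 \<and>
     (\<exists>vs. distinct vs \<and> length vs = l \<and> verts H = set vs \<and>
        edges H = {{vs ! i, vs ! (Suc i mod l)} | i. i < l})"

definition cycle_classes :: "nat \<Rightarrow> nat dgraph set set" where
  "cycle_classes l = {iso_class H | H. decorated_cycle l H}"

definition subgraphs_K :: "nat \<Rightarrow> nat dgraph set" where
  "subgraphs_K n = {S. decorated_graph S \<and> verts S \<subseteq> {..<n}}"


section \<open>The cycle statistic\<close>

definition Xi :: "real \<Rightarrow> real \<Rightarrow> real \<Rightarrow> 'a dgraph \<Rightarrow> real" where
  "Xi lam mu rho H =
     lam ^ card (edges_of Bullet H) * mu ^ card (edges_of Circ H) * rho ^ card (diff H)"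

text \<open>Summands over isomorphism classes are invariant under isomorphism, so evaluating them at
  the representative \<^const>\<open>rep\<close> is harmless.\<close>

definition beta :: "real \<Rightarrow> real \<Rightarrow> real \<Rightarrow> nat \<Rightarrow> real" where
  "beta lam mu rho l =
     (\<Sum>K\<in>cycle_classes l. (Xi lam mu rho (rep K))\<^sup>2 / real (card (Aut (rep K))))"

text \<open>Each edge contributes one factor, the matrix entry above the diagonal.\<close>

definition f_sub :: "nat dgraph \<Rightarrow> rmat \<times> rmat \<Rightarrow> real" where
  "f_sub S = (\<lambda>(X, Y).
     (\<Prod>(i, j)\<in>{(i, j). i < j \<and> {i, j} \<in> edges_of Bullet S}. X (i, j)) *
     (\<Prod>(i, j)\<in>{(i, j). i < j \<and> {i, j} \<in> edges_of Circ S}. Y (i, j)))"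

definition f_cycle ::
    "real \<Rightarrow> real \<Rightarrow> real \<Rightarrow> nat \<Rightarrow> nat \<Rightarrow> rmat \<times> rmat \<Rightarrow> real" where
  "f_cycle lam mu rho l n XY =
     1 / sqrt (real n ^ l * beta lam mu rho l) *
     (\<Sum>K\<in>cycle_classes l. Xi lam mu rho (rep K) *
        (\<Sum>S\<in>{S \<in> subgraphs_K n. S \<simeq>\<^sub>d rep K}. f_sub S XY))"

end

theory Submission
  imports Defs "HOL-Real_Asymp.Real_Asymp"
begin

text \<open>The proof is the second moment method. The statistic is a weighted sum over all decorated cycles
  \<open>S\<close> in \<open>K_n\<close>. Under the null law the monomials \<open>f_S\<close> are orthonormal, so the second moment is at most 1.
  Under the planted law \<open>E f_S = n^(-l/2) Xi(S)\<close>, because every vertex of a cycle has degree 2; hence the mean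
  is about \<open>sqrt beta\<close>. Up to automorphism factors \<open>beta\<close> is the trace of the \<open>l\<close>-th power of a
  2 by 2 transfer matrix, whose spectral radius exceeds 1 when \<open>F > 1\<close>, so the mean diverges.

  For the planted variance, vertex-disjoint pairs of cycles are uncorrelated. Two distinct cycles with
  \<open>k \<ge> 1\<close> common vertices share at most \<open>k - 1\<close> equally decorated edges; each common vertex costs a
  factor \<open>n\<close> in the number of pairs and each common edge gains only one factor \<open>n\<close> in the correlation, so
  these pairs contribute at most \<open>O(l)^l / n\<close>, which vanishes for \<open>l = o(log n / log log n)\<close>. The diagonal
  pairs contribute a bounded amount, and Chebyshev's inequality concludes.\<close>

section \<open>Decorated cycles\<close>

text \<open>The diagonal pairs are the delicate part of the variance. The cheap bound for
  \<open>E f_S^2\<close> is \<open>K^l\<close>, with \<open>K\<close> built from fourth moments of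
  the prior, and this may outgrow \<open>beta\<close>; a convexity argument
  (\<open>prod_one_plus_scaled_le\<close>) improves it to \<open>1 + (2 K)^l / n\<close>. Fourth
  moments suffice because a vertex has degree 2 in each cycle, so a pair of cycles produces total
  degree 4 there, shared edges included. The bounds are therefore organised as one factor
  \<open>r\<close> per vertex and cycle. The growth of \<open>beta\<close> is proved without
  eigenvalues. As \<open>lam, mu \<le> 1\<close>, the condition \<open>F > 1\<close> gives
  \<open>(1 - lam^2) (1 - mu^2) < lam^2 mu^2 rho^4\<close>, that is \<open>det (I - T) < 0\<close>
  for the transfer matrix \<open>T\<close>, and this yields a positive vector \<open>u\<close> with
  \<open>T u \<ge> \<theta> u\<close> and \<open>\<theta> > 1\<close>. Passing from decorated
  sequences to cycles loses only a factor \<open>l^2\<close>, negligible against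
  \<open>\<theta>^l\<close>. Given the spike, the entries involved are independent shifted normals,
  so null and planted moments come from one computation, \<open>null_law_shifted\<close>.\<close>

definition cyc_edge :: "'a list \<Rightarrow> nat \<Rightarrow> 'a set" where
  "cyc_edge vs i = {vs ! i, vs ! (Suc i mod length vs)}"

text \<open>A presentation of a decorated cycle: \<open>ds ! i\<close> decorates the edge leaving
  \<open>vs ! i\<close>. Positions modulo \<open>l\<close> turn products over edges and over
  vertices into products over \<open>{..<l}\<close>, related by the rotation
  \<open>Suc i mod l\<close>. A cycle has several presentations, so counts of presentations and of
  cycles must be compared below.\<close>

definition cyc :: "'a list \<Rightarrow> decoration list \<Rightarrow> 'a dgraph" where
  "cyc vs ds = \<lparr>verts = set vs, dec = map_of (zip (map (cyc_edge vs) [0..<length vs]) ds)\<rparr>"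

lemma Suc_mod_eq: "i < l \<Longrightarrow> Suc i mod l = (if Suc i = l then 0 else Suc i)"
  by auto

lemma Suc_mod_less [simp]: "i < l \<Longrightarrow> Suc i mod l < l"
  by (rule mod_less_divisor) simp

lemma bij_betw_Suc_mod: "bij_betw (\<lambda>i. Suc i mod l) {..<l} {..<l}"
proof -
  have "inj_on (\<lambda>i. Suc i mod l) {..<l}"
    by (auto simp: inj_on_def Suc_mod_eq split: if_splits)
  moreover have "(\<lambda>i. Suc i mod l) ` {..<l} \<subseteq> {..<l}"
    by auto
  ultimately show ?thesis
    by (simp add: bij_betw_def endo_inj_surj)
qed

lemma verts_cyc [simp]: "verts (cyc vs ds) = set vs"
  by (simp add: cyc_def)

text \<open>If two different positions gave the same edge, each would be the cyclic successor of the
  other, which forces length 2.\<close>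

lemma inj_on_cyc_edge:
  assumes "distinct vs" "3 \<le> length vs"
  shows "inj_on (cyc_edge vs) {..<length vs}"
proof (rule inj_onI)
  fix i j assume ij: "i \<in> {..<length vs}" "j \<in> {..<length vs}" and e: "cyc_edge vs i = cyc_edge vs j"
  have m: "Suc i mod length vs < length vs" "Suc j mod length vs < length vs"
    using ij by auto
  have "i = j \<or> i = Suc j mod length vs \<and> Suc i mod length vs = j"
    using e ij m assms(1) unfolding cyc_edge_def doubleton_eq_iff
    by (auto simp: nth_eq_iff_index_eq)
  then show "i = j"
    using ij assms(2) by (auto simp: Suc_mod_eq split: if_splits)
qed

lemma card_cyc_edge:
  assumes "distinct vs" "3 \<le> length vs" "i < length vs"
  shows "card (cyc_edge vs i) = 2"
proof -
  have "i \<noteq> Suc i mod length vs"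
    using assms by (auto simp: Suc_mod_eq split: if_splits)
  then have "vs ! i \<noteq> vs ! (Suc i mod length vs)"
    using assms by (simp add: nth_eq_iff_index_eq)
  then show ?thesis
    by (simp add: cyc_edge_def)
qed

lemma cyc_edge_subset: "i < length vs \<Longrightarrow> cyc_edge vs i \<subseteq> set vs"
  by (auto simp: cyc_edge_def)

lemma cyc_edge_map:
  "i < length vs \<Longrightarrow> cyc_edge (map h vs) i = h ` cyc_edge vs i"
  by (auto simp: cyc_edge_def)

context
  fixes vs :: "'a list" and ds :: "decoration list" and l :: nat
  assumes vs: "distinct vs" "length vs = l" and ds: "length ds = l" and l: "3 \<le> l"
begin

lemma dec_cyc_edge:
  assumes "i < l"
  shows "dec (cyc vs ds) (cyc_edge vs i) = Some (ds ! i)"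
proof -
  have "distinct (map (cyc_edge vs) [0..<l])"
    using inj_on_cyc_edge[OF vs(1)] vs l by (simp add: distinct_map atLeast0LessThan)
  then have "map_of (zip (map (cyc_edge vs) [0..<l]) ds) (map (cyc_edge vs) [0..<l] ! i) = Some (ds ! i)"
    using assms ds by (intro map_of_zip_nth) auto
  then show ?thesis
    using assms vs by (simp add: cyc_def)
qed

lemma edges_cyc: "edges (cyc vs ds) = cyc_edge vs ` {..<l}"
  using vs ds by (simp add: edges_def cyc_def dom_map_of_zip atLeast0LessThan)

lemma dec_cyc_iff:
  "dec (cyc vs ds) e = Some d \<longleftrightarrow> (\<exists>i<l. e = cyc_edge vs i \<and> d = ds ! i)"
proof
  assume "dec (cyc vs ds) e = Some d"
  moreover from this have "e \<in> edges (cyc vs ds)" by (auto simp: edges_def)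
  ultimately show "\<exists>i<l. e = cyc_edge vs i \<and> d = ds ! i"
    using dec_cyc_edge by (auto simp: edges_cyc)
qed (use dec_cyc_edge in auto)

lemma decorated_graph_cyc: "decorated_graph (cyc vs ds)"
  using vs l card_cyc_edge[of vs] cyc_edge_subset[of _ vs]
  by (auto simp: decorated_graph_def edges_cyc)

lemma decorated_cycle_cyc: "decorated_cycle l (cyc vs ds)"
  unfolding decorated_cycle_def
  using decorated_graph_cyc l vs
  by (auto intro!: exI[of _ vs] simp: edges_cyc cyc_edge_def)

end

lemma dgraph_iso_cyc_map:
  assumes h: "inj_on h (set vs)"
    and vs: "distinct vs" "length vs = l" and ds: "length ds = l" and l: "3 \<le> l"
  shows "dgraph_iso h (cyc vs ds) (cyc (map h vs) ds)"
proof -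
  have vs': "distinct (map h vs)" "length (map h vs) = l"
    using h vs by (auto simp: distinct_map)
  have "dec (cyc (map h vs) ds) {h u, h v} = dec (cyc vs ds) {u, v}" if "u \<in> set vs" "v \<in> set vs" for u v
  proof -
    have e: "{h u, h v} = cyc_edge (map h vs) i \<longleftrightarrow> {u, v} = cyc_edge vs i" if "i < l" for i
    proof -
      have "h ` {u, v} = h ` cyc_edge vs i \<longleftrightarrow> {u, v} = cyc_edge vs i"
        using \<open>u \<in> set vs\<close> \<open>v \<in> set vs\<close> cyc_edge_subset[of i vs] that vs
        by (intro inj_on_image_eq_iff[OF h]) auto
      then show ?thesis using that vs by (simp add: cyc_edge_map)
    qed
    show ?thesis
    proof (cases "\<exists>i<l. {u, v} = cyc_edge vs i")
      case True
      then obtain i where i: "i < l" "{u, v} = cyc_edge vs i" by blast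
      then have "{h u, h v} = cyc_edge (map h vs) i" using e by blast
      then show ?thesis using i dec_cyc_edge[OF vs ds l] dec_cyc_edge[OF vs' ds l] by simp
    next
      case False
      then have "{u, v} \<notin> edges (cyc vs ds)" "{h u, h v} \<notin> edges (cyc (map h vs) ds)"
        using e by (auto simp: edges_cyc[OF vs ds l] edges_cyc[OF vs' ds l])
      then show ?thesis by (simp add: edges_def domIff)
    qed
  qed
  then show ?thesis using h by (auto simp: dgraph_iso_def bij_betw_def)
qed

lemma decorated_graph_eqI:
  fixes G H :: "'a dgraph"
  assumes "verts G = verts H" "\<And>e d. dec G e = Some d \<longleftrightarrow> dec H e = Some d"
  shows "G = H"
proof -
  have "dec G e = dec H e" for e
    by (rule option.expand) (use assms(2)[of e] in \<open>metis option.collapse option.distinct(1) option.inject\<close>)+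
  then have "dec G = dec H" by (rule ext)
  with assms(1) show ?thesis by (cases G; cases H) simp
qed

lemma decorated_cycleE:
  assumes "decorated_cycle l H"
  obtains vs ds where "distinct vs" "length vs = l" "length ds = l" "H = cyc vs ds"
proof -
  obtain vs where vs: "distinct vs" "length vs = l" "verts H = set vs"
      "edges H = {{vs ! i, vs ! (Suc i mod l)} | i. i < l}" and l: "3 \<le> l"
    using assms unfolding decorated_cycle_def by blast
  define ds where "ds = map (\<lambda>i. the (dec H (cyc_edge vs i))) [0..<l]"
  have E: "edges H = cyc_edge vs ` {..<l}"
    unfolding vs(4) cyc_edge_def vs(2) by blast
  have "H = cyc vs ds"
  proof (rule decorated_graph_eqI)
    fix e d
    have "dec H e = Some d \<longleftrightarrow> e \<in> edges H \<and> the (dec H e) = d"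
      by (cases "dec H e") (simp_all add: edges_def domIff)
    also have "\<dots> \<longleftrightarrow> (\<exists>i<l. e = cyc_edge vs i \<and> d = ds ! i)"
      unfolding E ds_def by auto
    also have "\<dots> \<longleftrightarrow> dec (cyc vs ds) e = Some d"
      by (rule dec_cyc_iff[OF vs(1,2) _ l, symmetric]) (simp add: ds_def)
    finally show "dec H e = Some d \<longleftrightarrow> dec (cyc vs ds) e = Some d" .
  qed (simp add: vs(3))
  moreover have "length ds = l" by (simp add: ds_def)
  ultimately show thesis using that[OF vs(1,2)] by metis
qed

section \<open>Isomorphisms of decorated graphs\<close>

lemma dgraph_iso_refl: "dgraph_iso id G G"
  by (auto simp: dgraph_iso_def)

lemma dgraph_isoD:
  assumes "dgraph_iso h G H"
  shows "h ` verts G = verts H" "inj_on h (verts G)"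
    "\<lbrakk>u \<in> verts G; v \<in> verts G\<rbrakk> \<Longrightarrow> dec H {h u, h v} = dec G {u, v}"
  using assms unfolding dgraph_iso_def bij_betw_def by blast+

lemma dgraph_iso_comp:
  assumes "dgraph_iso g G H" "dgraph_iso h H K"
  shows "dgraph_iso (h \<circ> g) G K"
proof -
  have b: "bij_betw g (verts G) (verts H)" "bij_betw h (verts H) (verts K)"
    using assms by (auto simp: dgraph_iso_def)
  then have "g u \<in> verts H" if "u \<in> verts G" for u
    using that by (meson bij_betwE)
  then show ?thesis
    using assms bij_betw_trans[OF b] by (simp add: dgraph_iso_def)
qed

lemma dgraph_iso_inv:
  assumes "dgraph_iso h G H"
  shows "dgraph_iso (inv_into (verts G) h) H G"
proof -
  have b: "bij_betw h (verts G) (verts H)" using assms by (simp add: dgraph_iso_def)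
  let ?k = "inv_into (verts G) h"
  have "dec G {?k u, ?k v} = dec H {u, v}" if "u \<in> verts H" "v \<in> verts H" for u v
  proof -
    have "?k u \<in> verts G" "?k v \<in> verts G" "h (?k u) = u" "h (?k v) = v"
      using that b by (auto simp: bij_betw_def inv_into_into f_inv_into_f)
    then show ?thesis using dgraph_isoD(3)[OF assms, of "?k u" "?k v"] by simp
  qed
  then show ?thesis using b by (auto simp: dgraph_iso_def bij_betw_inv_into)
qed

lemma dgraph_iso_cong:
  assumes "dgraph_iso g G H" "\<And>x. x \<in> verts G \<Longrightarrow> h x = g x"
  shows "dgraph_iso h G H"
  using assms bij_betw_cong[of "verts G" h g "verts H"] by (auto simp: dgraph_iso_def)

text \<open>\<open>dgraph_iso\<close> constrains \<open>dec\<close> only on pairs of vertices;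
  well-formedness of the targets puts every decorated edge there, so the map determines its target
  completely.\<close>

lemma dgraph_iso_unique:
  assumes "dgraph_iso h G H" "dgraph_iso h G K" "decorated_graph H" "decorated_graph K"
  shows "H = K"
proof (rule decorated_graph_eqI)
  show "verts H = verts K"
    using dgraph_isoD(1)[OF assms(1)] dgraph_isoD(1)[OF assms(2)] by blast
  have *: "dec K e = Some d"
    if "dec H e = Some d" "dgraph_iso h G H" "dgraph_iso h G K" "decorated_graph H" for H K e d
  proof -
    have "e \<in> edges H" using that by (auto simp: edges_def)
    then have e: "e \<subseteq> verts H" "card e = 2"
      using \<open>decorated_graph H\<close> unfolding decorated_graph_def by blast+
    then obtain a b where "e = {a, b}" unfolding card_2_iff by blast
    with e(1) have ab: "e = {a, b}" "a \<in> verts H" "b \<in> verts H" by simp_all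
    obtain u w where uw: "a = h u" "b = h w" "u \<in> verts G" "w \<in> verts G"
      using ab(2,3) unfolding dgraph_isoD(1)[OF \<open>dgraph_iso h G H\<close>, symmetric] by (elim imageE)
    have "dec K {a, b} = dec H {a, b}"
      unfolding uw(1,2) dgraph_isoD(3)[OF \<open>dgraph_iso h G H\<close> uw(3,4)]
        dgraph_isoD(3)[OF \<open>dgraph_iso h G K\<close> uw(3,4)] ..
    then show ?thesis using \<open>dec H e = Some d\<close> ab(1) by simp
  qed
  show "dec H e = Some d \<longleftrightarrow> dec K e = Some d" for e d
    using *[OF _ assms(1,2,3)] *[OF _ assms(2,1,4)] by blast
qed

lemma isomorphic_sym: "G \<simeq>\<^sub>d H \<Longrightarrow> H \<simeq>\<^sub>d G"
  unfolding isomorphic_def using dgraph_iso_inv by blast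

lemma isomorphic_trans: "G \<simeq>\<^sub>d H \<Longrightarrow> H \<simeq>\<^sub>d K \<Longrightarrow> G \<simeq>\<^sub>d K"
  unfolding isomorphic_def using dgraph_iso_comp by blast

lemma isomorphic_refl: "G \<simeq>\<^sub>d G"
  unfolding isomorphic_def using dgraph_iso_refl by blast

text \<open>Copies of a cycle are relabellings of its vertex list with the decoration list
  unchanged, so questions about isomorphic cycles reduce to lists.\<close>

lemma dgraph_iso_cycD:
  assumes "dgraph_iso h (cyc vs ds) H" "decorated_graph H"
    "distinct vs" "length vs = l" "length ds = l" "3 \<le> l"
  shows "H = cyc (map h vs) ds" "distinct (map h vs)"
proof -
  have i: "inj_on h (set vs)"
    using dgraph_isoD(2)[OF assms(1)] by simp
  then show d: "distinct (map h vs)" using assms by (simp add: distinct_map)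
  have "decorated_graph (cyc (map h vs) ds)"
    using decorated_graph_cyc[OF d _ assms(5,6)] assms(4) by simp
  then show "H = cyc (map h vs) ds"
    by (rule dgraph_iso_unique[OF assms(1) dgraph_iso_cyc_map[OF i assms(3-6)] assms(2)])
qed

section \<open>The weight of a cycle as a product over positions\<close>

definition coef :: "real \<Rightarrow> real \<Rightarrow> decoration \<Rightarrow> real" where
  "coef lam mu d = (case d of Bullet \<Rightarrow> lam | Circ \<Rightarrow> mu)"

lemma prod_coef:
  fixes l :: nat
  shows "(\<Prod>i<l. coef lam mu (f i)) = lam ^ card {i. i < l \<and> f i = Bullet} * mu ^ card {i. i < l \<and> f i = Circ}"
proof (induction l)
  case (Suc l)
  have *: "{i. i < Suc l \<and> f i = d} = (if f l = d then insert l {i. i < l \<and> f i = d} else {i. i < l \<and> f i = d})" for d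
    by (auto simp: less_Suc_eq)
  show ?case
    by (cases "f l") (simp_all add: Suc.IH * , simp_all add: coef_def)
qed simp

context
  fixes vs :: "'a list" and ds :: "decoration list" and l :: nat
  assumes vs: "distinct vs" "length vs = l" and ds: "length ds = l" and l: "3 \<le> l"
begin

lemma edges_of_cyc: "edges_of d (cyc vs ds) = cyc_edge vs ` {i. i < l \<and> ds ! i = d}"
  by (auto simp: edges_of_def dec_cyc_iff[OF vs ds l])

lemma card_edges_of_cyc: "card (edges_of d (cyc vs ds)) = card {i. i < l \<and> ds ! i = d}"
  unfolding edges_of_cyc using inj_on_cyc_edge[OF vs(1)] vs(2) l
  by (intro card_image) (auto intro: inj_on_subset)

lemma inj_on_nth_Suc_mod: "inj_on (\<lambda>i. vs ! (Suc i mod l)) {..<l}"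
proof -
  have "inj_on (nth vs \<circ> (\<lambda>i. Suc i mod l)) {..<l}"
    using bij_betw_Suc_mod[of l] vs
    by (intro comp_inj_on) (auto simp: bij_betw_def intro: inj_on_nth)
  then show ?thesis by (simp add: o_def)
qed

text \<open>The edges at positions \<open>i\<close> and \<open>Suc i mod l\<close> meet at
  \<open>vs ! (Suc i mod l)\<close>. Indexing vertices by this shift lets
  \<open>card_diff_cyc\<close> compare the two decorations at a vertex without cyclic
  predecessors.\<close>

lemma verts_of_cyc:
  "verts_of d (cyc vs ds) =
     (\<lambda>i. vs ! (Suc i mod l)) ` {i. i < l \<and> (ds ! i = d \<or> ds ! (Suc i mod l) = d)}" (is "?L = ?R")
proof -
  have "?L = {vs ! i |i. i < l \<and> ds ! i = d} \<union> {vs ! (Suc i mod l) |i. i < l \<and> ds ! i = d}"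
    by (auto simp: verts_of_def edges_of_cyc cyc_edge_def vs)
  also have "{vs ! i |i. i < l \<and> ds ! i = d} = {vs ! (Suc i mod l) |i. i < l \<and> ds ! (Suc i mod l) = d}"
    (is "?A = ?B")
  proof
    show "?A \<subseteq> ?B"
    proof
      fix x assume "x \<in> ?A"
      then obtain i where i: "i < l" "ds ! i = d" "x = vs ! i" by blast
      then have "i \<in> (\<lambda>i. Suc i mod l) ` {..<l}"
        using bij_betw_Suc_mod[of l] by (simp add: bij_betw_def)
      then show "x \<in> ?B" using i by auto
    qed
    show "?B \<subseteq> ?A" using Suc_mod_less by blast
  qed
  finally show ?thesis by blast
qed

lemma card_diff_cyc: "card (diff (cyc vs ds)) = card {i. i < l \<and> ds ! i \<noteq> ds ! (Suc i mod l)}"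
proof -
  have "diff (cyc vs ds) = (\<lambda>i. vs ! (Suc i mod l)) `
    ({i. i < l \<and> (ds ! i = Bullet \<or> ds ! (Suc i mod l) = Bullet)} \<inter> {i. i < l \<and> (ds ! i = Circ \<or> ds ! (Suc i mod l) = Circ)})"
    unfolding diff_def verts_of_cyc
    by (rule inj_on_image_Int[OF inj_on_nth_Suc_mod, symmetric]) auto
  also have "\<dots> = (\<lambda>i. vs ! (Suc i mod l)) ` {i. i < l \<and> ds ! i \<noteq> ds ! (Suc i mod l)}"
    by (intro arg_cong[where f = "(`) _"]) (auto, (metis decoration.exhaust)+)
  finally show ?thesis
    by (simp only:) (rule card_image, rule inj_on_subset[OF inj_on_nth_Suc_mod], auto)
qed

text \<open>The nearest-neighbour form serves twice: the factors \<open>1\<close> and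
  \<open>rho\<close> are the vertex expectations under the prior (\<open>prod_spike_slots\<close>),
  and the square is a product of transfer matrix entries (\<open>Xi_cyc_square\<close>).\<close>

lemma Xi_cyc:
  "Xi lam mu rho (cyc vs ds) =
    (\<Prod>i<l. coef lam mu (ds ! i)) * (\<Prod>i<l. if ds ! i = ds ! (Suc i mod l) then 1 else rho)"
proof -
  have "(\<Prod>i<l. if ds ! i = ds ! (Suc i mod l) then 1 else rho) = rho ^ card {i. i < l \<and> ds ! i \<noteq> ds ! (Suc i mod l)}"
    by (subst prod.If_cases) (auto intro!: arg_cong[where f = "\<lambda>A. rho ^ card A"])
  then show ?thesis
    by (simp add: Xi_def prod_coef card_edges_of_cyc card_diff_cyc)
qed

end

section \<open>Cycles in the complete graph and sums over isomorphism classes\<close>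

definition cycles :: "nat \<Rightarrow> nat \<Rightarrow> nat dgraph set" where
  "cycles n l = {S \<in> subgraphs_K n. decorated_cycle l S}"

definition dlists :: "nat \<Rightarrow> nat \<Rightarrow> nat list set" where
  "dlists n l = {vs. distinct vs \<and> length vs = l \<and> set vs \<subseteq> {..<n}}"

lemma finite_dlists [simp]: "finite (dlists n l)"
  by (rule finite_subset[OF _ finite_lists_length_eq[of "{..<n}" l]]) (auto simp: dlists_def)

lemma UNIV_decoration: "(UNIV :: decoration set) = {Bullet, Circ}"
  using decoration.exhaust by auto

lemma finite_UNIV_decoration [simp]: "finite (UNIV :: decoration set)"
  unfolding UNIV_decoration by simp

lemma finite_decoration_lists [simp]: "finite {ds :: decoration list. length ds = l}"
  using finite_lists_length_eq[of "UNIV :: decoration set" l] by simp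

lemma cycles_eq:
  assumes "3 \<le> l"
  shows "cycles n l = (\<lambda>(vs, ds). cyc vs ds) ` (dlists n l \<times> {ds. length ds = l})"
proof
  show "cycles n l \<subseteq> (\<lambda>(vs, ds). cyc vs ds) ` (dlists n l \<times> {ds. length ds = l})"
    unfolding cycles_def subgraphs_K_def dlists_def by (auto elim!: decorated_cycleE)
  show "(\<lambda>(vs, ds). cyc vs ds) ` (dlists n l \<times> {ds. length ds = l}) \<subseteq> cycles n l"
    using decorated_cycle_cyc[OF _ _ _ assms] decorated_graph_cyc[OF _ _ _ assms]
    by (auto simp: cycles_def subgraphs_K_def dlists_def)
qed

lemma finite_cycles: "3 \<le> l \<Longrightarrow> finite (cycles n l)"
  by (simp add: cycles_eq)

lemma decorated_cycle_iso:
  assumes "decorated_cycle l H" "decorated_graph G" "G \<simeq>\<^sub>d H"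
  shows "decorated_cycle l G" "Xi lam mu rho G = Xi lam mu rho H"
proof -
  have l: "3 \<le> l" using assms(1) by (simp add: decorated_cycle_def)
  obtain vs ds where v: "distinct vs" "length vs = l" "length ds = l" and H: "H = cyc vs ds"
    using decorated_cycleE[OF assms(1)] by metis
  obtain h where "dgraph_iso h (cyc vs ds) G"
    using isomorphic_sym[OF assms(3)] H by (auto simp: isomorphic_def)
  then have G: "G = cyc (map h vs) ds" and d: "distinct (map h vs)" "length (map h vs) = l"
    using dgraph_iso_cycD[OF _ assms(2) v l] v by auto
  show "decorated_cycle l G" unfolding G by (rule decorated_cycle_cyc[OF d v(3) l])
  show "Xi lam mu rho G = Xi lam mu rho H"
    unfolding G H Xi_cyc[OF d v(3) l] Xi_cyc[OF v l] ..
qed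

lemma cycle_classes_rep:
  assumes "K \<in> cycle_classes l"
  shows "decorated_cycle l (rep K)" "iso_class (rep K) = K"
proof -
  obtain H where H: "K = iso_class H" "decorated_cycle l H"
    using assms by (auto simp: cycle_classes_def)
  then have "H \<in> K" by (auto simp: iso_class_def decorated_cycle_def isomorphic_refl)
  then have "rep K \<in> K" unfolding rep_def by (rule someI)
  then have r: "decorated_graph (rep K)" "rep K \<simeq>\<^sub>d H" using H by (auto simp: iso_class_def)
  then show "decorated_cycle l (rep K)" using decorated_cycle_iso H by blast
  show "iso_class (rep K) = K"
    using r isomorphic_trans isomorphic_sym unfolding H iso_class_def by blast
qed

lemma copies_eq:
  assumes "K \<in> cycle_classes l"
  shows "{S \<in> subgraphs_K n. S \<simeq>\<^sub>d rep K} = {S \<in> cycles n l. iso_class S = K}"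
proof -
  note r = cycle_classes_rep[OF assms]
  have "decorated_cycle l S \<and> iso_class S = K" if "S \<in> subgraphs_K n" "S \<simeq>\<^sub>d rep K" for S
  proof
    have g: "decorated_graph S" using that by (simp add: subgraphs_K_def)
    show "decorated_cycle l S" using decorated_cycle_iso[OF r(1) g that(2)] by simp
    show "iso_class S = K"
      using that isomorphic_trans isomorphic_sym r(2) unfolding iso_class_def by blast
  qed
  moreover have "S \<simeq>\<^sub>d rep K" if "S \<in> cycles n l" "iso_class S = K" for S
  proof -
    have "S \<in> iso_class S" using that
      by (auto simp: cycles_def iso_class_def decorated_cycle_def isomorphic_refl)
    then show ?thesis using that(2) r(2) by (auto simp: iso_class_def)
  qed
  ultimately show ?thesis by (auto simp: cycles_def)
qed

lemma ex_map_eq: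
  assumes "distinct us" "length us = length vs"
  obtains g where "map g us = vs"
proof
  show "map (\<lambda>x. the (map_of (zip us vs) x)) us = vs"
    using assms by (intro nth_equalityI) (auto simp: map_of_zip_nth)
qed

text \<open>There are infinitely many cycles on the naturals, but relabelling the vertices by
  \<open>[0..<l]\<close> puts a member of every class into the finite set \<open>cycles l l\<close>.
  Finiteness matters because a sum over an infinite set is 0 by default.\<close>

lemma finite_cycle_classes:
  assumes "3 \<le> l"
  shows "finite (cycle_classes l)"
proof (rule finite_subset)
  show "cycle_classes l \<subseteq> iso_class ` cycles l l"
  proof
    fix K assume "K \<in> cycle_classes l"
    then obtain H where K: "K = iso_class H" and H: "decorated_cycle l H"
      by (auto simp: cycle_classes_def)
    obtain vs ds where v: "distinct vs" "length vs = l" "length ds = l" and Hc: "H = cyc vs ds"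
      using decorated_cycleE[OF H] by metis
    obtain g where g: "map g vs = [0..<l]"
      using ex_map_eq[of vs "[0..<l]"] v by auto
    then have "inj_on g (set vs)" by (metis distinct_map distinct_upt)
    from dgraph_iso_cyc_map[OF this v assms] have i: "H \<simeq>\<^sub>d cyc [0..<l] ds"
      unfolding g Hc isomorphic_def by blast
    have "iso_class H = iso_class (cyc [0..<l] ds)"
      using i isomorphic_trans isomorphic_sym unfolding iso_class_def by blast
    moreover have "cyc [0..<l] ds \<in> cycles l l"
      unfolding cycles_eq[OF assms] dlists_def using v by force
    ultimately show "K \<in> iso_class ` cycles l l" using K by blast
  qed
qed (simp add: finite_cycles assms)

lemma sum_cycle_classes:
  fixes f :: "nat dgraph \<Rightarrow> real"
  assumes "3 \<le> l"
  shows "(\<Sum>K\<in>cycle_classes l. \<Sum>S\<in>{S \<in> subgraphs_K n. S \<simeq>\<^sub>d rep K}. f S) = (\<Sum>S\<in>cycles n l. f S)"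
proof -
  have "(\<Sum>K\<in>cycle_classes l. \<Sum>S\<in>{S \<in> subgraphs_K n. S \<simeq>\<^sub>d rep K}. f S)
      = (\<Sum>K\<in>cycle_classes l. \<Sum>S\<in>{S \<in> cycles n l. iso_class S = K}. f S)"
    by (rule sum.cong) (simp_all add: copies_eq)
  also have "\<dots> = (\<Sum>S\<in>cycles n l. f S)"
    by (rule sum.group[OF finite_cycles[OF assms] finite_cycle_classes[OF assms]])
      (auto simp: cycles_def cycle_classes_def)
  finally show ?thesis .
qed

lemma Xi_copy:
  assumes "K \<in> cycle_classes l" "S \<in> subgraphs_K n" "S \<simeq>\<^sub>d rep K"
  shows "Xi lam mu rho S = Xi lam mu rho (rep K)"
  using decorated_cycle_iso(2)[OF cycle_classes_rep(1)[OF assms(1)] _ assms(3)] assms(2)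
  by (auto simp: subgraphs_K_def)

text \<open>\<open>Xi\<close> is an isomorphism invariant and the copies of the classes partition
  the cycles in the complete graph, so the double sum collapses. Classes survive only inside
  \<open>beta\<close>.\<close>

lemma f_cycle_eq:
  assumes "3 \<le> l"
  shows "f_cycle lam mu rho l n XY =
    1 / sqrt (real n ^ l * beta lam mu rho l) * (\<Sum>S\<in>cycles n l. Xi lam mu rho S * f_sub S XY)"
  unfolding f_cycle_def sum_cycle_classes[OF assms, where n = n, symmetric] sum_distrib_left
  by (intro sum.cong refl arg_cong2[where f = "(*)"]) (auto intro: Xi_copy[symmetric])

text \<open>Orbit counting. With a presentation of \<open>H\<close> fixed, the lists in
  \<open>dlists n l\<close> are the embeddings of \<open>H\<close>; the image of each is a copy of
  \<open>H\<close>, and the embeddings onto one copy form a torsor under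
  \<open>Aut H\<close>.\<close>

lemma card_Aut_times_copies:
  assumes H: "decorated_cycle l H"
  shows "card (dlists n l) = card (Aut H) * card {S \<in> subgraphs_K n. S \<simeq>\<^sub>d H}"
proof -
  have l: "3 \<le> l" using H by (simp add: decorated_cycle_def)
  obtain us ds where u: "distinct us" "length us = l" "length ds = l" and Hc: "H = cyc us ds"
    using decorated_cycleE[OF H] by metis
  let ?C = "{S \<in> subgraphs_K n. S \<simeq>\<^sub>d H}" and ?D = "dlists n l"
  have isoD: "dgraph_iso g H (cyc (map g us) ds)" if "map g us \<in> ?D" for g
    unfolding Hc using that by (intro dgraph_iso_cyc_map[OF _ u l]) (auto simp: dlists_def distinct_map)
  have fib: "card {vs \<in> ?D. cyc vs ds = S} = card (Aut H)" if S: "S \<in> ?C" for S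
  proof -
    have gS: "decorated_graph S" "verts S \<subseteq> {..<n}" using S by (auto simp: subgraphs_K_def)
    obtain h where h: "dgraph_iso h H S"
      using S isomorphic_sym by (auto simp: isomorphic_def)
    then have bh: "bij_betw h (set us) (verts S)" by (simp add: dgraph_iso_def Hc)
    \<comment> \<open>One isomorphism \<open>h\<close> onto \<open>S\<close> is fixed; every other
      one is \<open>h\<close> after an automorphism.\<close>
    have "bij_betw (\<lambda>\<alpha>. map (h \<circ> \<alpha>) us) (Aut H) {vs \<in> ?D. cyc vs ds = S}"
      unfolding bij_betw_def
    proof
      show "inj_on (\<lambda>\<alpha>. map (h \<circ> \<alpha>) us) (Aut H)"
      proof (rule inj_onI)
        fix \<alpha> \<alpha>' assume a: "\<alpha> \<in> Aut H" "\<alpha>' \<in> Aut H" "map (h \<circ> \<alpha>) us = map (h \<circ> \<alpha>') us"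
        then have p: "\<alpha> permutes set us" "\<alpha>' permutes set us" by (auto simp: Aut_def Hc)
        show "\<alpha> = \<alpha>'"
        proof
          fix x show "\<alpha> x = \<alpha>' x"
          proof (cases "x \<in> set us")
            case True
            then have "h (\<alpha> x) = h (\<alpha>' x)" using a(3) by simp
            moreover have "\<alpha> x \<in> set us" "\<alpha>' x \<in> set us" using p True by (simp_all add: permutes_in_image)
            ultimately show ?thesis using bh by (auto simp: bij_betw_def dest: inj_onD)
          next
            case False then show ?thesis using p by (simp add: permutes_def)
          qed
        qed
      qed
      show "(\<lambda>\<alpha>. map (h \<circ> \<alpha>) us) ` Aut H = {vs \<in> ?D. cyc vs ds = S}" (is "?L = ?R")
      proof
        show "?L \<subseteq> ?R"
        proof
          fix vs assume "vs \<in> ?L"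
          then obtain \<alpha> where a: "\<alpha> \<in> Aut H" "vs = map (h \<circ> \<alpha>) us" by blast
          then have "dgraph_iso (h \<circ> \<alpha>) H S" using h by (auto simp: Aut_def intro: dgraph_iso_comp)
          then have "S = cyc vs ds" "distinct vs"
            using dgraph_iso_cycD[of "h \<circ> \<alpha>" us ds S l] gS u l unfolding Hc a by auto
          moreover from this have "set vs \<subseteq> {..<n}" using gS by simp
          ultimately show "vs \<in> ?R" using a(2) u by (simp add: dlists_def)
        qed
        show "?R \<subseteq> ?L"
        proof
          fix vs assume vs: "vs \<in> ?R"
          then have lv: "length us = length vs" using u by (simp add: dlists_def)
          obtain g where g: "map g us = vs" using ex_map_eq[OF u(1) lv] .
          have ig: "dgraph_iso g H S" using isoD[of g] g vs by simp
          let ?k = "inv_into (verts H) h"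
          \<comment> \<open>\<open>Aut\<close> consists of permutations of the whole type, so
            \<alpha> has to be the identity off the vertices.\<close>
          define \<alpha> where "\<alpha> = (\<lambda>x. if x \<in> set us then ?k (g x) else x)"
          have "dgraph_iso (?k \<circ> g) H H"
            using ig dgraph_iso_inv[OF h] by (rule dgraph_iso_comp)
          then have ia: "dgraph_iso \<alpha> H H"
            by (rule dgraph_iso_cong) (simp add: \<alpha>_def Hc)
          then have "bij_betw \<alpha> (set us) (set us)" by (simp add: dgraph_iso_def Hc)
          then have "\<alpha> permutes set us" by (rule bij_imp_permutes) (simp add: \<alpha>_def)
          then have "\<alpha> \<in> Aut H" using ia by (simp add: Aut_def Hc)
          moreover have "h (\<alpha> x) = g x" if "x \<in> set us" for x
          proof -
            have "g x \<in> verts S" using dgraph_isoD(1)[OF ig] that by (auto simp: Hc)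
            then show ?thesis using that bh unfolding \<alpha>_def
              by (simp add: Hc bij_betw_def f_inv_into_f)
          qed
          then have "vs = map (h \<circ> \<alpha>) us" using g by auto
          ultimately show "vs \<in> ?L" by blast
        qed
      qed
    qed
    from bij_betw_same_card[OF this] show ?thesis by simp
  qed
  have "(\<lambda>vs. cyc vs ds) ` ?D \<subseteq> ?C"
  proof
    fix S assume "S \<in> (\<lambda>vs. cyc vs ds) ` ?D"
    then obtain vs where vs: "vs \<in> ?D" "S = cyc vs ds" by blast
    then obtain g where g: "map g us = vs" using ex_map_eq[OF u(1), of vs] u by (auto simp: dlists_def)
    then have "H \<simeq>\<^sub>d S" using isoD[of g] vs by (auto simp: isomorphic_def)
    moreover have "decorated_graph S" "verts S \<subseteq> {..<n}"
      using vs decorated_graph_cyc[of vs l ds] u l by (auto simp: dlists_def)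
    ultimately show "S \<in> ?C" by (simp add: isomorphic_sym subgraphs_K_def)
  qed
  moreover have "?C \<subseteq> cycles n l"
    using decorated_cycle_iso(1)[OF H] by (auto simp: cycles_def subgraphs_K_def)
  then have "finite ?C" using finite_cycles[OF l] finite_subset by blast
  ultimately have "(\<Sum>S\<in>?C. \<Sum>vs\<in>{vs \<in> ?D. cyc vs ds = S}. 1) = (\<Sum>vs\<in>?D. 1::nat)"
    by (intro sum.group) auto
  then show ?thesis by (simp add: fib mult.commute)
qed

text \<open>\<open>card_Aut_times_copies\<close> trades the reciprocal of the automorphism count for
  the number of copies. Since \<open>beta\<close> does not depend on \<open>n\<close>, the identity
  can be read at the given \<open>n\<close> for the moments and at \<open>n = l\<close> for the
  growth of \<open>beta\<close>.\<close>

lemma beta_times_card: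
  assumes "3 \<le> l"
  shows "beta lam mu rho l * card (dlists n l) = (\<Sum>S\<in>cycles n l. (Xi lam mu rho S)\<^sup>2)"
proof -
  have "(Xi lam mu rho (rep K))\<^sup>2 / real (card (Aut (rep K))) * real (card (dlists n l))
    = (\<Sum>S\<in>{S \<in> subgraphs_K n. S \<simeq>\<^sub>d rep K}. (Xi lam mu rho S)\<^sup>2)" if K: "K \<in> cycle_classes l" for K
  proof -
    let ?C = "{S \<in> subgraphs_K n. S \<simeq>\<^sub>d rep K}"
    have dc: "decorated_cycle l (rep K)" using cycle_classes_rep(1)[OF K] .
    then have "finite (verts (rep K))" by (simp add: decorated_cycle_def decorated_graph_def)
    then have "finite (Aut (rep K))" "id \<in> Aut (rep K)"
      using finite_subset[OF _ finite_permutations, of "Aut (rep K)"]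
      by (auto simp: Aut_def permutes_id dgraph_iso_refl)
    then have "card (Aut (rep K)) \<noteq> 0" by auto
    then have "(Xi lam mu rho (rep K))\<^sup>2 / real (card (Aut (rep K))) * real (card (dlists n l))
      = (Xi lam mu rho (rep K))\<^sup>2 * card ?C"
      using card_Aut_times_copies[OF dc, of n] by simp
    also have "\<dots> = (\<Sum>S\<in>?C. (Xi lam mu rho (rep K))\<^sup>2)" by simp
    also have "\<dots> = (\<Sum>S\<in>?C. (Xi lam mu rho S)\<^sup>2)"
      using Xi_copy[OF K] by (intro sum.cong) auto
    finally show ?thesis .
  qed
  then show ?thesis
    unfolding sum_cycle_classes[OF assms, where n = n, symmetric] beta_def sum_distrib_right
    by (intro sum.cong refl) simp
qed

section \<open>Overlaps and growth of the normalisation\<close>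

text \<open>A slot names one entry of one of the two matrices. The same edge with two decorations
  gives two independent normals, so the overlap of two cycles is counted in slots and not in
  edges.\<close>

definition slots :: "'a dgraph \<Rightarrow> (decoration \<times> 'a set) set" where
  "slots S = {(d, e). dec S e = Some d}"

lemma Suc_mod_closed:
  assumes "I \<subseteq> {..<l}" "I \<noteq> {}" "\<And>i. i \<in> I \<Longrightarrow> Suc i mod l \<in> I"
  shows "I = {..<l}"
proof
  obtain i where i: "i \<in> I" using assms(2) by blast
  then have il: "i < l" using assms(1) by auto
  have "(i + m) mod l \<in> I" for m
  proof (induction m)
    case 0 then show ?case using i il by simp
  next
    case (Suc m)
    from assms(3)[OF this] show ?case by (simp add: mod_Suc_eq)
  qed
  \<comment> \<open>Starting at \<open>i\<close>, the rotation reaches \<open>j\<close> after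
    \<open>l - i + j\<close> steps.\<close>
  from this[of "l - i + _"] show "{..<l} \<subseteq> I"
  proof (intro subsetI)
    fix j assume "\<And>j. (i + (l - i + j)) mod l \<in> I" and j: "j \<in> {..<l}"
    from this(1)[of j] show "j \<in> I" using il j by simp
  qed
qed (fact assms(1))

context
  fixes vs :: "'a list" and ds :: "decoration list" and l :: nat
  assumes vs: "distinct vs" "length vs = l" and ds: "length ds = l" and l: "3 \<le> l"
begin

lemma slots_cyc: "slots (cyc vs ds) = (\<lambda>i. (ds ! i, cyc_edge vs i)) ` {..<l}"
  unfolding slots_def by (auto simp: dec_cyc_iff[OF vs ds l])

lemma inj_on_slot: "inj_on (\<lambda>i. (ds ! i, cyc_edge vs i)) {..<l}"
  using inj_on_cyc_edge[OF vs(1)] vs(2) l by (auto simp: inj_on_def)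

lemma card_slots_cyc: "card (slots (cyc vs ds)) = l"
  by (simp add: slots_cyc card_image inj_on_slot)

lemma Union_slots_cyc: "\<Union> (snd ` slots (cyc vs ds)) = set vs"
  by (auto simp: slots_cyc image_image cyc_edge_def vs set_conv_nth)

end

lemma cyclesE:
  assumes "S \<in> cycles n l" "3 \<le> l"
  obtains vs ds where "distinct vs" "length vs = l" "length ds = l" "set vs \<subseteq> {..<n}" "S = cyc vs ds"
  using assms by (auto simp: cycles_eq dlists_def)

text \<open>A cycle has no isolated vertices, so its slots determine its vertex set as well.\<close>

lemma slots_eqD:
  assumes "S \<in> cycles n l" "T \<in> cycles n l" "3 \<le> l" "slots S = slots T"
  shows "S = T"
proof -
  have v: "verts S = \<Union> (snd ` slots S)" if "S \<in> cycles n l" for S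
    using cyclesE[OF that assms(3)] Union_slots_cyc[OF _ _ _ assms(3)] by (metis verts_cyc)
  show ?thesis
  proof (rule decorated_graph_eqI)
    show "verts S = verts T" using v assms by metis
    show "dec S e = Some d \<longleftrightarrow> dec T e = Some d" for e d
      using assms(4) by (auto simp: slots_def set_eq_iff)
  qed
qed

lemma card_slots: "S \<in> cycles n l \<Longrightarrow> 3 \<le> l \<Longrightarrow> card (slots S) = l"
  by (metis cyclesE card_slots_cyc)

lemma finite_slots: "S \<in> cycles n l \<Longrightarrow> 3 \<le> l \<Longrightarrow> finite (slots S)"
  by (metis card_slots card.infinite not_numeral_le_zero)

lemma card_verts_cycle: "S \<in> cycles n l \<Longrightarrow> 3 \<le> l \<Longrightarrow> card (verts S) = l"
  by (metis cyclesE verts_cyc distinct_card)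

lemma slots_edge:
  assumes "S \<in> cycles n l" "(d, e) \<in> slots S"
  shows "e \<subseteq> verts S" "card e = 2"
  using assms by (auto simp: cycles_def decorated_cycle_def decorated_graph_def slots_def edges_def)

text \<open>A vertex set meeting a cycle in \<open>k \<ge> 1\<close> vertices spans at most \<open>k - 1\<close> of its edges, unless
  it contains the whole cycle.\<close>
lemma card_common_slots:
  assumes S: "S \<in> cycles n l" and T: "T \<in> cycles n l" and l: "3 \<le> l"
    and neq: "S \<noteq> T" and int: "verts S \<inter> verts T \<noteq> {}"
  shows "card (slots S \<inter> slots T) < card (verts S \<inter> verts T)"
proof -
  obtain vs ds where v: "distinct vs" "length vs = l" "length ds = l" and Sc: "S = cyc vs ds"
    using cyclesE[OF S l] by metis
  define I where "I = {i. i < l \<and> vs ! i \<in> verts T}"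
  define J where "J = {i. i < l \<and> (ds ! i, cyc_edge vs i) \<in> slots T}"
  have "slots S \<inter> slots T = (\<lambda>i. (ds ! i, cyc_edge vs i)) ` J"
    unfolding Sc slots_cyc[OF v l] J_def by auto
  then have cJ: "card (slots S \<inter> slots T) = card J"
    using inj_on_subset[OF inj_on_slot[OF v l]] by (simp add: J_def card_image subset_iff)
  have sI: "verts S \<inter> verts T = nth vs ` I"
    unfolding I_def using v by (auto simp: Sc in_set_conv_nth)
  then have cI: "card (verts S \<inter> verts T) = card I"
    using v by (simp add: I_def card_image inj_on_nth)
  have JI: "i \<in> I \<and> Suc i mod l \<in> I" if "i \<in> J" for i
    using slots_edge(1)[OF T, of "ds ! i" "cyc_edge vs i"] that v
    by (auto simp: I_def J_def cyc_edge_def)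
  \<comment> \<open>A common slot has both endpoints common, so \<open>J = I\<close> would make
    \<open>I\<close> closed under the cyclic successor, hence everything; then all slots are common
    and the cycles coincide.\<close>
  have "J \<noteq> I"
  proof
    assume "J = I"
    moreover have "I \<noteq> {}" using int sI by auto
    ultimately have "J = {..<l}"
      using Suc_mod_closed[of I l] JI by (auto simp: I_def)
    then have "card (slots S \<inter> slots T) = l" using cJ by simp
    then have "slots S \<inter> slots T = slots S" "slots S \<inter> slots T = slots T"
      using card_slots[OF S l] card_slots[OF T l] finite_slots[OF S l] finite_slots[OF T l]
      by (metis card_subset_eq inf_le1, metis card_subset_eq inf_le2)
    then show False using slots_eqD[OF S T l] neq by simp
  qed
  moreover have "finite I" by (simp add: I_def)
  ultimately have "card J < card I" using JI by (intro psubset_card_mono) auto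
  then show ?thesis using cI cJ by simp
qed

section \<open>Counting vertex sequences and cycles\<close>

lemma sum_lists_Suc:
  fixes f :: "'a list \<Rightarrow> 'b::comm_monoid_add"
  shows "(\<Sum>xs | set xs \<subseteq> A \<and> length xs = Suc l. f xs) =
    (\<Sum>x\<in>A. \<Sum>xs | set xs \<subseteq> A \<and> length xs = l. f (x # xs))"
proof -
  let ?L = "{xs. set xs \<subseteq> A \<and> length xs = l}"
  have "{xs. set xs \<subseteq> A \<and> length xs = Suc l} = (\<lambda>(x, xs). x # xs) ` (A \<times> ?L)"
    by (auto simp: length_Suc_conv image_iff)
  then have "(\<Sum>xs | set xs \<subseteq> A \<and> length xs = Suc l. f xs) = (\<Sum>p\<in>A \<times> ?L. f (fst p # snd p))"
    by (simp add: sum.reindex inj_on_def case_prod_unfold)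
  also have "\<dots> = (\<Sum>x\<in>A. \<Sum>xs\<in>?L. f (x # xs))"
    by (simp add: sum.cartesian_product case_prod_unfold)
  finally show ?thesis .
qed

lemma sum_prod_list:
  fixes g :: "'a \<Rightarrow> 'b::comm_semiring_1"
  shows "(\<Sum>xs | set xs \<subseteq> A \<and> length xs = l. prod_list (map g xs)) = (\<Sum>x\<in>A. g x) ^ l"
proof (induction l)
  case 0
  have "{xs. set xs \<subseteq> A \<and> length xs = 0} = {[]}" by auto
  then show ?case by simp
next
  case (Suc l)
  then show ?case
    by (simp add: sum_lists_Suc flip: sum_distrib_left sum_distrib_right)
qed

lemma card_decoration_lists: "card {ds :: decoration list. length ds = l} = 2 ^ l"
proof -
  have "card (UNIV :: decoration set) = 2" unfolding UNIV_decoration by simp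
  then show ?thesis
    using card_lists_length_eq[of "UNIV :: decoration set" l] by simp
qed

lemma card_dlists_le: "card (dlists n l) \<le> n ^ l"
  using card_mono[OF finite_lists_length_eq[of "{..<n}" l], of "dlists n l"]
  by (auto simp: dlists_def card_lists_length_eq)

lemma card_dlists_ge:
  assumes "l \<le> n"
  shows "(n - l) ^ l \<le> card (dlists n l)"
proof -
  have "(n - l) ^ l = (\<Prod>i\<in>{n - l + 1..n}. n - l)" using assms by simp
  also have "\<dots> \<le> \<Prod>{n - l + 1..n}" by (intro prod_mono) auto
  also have "\<dots> = card (dlists n l)"
    unfolding dlists_def using assms
    using card_lists_distinct_length_eq[of "{..<n}" l] by (simp add: conj_commute conj_left_commute)
  finally show ?thesis .
qed

text \<open>Each cycle has at least one presentation, so presentations overcount;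
  \<open>sum_sequences_le\<close> limits the overcount to \<open>l^2\<close>.\<close>

lemma sum_cycles_le:
  fixes f :: "nat dgraph \<Rightarrow> real"
  assumes "3 \<le> l" "\<And>S. f S \<ge> 0"
  shows "(\<Sum>S\<in>cycles n l. f S) \<le> (\<Sum>vs\<in>dlists n l. \<Sum>ds | length ds = l. f (cyc vs ds))"
proof -
  have "(\<Sum>S\<in>cycles n l. f S) \<le> sum (f \<circ> (\<lambda>(vs, ds). cyc vs ds)) (dlists n l \<times> {ds. length ds = l})"
    unfolding cycles_eq[OF assms(1)] using assms(2) by (intro sum_image_le) auto
  then show ?thesis by (simp add: sum.cartesian_product o_def case_prod_unfold)
qed

lemma card_cycles_le:
  assumes "3 \<le> l"
  shows "real (card (cycles n l)) \<le> (2 * real n) ^ l"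
proof -
  have "real (card (cycles n l)) \<le> real (card (dlists n l)) * 2 ^ l"
    using sum_cycles_le[OF assms, of "\<lambda>_. 1" n] by (simp add: card_decoration_lists)
  also have "\<dots> \<le> real n ^ l * 2 ^ l"
    using card_dlists_le[of n l] by (intro mult_right_mono) (simp_all flip: of_nat_power)
  finally show ?thesis by (simp add: power_mult_distrib mult.commute)
qed

text \<open>The weight factorises along the vertex sequence: \<open>n\<close> for a vertex in
  \<open>V\<close>, 1 otherwise. Once distinctness is dropped, the sum is the \<open>l\<close>-th
  power of the one-vertex sum, at most \<open>l n + n\<close>: a vertex forced into \<open>V\<close>
  has \<open>l\<close> choices instead of \<open>n\<close>, which pays for its weight. The factor 2
  per position counts decorations.\<close>

lemma sum_cycles_overlap_le:
  assumes l: "3 \<le> l" and V: "finite V" "card V \<le> l" and n: "1 \<le> n"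
  shows "(\<Sum>T\<in>cycles n l. real n ^ card (V \<inter> verts T)) \<le> (2 * real n * (real l + 1)) ^ l"
proof -
  define g where "g x = (if x \<in> V then real n else 1)" for x
  have eq: "real n ^ card (V \<inter> set vs) = prod_list (map g vs)" if "vs \<in> dlists n l" for vs
  proof -
    have "prod_list (map g vs) = (\<Prod>x\<in>set vs. g x)"
      using that by (simp add: dlists_def prod.distinct_set_conv_list)
    also have "\<dots> = real n ^ card (V \<inter> set vs)"
      unfolding g_def by (subst prod.If_cases) (auto simp: Int_commute)
    finally show ?thesis by simp
  qed
  have g0: "g x \<ge> 0" for x by (simp add: g_def)
  have "(\<Sum>T\<in>cycles n l. real n ^ card (V \<inter> verts T))
      \<le> (\<Sum>vs\<in>dlists n l. 2 ^ l * prod_list (map g vs))"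
    using sum_cycles_le[OF l, of "\<lambda>T. real n ^ card (V \<inter> verts T)" n]
    by (simp add: card_decoration_lists eq)
  also have "\<dots> \<le> 2 ^ l * (\<Sum>vs | set vs \<subseteq> {..<n} \<and> length vs = l. prod_list (map g vs))"
    unfolding sum_distrib_left[symmetric] using g0
    by (intro mult_left_mono sum_mono2 finite_lists_length_eq)
      (auto simp: dlists_def intro!: prod_list_nonneg)
  also have "\<dots> = 2 ^ l * (\<Sum>x<n. g x) ^ l"
    by (simp add: sum_prod_list)
  also have "\<dots> \<le> 2 ^ l * (real n * (real l + 1)) ^ l"
  proof (intro mult_left_mono power_mono)
    have "(\<Sum>x<n. g x) \<le> (\<Sum>x<n. (if x \<in> V then real n else 0) + 1)"
      by (intro sum_mono) (simp add: g_def)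
    also have "\<dots> = real (card ({..<n} \<inter> V)) * real n + real n"
      by (simp add: sum.distrib sum.If_cases)
    also have "real (card ({..<n} \<inter> V)) \<le> real l"
      using V card_mono[of V "{..<n} \<inter> V"] by simp
    finally show "(\<Sum>x<n. g x) \<le> real n * (real l + 1)" by (simp add: algebra_simps mult_right_mono)
  qed (use g0 in \<open>auto intro: sum_nonneg\<close>)
  finally show ?thesis by (simp add: power_mult_distrib mult.assoc)
qed

section \<open>The transfer matrix and the growth of \<open>beta\<close>\<close>

definition cweight :: "real \<Rightarrow> real \<Rightarrow> real \<Rightarrow> decoration \<Rightarrow> decoration \<Rightarrow> real" where
  "cweight lam mu rho a b = (coef lam mu a)\<^sup>2 * (if a = b then 1 else rho\<^sup>2)"

text \<open>Consequently the sum over all decorations is the trace of the \<open>l\<close>-th power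
  of the matrix with rows \<open>(lam^2, lam^2 rho^2)\<close> and
  \<open>(mu^2 rho^2, mu^2)\<close>.\<close>

lemma Xi_cyc_square:
  assumes "distinct vs" "length vs = l" "length ds = l" "3 \<le> l"
  shows "(Xi lam mu rho (cyc vs ds))\<^sup>2 = (\<Prod>i<l. cweight lam mu rho (ds ! i) (ds ! (Suc i mod l)))"
proof -
  have "(\<Prod>i<l. if ds ! i = ds ! (Suc i mod l) then 1 else rho)\<^sup>2
      = (\<Prod>i<l. if ds ! i = ds ! (Suc i mod l) then 1 else rho\<^sup>2)"
    unfolding prod_power_distrib by (intro prod.cong) auto
  then show ?thesis
    unfolding Xi_cyc[OF assms] cweight_def power_mult_distrib prod.distrib
    by (simp add: prod_power_distrib)
qed

text \<open>Once two consecutive vertices agree, so does the next: only two edges of the cycle pass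
  through \<open>vs ! Suc i\<close>, and one of them is already used. Two initial vertices fix both
  the starting point and the direction.\<close>

lemma cyc_inj:
  assumes v: "distinct vs" "length vs = l" "length ds = l" and w: "distinct ws" "length ws = l" "length es = l"
    and l: "3 \<le> l" and eq: "cyc vs ds = cyc ws es" and 0: "vs ! 0 = ws ! 0" and 1: "vs ! 1 = ws ! 1"
  shows "vs = ws \<and> ds = es"
proof -
  have *: "Suc i < l \<longrightarrow> vs ! i = ws ! i \<and> vs ! Suc i = ws ! Suc i" for i
  proof (induction i)
    case 0 then show ?case using assms(9,10) by simp
  next
    case (Suc i)
    show ?case
    proof
      assume i: "Suc (Suc i) < l"
      then have IH: "vs ! i = ws ! i" "vs ! Suc i = ws ! Suc i" using Suc by auto
      have "cyc_edge vs (Suc i) \<in> edges (cyc ws es)"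
        unfolding eq[symmetric] edges_cyc[OF v l] using i by auto
      then obtain j where j: "j < l" "cyc_edge vs (Suc i) = cyc_edge ws j"
        unfolding edges_cyc[OF w l] by auto
      have vi: "cyc_edge vs i = {vs ! i, vs ! Suc i}" "cyc_edge ws i = {ws ! i, ws ! Suc i}"
        "cyc_edge vs (Suc i) = {vs ! Suc i, vs ! Suc (Suc i)}" "cyc_edge ws (Suc i) = {ws ! Suc i, ws ! Suc (Suc i)}"
        using i v w by (simp_all add: cyc_edge_def)
      have "ws ! Suc i \<in> cyc_edge ws j" using j(2) vi IH by auto
      then have "j = Suc i \<or> Suc j mod l = Suc i"
        using w i j(1) by (auto simp: cyc_edge_def nth_eq_iff_index_eq)
      then have "j = Suc i \<or> j = i" using i j(1) by (auto simp: Suc_mod_eq split: if_splits)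
      moreover have "j \<noteq> i"
      proof
        assume "j = i"
        then have "cyc_edge vs (Suc i) = cyc_edge vs i" using j(2) vi IH by simp
        then show False using inj_on_cyc_edge[OF v(1)] v l i by (auto dest: inj_onD)
      qed
      ultimately have "{vs ! Suc i, vs ! Suc (Suc i)} = {ws ! Suc i, ws ! Suc (Suc i)}"
        using j(2) vi by auto
      then show "vs ! Suc i = ws ! Suc i \<and> vs ! Suc (Suc i) = ws ! Suc (Suc i)"
        using IH by (auto simp: doubleton_eq_iff)
    qed
  qed
  have "vs ! i = ws ! i" if "i < l" for i
    using *[of i] *[of "i - 1"] that l by (cases i) auto
  then have vw: "vs = ws" using v w by (intro nth_equalityI) auto
  have "ds ! i = es ! i" if "i < l" for i
    using dec_cyc_edge[OF v l that] dec_cyc_edge[OF w l that] eq vw by simp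
  then show ?thesis using v w vw by (auto intro: nth_equalityI)
qed

text \<open>A decorated sequence is determined by its cycle and its first two vertices.\<close>
lemma sum_sequences_le:
  fixes f :: "nat dgraph \<Rightarrow> real"
  assumes l: "3 \<le> l" and f: "\<And>S. f S \<ge> 0"
  shows "(\<Sum>vs\<in>dlists n l. \<Sum>ds | length ds = l. f (cyc vs ds)) \<le> real l ^ 2 * (\<Sum>S\<in>cycles n l. f S)"
proof -
  let ?P = "dlists n l \<times> {ds. length ds = l}" and ?g = "\<lambda>(vs, ds). cyc vs ds"
  have fib: "card {p \<in> ?P. ?g p = S} \<le> l ^ 2" if S: "S \<in> cycles n l" for S
  proof -
    have "inj_on (\<lambda>(vs, ds). (vs ! 0, vs ! 1)) {p \<in> ?P. ?g p = S}"
    proof (rule inj_onI)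
      fix p q
      assume "p \<in> {p \<in> ?P. ?g p = S}" "q \<in> {p \<in> ?P. ?g p = S}"
        and e: "(case p of (vs, ds) \<Rightarrow> (vs ! 0, vs ! 1)) = (case q of (vs, ds) \<Rightarrow> (vs ! 0, vs ! 1))"
      moreover obtain vs ds ws es where pq: "p = (vs, ds)" "q = (ws, es)" by (cases p; cases q)
      ultimately have "vs = ws \<and> ds = es"
        using l by (intro cyc_inj[of vs l ds ws es]) (auto simp: dlists_def)
      then show "p = q" by (simp add: pq)
    qed
    moreover have "(\<lambda>(vs, ds). (vs ! 0, vs ! 1)) ` {p \<in> ?P. ?g p = S} \<subseteq> verts S \<times> verts S"
      using l by (auto simp: dlists_def intro!: nth_mem)
    moreover have "finite (verts S)" using S by (auto simp: cycles_def decorated_cycle_def decorated_graph_def)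
    ultimately have "card {p \<in> ?P. ?g p = S} \<le> card (verts S \<times> verts S)"
      by (metis (no_types, lifting) card_image card_mono finite_SigmaI)
    then show ?thesis using card_verts_cycle[OF S l] by (simp add: card_cartesian_product power2_eq_square)
  qed
  have "(\<Sum>vs\<in>dlists n l. \<Sum>ds | length ds = l. f (cyc vs ds)) = (\<Sum>p\<in>?P. f (?g p))"
    by (simp add: sum.cartesian_product case_prod_unfold)
  also have "\<dots> = (\<Sum>S\<in>cycles n l. \<Sum>p\<in>{p \<in> ?P. ?g p = S}. f (?g p))"
    by (rule sum.group[symmetric]) (auto simp: finite_cycles l cycles_eq)
  also have "\<dots> = (\<Sum>S\<in>cycles n l. real (card {p \<in> ?P. ?g p = S}) * f S)"
    by (intro sum.cong refl) (simp add: case_prod_unfold)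
  also have "\<dots> \<le> (\<Sum>S\<in>cycles n l. real l ^ 2 * f S)"
    using fib f by (intro sum_mono mult_right_mono) (simp_all flip: of_nat_power)
  finally show ?thesis by (simp add: sum_distrib_left)
qed

lemma sum_UNIV_decoration: "(\<Sum>a\<in>UNIV. f a) = f Bullet + (f Circ :: 'b::comm_monoid_add)"
  unfolding UNIV_decoration by simp

text \<open>The left side is \<open>(T^m u) a\<close> expanded over paths from \<open>a\<close>, so
  this iterates the subinvariance \<open>T u \<ge> \<theta> u\<close>; no eigenvalue is
  computed.\<close>

lemma sum_paths_ge:
  fixes T :: "decoration \<Rightarrow> decoration \<Rightarrow> real"
  assumes T: "\<And>a b. T a b \<ge> 0" and sub: "\<And>a. T a Bullet * u Bullet + T a Circ * u Circ \<ge> \<theta> * u a"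
    and th: "\<theta> \<ge> 0"
  shows "(\<Sum>xs | length xs = m. (\<Prod>i<m. T ((a # xs) ! i) ((a # xs) ! Suc i)) * u (last (a # xs))) \<ge> \<theta> ^ m * u a"
proof (induction m arbitrary: a)
  case (Suc m)
  let ?p = "\<lambda>m a xs. (\<Prod>i<m. T ((a # xs) ! i) ((a # xs) ! Suc i)) * u (last (a # xs))"
  have "\<theta> ^ Suc m * u a = \<theta> ^ m * (\<theta> * u a)" by simp
  also have "\<dots> \<le> \<theta> ^ m * (T a Bullet * u Bullet + T a Circ * u Circ)"
    using sub th by (intro mult_left_mono) auto
  also have "\<dots> = T a Bullet * (\<theta> ^ m * u Bullet) + T a Circ * (\<theta> ^ m * u Circ)"
    by (simp add: algebra_simps)
  also have "\<dots> \<le> T a Bullet * (\<Sum>xs | length xs = m. ?p m Bullet xs) + T a Circ * (\<Sum>xs | length xs = m. ?p m Circ xs)"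
    using Suc T by (intro add_mono mult_left_mono) auto
  also have "\<dots> = (\<Sum>b\<in>UNIV. \<Sum>xs | length xs = m. ?p (Suc m) a (b # xs))"
    unfolding sum_UNIV_decoration prod.lessThan_Suc_shift by (simp add: sum_distrib_left mult.assoc)
  also have "\<dots> = (\<Sum>xs | length xs = Suc m. ?p (Suc m) a xs)"
    using sum_lists_Suc[of "?p (Suc m) a" UNIV m] by simp
  finally show ?case .
qed simp

text \<open>A lower bound for the trace of \<open>T^l\<close>: closing a path of \<open>m\<close>
  steps costs a factor of at least \<open>t\<close>. The end value of \<open>u\<close> is bounded by
  the total \<open>U\<close>, and the same \<open>U\<close> arises from summing
  \<open>\<theta>^m u a\<close> over the starting points, so it cancels.\<close>

lemma sum_closed_paths_ge:
  fixes T :: "decoration \<Rightarrow> decoration \<Rightarrow> real"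
  assumes T: "\<And>a b. T a b \<ge> t" and t: "t \<ge> 0"
    and sub: "\<And>a. T a Bullet * u Bullet + T a Circ * u Circ \<ge> \<theta> * u a"
    and u: "u Bullet > 0" "u Circ > 0" and th: "\<theta> \<ge> 0" and l: "l = Suc m"
  shows "(\<Sum>ds | length ds = l. \<Prod>i<l. T (ds ! i) (ds ! (Suc i mod l))) \<ge> t * \<theta> ^ m"
proof -
  have T0: "T a b \<ge> 0" for a b using T[of a b] t by simp
  let ?q = "\<lambda>a xs. \<Prod>i<m. T ((a # xs) ! i) ((a # xs) ! Suc i)"
  define U where "U = u Bullet + u Circ"
  have uU: "u a \<le> U" for a using u by (cases a) (auto simp: U_def)
  have U0: "U > 0" using u by (simp add: U_def)
  have q0: "?q a xs \<ge> 0" for a xs using T0 by (intro prod_nonneg) auto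
  have "t * \<theta> ^ m * U = t * (\<Sum>a\<in>UNIV. \<theta> ^ m * u a)"
    by (simp add: sum_UNIV_decoration U_def algebra_simps)
  also have "\<dots> \<le> t * (\<Sum>a\<in>UNIV. \<Sum>xs | length xs = m. ?q a xs * u (last (a # xs)))"
    using sum_paths_ge[of T \<theta> u m, OF T0 sub th] t by (intro mult_left_mono sum_mono) auto
  also have "\<dots> \<le> t * (\<Sum>a\<in>UNIV. \<Sum>xs | length xs = m. ?q a xs * U)"
    using uU t q0 by (intro mult_left_mono sum_mono) auto
  also have "\<dots> = U * (\<Sum>a\<in>UNIV. \<Sum>xs | length xs = m. ?q a xs * t)"
    by (simp add: sum_distrib_left sum_distrib_right algebra_simps)
  also have "\<dots> \<le> U * (\<Sum>a\<in>UNIV. \<Sum>xs | length xs = m. ?q a xs * T ((a # xs) ! m) a)"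
    using U0 q0 T by (intro mult_left_mono sum_mono) auto
  also have "(\<Sum>a\<in>UNIV. \<Sum>xs | length xs = m. ?q a xs * T ((a # xs) ! m) a)
    = (\<Sum>a\<in>UNIV. \<Sum>xs | length xs = m. \<Prod>i<Suc m. T ((a # xs) ! i) ((a # xs) ! (Suc i mod Suc m)))"
    by (intro sum.cong refl) (simp del: nth_Cons_Suc)
  also have "\<dots> = (\<Sum>ds | length ds = Suc m. \<Prod>i<Suc m. T (ds ! i) (ds ! (Suc i mod Suc m)))"
    using sum_lists_Suc[of "\<lambda>ds. \<Prod>i<Suc m. T (ds ! i) (ds ! (Suc i mod Suc m))" UNIV m] by simp
  finally show ?thesis using U0 l by (simp add: mult.commute)
qed

text \<open>With \<open>lam, mu \<le> 1\<close> only the third entry of the maximum can exceed 1.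
  Both of its fractions are at most 1, so neither vanishes; clearing denominators leaves
  \<open>det (I - T) < 0\<close> for the transfer matrix \<open>T\<close>.\<close>

lemma F_gt_1_imp:
  fixes lam mu rho :: real
  assumes "lam \<in> {0..1}" "mu \<in> {0..1}" "rho \<in> {0<..<1}" "F lam mu rho 1 > 1"
  shows "lam > 0" "mu > 0" "(1 - lam\<^sup>2) * (1 - mu\<^sup>2) < lam\<^sup>2 * rho\<^sup>2 * (mu\<^sup>2 * rho\<^sup>2)"
proof -
  define p q A B where "p = 1 - lam\<^sup>2" and "q = 1 - mu\<^sup>2" and "A = lam\<^sup>2 * rho\<^sup>2" and "B = mu\<^sup>2 * rho\<^sup>2"
  have le: "lam\<^sup>2 \<le> 1" "mu\<^sup>2 \<le> 1" using assms by (auto simp: power_le_one)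
  then have "\<not> lam\<^sup>2 / 1 > 1" "\<not> mu\<^sup>2 / 1 > 1" by auto
  moreover have "1 < lam\<^sup>2 / 1 \<or> 1 < mu\<^sup>2 / 1 \<or> 1 < A / (p + A) + B / (q + B)"
    using assms(4) by (auto simp: F_def Max_gr_iff p_def q_def A_def B_def)
  ultimately have gt: "1 < A / (p + A) + B / (q + B)" by blast
  have nn: "p \<ge> 0" "q \<ge> 0" "A \<ge> 0" "B \<ge> 0" using le by (auto simp: p_def q_def A_def B_def)
  have l1: "A / (p + A) \<le> 1" "B / (q + B) \<le> 1" using nn by (auto simp: divide_le_eq_1)
  have "A \<noteq> 0" "B \<noteq> 0" using gt l1 by auto
  then have AB: "A > 0" "B > 0" using nn by auto
  then show "lam > 0" "mu > 0" using assms(1,2) by (auto simp: A_def B_def zero_less_mult_iff less_le)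
  have "p + A > 0" "q + B > 0" using nn AB by auto
  then have "(p + A) * (q + B) < A * (q + B) + B * (p + A)"
    using gt by (simp add: add_frac_eq[OF less_imp_neq[symmetric] less_imp_neq[symmetric]] less_divide_eq)
  then have "p * q < A * B" by (simp add: algebra_simps)
  then show "(1 - lam\<^sup>2) * (1 - mu\<^sup>2) < lam\<^sup>2 * rho\<^sup>2 * (mu\<^sup>2 * rho\<^sup>2)"
    by (simp add: p_def q_def A_def B_def)
qed

lemma beta_ge:
  fixes lam mu rho :: real
  assumes "lam \<in> {0..1}" "mu \<in> {0..1}" "rho \<in> {0<..<1}" "F lam mu rho 1 > 1"
  obtains \<kappa> \<theta> where "\<kappa> > 0" "\<theta> > 1" "\<And>l. 3 \<le> l \<Longrightarrow> beta lam mu rho l \<ge> \<kappa> * \<theta> ^ l / real l ^ 2"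
proof -
  note F = F_gt_1_imp[OF assms]
  define p q A B where "p = 1 - lam\<^sup>2" and "q = 1 - mu\<^sup>2" and "A = lam\<^sup>2 * rho\<^sup>2" and "B = mu\<^sup>2 * rho\<^sup>2"
  have pq: "p * q < A * B" using F(3) by (simp add: p_def q_def A_def B_def)
  have nn: "p \<ge> 0" "q \<ge> 0" "A > 0" "B > 0"
    using assms F(1,2) by (auto simp: p_def q_def A_def B_def power_le_one)
  \<comment> \<open>\<open>(1, s)\<close> is a subinvariant vector of the transfer matrix with factor \<open>\<theta> > 1\<close>; any \<open>s\<close> strictly
    between \<open>p / A\<close> and \<open>B / q\<close> would do, and the mediant also covers \<open>q = 0\<close>.\<close>
  define s where "s = (p + B) / (q + A)"
  have s: "s > 0" using nn by (simp add: s_def add_nonneg_pos)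
  have qA: "q + A > 0" using nn by simp
  have "p < A * s" using pq qA by (simp add: s_def field_simps)
  then have s1: "lam\<^sup>2 + A * s > 1" by (simp add: p_def)
  have "q * s < B" using pq qA by (simp add: s_def field_simps)
  then have s2: "(B + mu\<^sup>2 * s) / s > 1" using s by (simp add: q_def field_simps)
  define \<theta> where "\<theta> = min (lam\<^sup>2 + A * s) ((B + mu\<^sup>2 * s) / s)"
  have th: "\<theta> > 1" using s1 s2 by (simp add: \<theta>_def)
  define t where "t = min A B"
  have t: "t > 0" using nn by (simp add: t_def)
  define u where "u a = (case a of Bullet \<Rightarrow> 1 | Circ \<Rightarrow> s)" for a
  let ?T = "cweight lam mu rho"
  have rho: "rho\<^sup>2 \<le> 1" using assms by (simp add: power_le_one)
  have "A \<le> lam\<^sup>2" "B \<le> mu\<^sup>2" using rho by (auto simp: A_def B_def intro: mult_left_le)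
  then have Tt: "?T a b \<ge> t" for a b
    by (cases a; cases b) (auto simp: cweight_def coef_def t_def A_def B_def)
  have sub: "?T a Bullet * u Bullet + ?T a Circ * u Circ \<ge> \<theta> * u a" for a
  proof (cases a)
    case Bullet
    then show ?thesis by (simp add: cweight_def coef_def u_def \<theta>_def A_def)
  next
    case Circ
    have "\<theta> * s \<le> ((B + mu\<^sup>2 * s) / s) * s" using s by (intro mult_right_mono) (auto simp: \<theta>_def)
    then show ?thesis using Circ s by (simp add: cweight_def coef_def u_def B_def)
  qed
  show thesis
  \<comment> \<open>\<open>sum_closed_paths_ge\<close> bounds \<open>l - 1\<close> steps by \<theta>
    and the closing one by \<open>t\<close>, hence the constant \<open>t / \<theta>\<close>.\<close>
  proof (rule that[of "t / \<theta>" \<theta>])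
    fix l :: nat assume l: "3 \<le> l"
    then obtain m where m: "l = Suc m" by (cases l) auto
    \<comment> \<open>\<open>beta\<close> is evaluated on the cycles through all of \<open>l\<close>
      vertices; the number \<open>?N\<close> of vertex orderings cancels at the end.\<close>
    let ?N = "real (card (dlists l l))"
    have "[0..<l] \<in> dlists l l" by (auto simp: dlists_def)
    then have N: "?N > 0" using card_gt_0_iff finite_dlists by fastforce
    have "?N * (t * \<theta> ^ m) \<le> ?N * (\<Sum>ds | length ds = l. \<Prod>i<l. ?T (ds ! i) (ds ! (Suc i mod l)))"
      using sum_closed_paths_ge[of t ?T \<theta> u l m, OF Tt _ sub _ _ _ m] t th s
      by (intro mult_left_mono) (auto simp: u_def)
    also have "\<dots> = (\<Sum>vs\<in>dlists l l. \<Sum>ds | length ds = l. (Xi lam mu rho (cyc vs ds))\<^sup>2)"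
      using l by (simp add: Xi_cyc_square dlists_def)
    also have "\<dots> \<le> real l ^ 2 * (\<Sum>S\<in>cycles l l. (Xi lam mu rho S)\<^sup>2)"
      by (rule sum_sequences_le[OF l]) simp
    also have "\<dots> = ?N * (real l ^ 2 * beta lam mu rho l)"
      by (simp add: beta_times_card[OF l, symmetric])
    finally have "t * \<theta> ^ m \<le> real l ^ 2 * beta lam mu rho l" using N by simp
    then show "t / \<theta> * \<theta> ^ l / real l ^ 2 \<le> beta lam mu rho l"
      using l th m by (simp add: field_simps)
  qed (use t th in auto)
qed

section \<open>Gaussian moments\<close>

lemma PiM_prod_subset:
  fixes h :: "'i \<Rightarrow> 'a \<Rightarrow> real"
  assumes "\<And>i. prob_space (M i)" "finite I" "J \<subseteq> I" "\<And>i. i \<in> J \<Longrightarrow> integrable (M i) (h i)"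
  shows "integrable (Pi\<^sub>M I M) (\<lambda>w. \<Prod>i\<in>J. h i (w i))"
    and "(\<integral>w. (\<Prod>i\<in>J. h i (w i)) \<partial>Pi\<^sub>M I M) = (\<Prod>i\<in>J. \<integral>x. h i x \<partial>M i)"
proof -
  interpret P: prob_space "M i" for i by fact
  interpret product_sigma_finite M
    by (simp add: product_sigma_finite_def P.sigma_finite_measure_axioms)
  \<comment> \<open>Padding with the constant 1 extends the product to all of \<open>I\<close>; it
    integrates to 1 because every \<open>M i\<close> is a probability measure.\<close>
  define h' where "h' i x = (if i \<in> J then h i x else 1)" for i x
  have i: "integrable (M i) (h' i)" for i
    using assms(4)[of i] by (cases "i \<in> J") (simp_all add: h'_def[abs_def])
  have *: "(\<Prod>i\<in>I. g i) = (\<Prod>i\<in>J. g i)" if "\<And>i. i \<notin> J \<Longrightarrow> g i = 1" for g :: "'i \<Rightarrow> real"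
    using that assms(2,3) by (intro prod.mono_neutral_right) auto
  have e: "(\<Prod>i\<in>I. h' i (w i)) = (\<Prod>i\<in>J. h i (w i))" for w
    using *[of "\<lambda>i. h' i (w i)"] by (simp add: h'_def)
  have e': "(\<Prod>i\<in>I. \<integral>x. h' i x \<partial>M i) = (\<Prod>i\<in>J. \<integral>x. h i x \<partial>M i)"
    using *[of "\<lambda>i. \<integral>x. h' i x \<partial>M i"] by (simp add: h'_def P.prob_space)
  show "integrable (Pi\<^sub>M I M) (\<lambda>w. \<Prod>i\<in>J. h i (w i))"
    using product_integrable_prod[OF assms(2) i] by (simp add: e)
  show "(\<integral>w. (\<Prod>i\<in>J. h i (w i)) \<partial>Pi\<^sub>M I M) = (\<Prod>i\<in>J. \<integral>x. h i x \<partial>M i)"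
    using product_integral_prod[OF assms(2) i] by (simp add: e e')
qed

lemma pair_prod_integral:
  fixes f :: "'a \<Rightarrow> real" and g :: "'b \<Rightarrow> real"
  assumes "prob_space M" "prob_space N" "integrable M f" "integrable N g"
  shows "integrable (M \<Otimes>\<^sub>M N) (\<lambda>(x, y). f x * g y)"
    and "(\<integral>(x, y). f x * g y \<partial>(M \<Otimes>\<^sub>M N)) = (\<integral>x. f x \<partial>M) * (\<integral>y. g y \<partial>N)"
proof -
  interpret M: prob_space M by fact
  interpret N: prob_space N by fact
  interpret pair_sigma_finite M N ..
  have [measurable]: "f \<in> borel_measurable M" "g \<in> borel_measurable N"
    using assms by auto
  show i: "integrable (M \<Otimes>\<^sub>M N) (\<lambda>(x, y). f x * g y)"
    by (rule Fubini_integrable) (use assms in \<open>auto simp: abs_mult\<close>)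
  show "(\<integral>(x, y). f x * g y \<partial>(M \<Otimes>\<^sub>M N)) = (\<integral>x. f x \<partial>M) * (\<integral>y. g y \<partial>N)"
    using integral_fst'[OF i] by simp
qed

definition std_normal :: "real measure" where
  "std_normal = density lborel std_normal_density"

lemma prob_space_std_normal: "prob_space std_normal"
  unfolding std_normal_def by (rule prob_space_normal_density) simp

lemma std_normal_power: "integrable std_normal (\<lambda>x. x ^ k)"
  unfolding std_normal_def using integrable_std_normal_moment[of k]
  by (subst integrable_density) auto

lemma integral_std_normal:
  "(\<integral>x. x \<partial>std_normal) = 0" "(\<integral>x. x\<^sup>2 \<partial>std_normal) = 1"
  unfolding std_normal_def
  using integral_std_normal_moment_odd[of 0] integral_std_normal_moment_even[of 1]
  by (simp_all add: integral_density)

lemma std_normal_shift: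
  shows "integrable std_normal (\<lambda>x. a + x)" "(\<integral>x. a + x \<partial>std_normal) = a"
    "integrable std_normal (\<lambda>x. (a + x)\<^sup>2)" "(\<integral>x. (a + x)\<^sup>2 \<partial>std_normal) = 1 + a\<^sup>2"
proof -
  interpret prob_space std_normal by (rule prob_space_std_normal)
  note [simp] = std_normal_power[of 1, simplified] std_normal_power[of 2]
  have e: "(a + x)\<^sup>2 = a\<^sup>2 + (2 * a) * x + x\<^sup>2" for x by (simp add: power2_sum)
  show "integrable std_normal (\<lambda>x. a + x)" "(\<integral>x. a + x \<partial>std_normal) = a"
    by (simp_all add: integral_std_normal prob_space)
  show "integrable std_normal (\<lambda>x. (a + x)\<^sup>2)" "(\<integral>x. (a + x)\<^sup>2 \<partial>std_normal) = 1 + a\<^sup>2"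
    unfolding e by (simp_all add: integral_std_normal prob_space)
qed

section \<open>Wigner matrices and their off-diagonal entries\<close>

abbreviation wigner_index :: "nat \<Rightarrow> (nat \<times> nat) set" where
  "wigner_index n \<equiv> {(i, j). i \<le> j \<and> j < n}"

definition wigner_entry :: "nat \<times> nat \<Rightarrow> real measure" where
  "wigner_entry = (\<lambda>(i, j). density lborel (normal_density 0 (sqrt (1 + (if i = j then 1 else 0)))))"

lemma prob_space_wigner_entry: "prob_space (wigner_entry p)"
  unfolding wigner_entry_def by (cases p) (auto intro!: prob_space_normal_density)

lemma finite_wigner_index: "finite (wigner_index n)"
  by (rule finite_subset[of _ "{..<n} \<times> {..<n}"]) auto

lemma measurable_symmetrize:
  "(\<lambda>w. \<lambda>(i, j)\<in>{..<n} \<times> {..<n}. w (min i j, max i j)) \<in> Pi\<^sub>M (wigner_index n) wigner_entry \<rightarrow>\<^sub>M mat_space n"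
proof -
  have c: "(\<lambda>w. w p) \<in> borel_measurable (Pi\<^sub>M (wigner_index n) wigner_entry)" if "p \<in> wigner_index n" for p
  proof -
    have sb: "sets (wigner_entry p) = sets borel" by (auto simp: wigner_entry_def split: prod.splits)
    from measurable_component_singleton[OF that, of wigner_entry] show ?thesis
      unfolding measurable_cong_sets[OF refl sb] .
  qed
  show ?thesis
    unfolding mat_space_def
    by (rule measurable_restrict) (auto intro!: c simp: min_def max_def split: prod.splits)
qed

lemma wigner_eq: "wigner n = distr (Pi\<^sub>M (wigner_index n) wigner_entry) (mat_space n)
       (\<lambda>w. \<lambda>(i, j)\<in>{..<n} \<times> {..<n}. w (min i j, max i j))"
  by (simp add: wigner_def wigner_entry_def)

lemma prob_space_wigner: "prob_space (wigner n)"
  unfolding wigner_eq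
  by (intro prob_space.prob_space_distr prob_space_PiM prob_space_wigner_entry measurable_symmetrize)

lemma sets_wigner [measurable_cong]: "sets (wigner n) = sets (mat_space n)"
  by (simp add: wigner_def)

lemma prob_space_null_law: "prob_space (null_law n)"
  unfolding null_law_def by (intro prob_space_pair prob_space_wigner)

lemma sets_null_law [measurable_cong]: "sets (null_law n) = sets (mat_space n \<Otimes>\<^sub>M mat_space n)"
  unfolding null_law_def by (intro sets_pair_measure_cong sets_wigner)

definition kedges :: "nat \<Rightarrow> nat set set" where
  "kedges n = {e. e \<subseteq> {..<n} \<and> card e = 2}"

lemma finite_kedges: "finite (kedges n)"
  by (rule finite_subset[of _ "Pow {..<n}"]) (auto simp: kedges_def)

lemma kedgesE:
  assumes "e \<in> kedges n"
  obtains i j where "i < j" "j < n" "e = {i, j}" "Min e = i" "Max e = j"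
proof -
  obtain a b where "e = {a, b}" "a \<noteq> b" using assms by (auto simp: kedges_def card_2_iff)
  with assms that[of a b] that[of b a] show thesis
    by (cases "a < b") (auto simp: kedges_def insert_commute)
qed

lemma Min_Max_inj: "inj_on (\<lambda>e. (Min e, Max e)) (kedges n)"
  by (rule inj_onI) (elim kedgesE, simp)

text \<open>Distinct edges occupy distinct positions strictly above the diagonal, where the entries
  are independent standard normals; the diagonal entries of variance 2 are never met.\<close>

lemma wigner_prod:
  fixes h :: "nat set \<Rightarrow> real \<Rightarrow> real"
  assumes A: "A \<subseteq> kedges n" and h: "\<And>e. e \<in> A \<Longrightarrow> integrable std_normal (h e)"
  shows "integrable (wigner n) (\<lambda>W. \<Prod>e\<in>A. h e (W (Min e, Max e)))"
    and "(\<integral>W. (\<Prod>e\<in>A. h e (W (Min e, Max e))) \<partial>wigner n) = (\<Prod>e\<in>A. \<integral>x. h e x \<partial>std_normal)"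
proof -
  let ?P = "\<lambda>e. (Min e, Max e)" and ?s = "\<lambda>w. \<lambda>(i, j)\<in>{..<n} \<times> {..<n}. w (min i j, max i j)"
  let ?M = "Pi\<^sub>M (wigner_index n) wigner_entry"
  have inj: "inj_on ?P A" using Min_Max_inj A by (rule inj_on_subset)
  \<comment> \<open>The product measure is indexed by positions, so each factor is carried from its
    edge to its position along the injective map \<open>?P\<close>.\<close>
  define k where "k p = h (inv_into A ?P p)" for p
  have k: "k (?P e) = h e" if "e \<in> A" for e
    unfolding k_def using inv_into_f_f[OF inj that] by simp
  have P: "?P e \<in> wigner_index n" "wigner_entry (?P e) = std_normal" "?P e \<in> {..<n} \<times> {..<n}"
    "min (Min e) (Max e) = Min e" "max (Min e) (Max e) = Max e" if "e \<in> A" for e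
  proof -
    have "e \<in> kedges n" using that A by blast
    then obtain i j where "i < j" "j < n" "Min e = i" "Max e = j" by (rule kedgesE)
    then show "?P e \<in> wigner_index n" "wigner_entry (?P e) = std_normal" "?P e \<in> {..<n} \<times> {..<n}"
      "min (Min e) (Max e) = Min e" "max (Min e) (Max e) = Max e"
      by (auto simp: wigner_entry_def std_normal_def)
  qed
  have h_meas: "h e \<in> borel_measurable borel" if "e \<in> A" for e
    using borel_measurable_integrable[OF h[OF that]] by (simp add: std_normal_def)
  have c: "(\<lambda>W. W p) \<in> borel_measurable (mat_space n)" if "p \<in> {..<n} \<times> {..<n}" for p
    unfolding mat_space_def using that by (rule measurable_component_singleton)
  have meas: "(\<lambda>W. \<Prod>e\<in>A. h e (W (?P e))) \<in> borel_measurable (mat_space n)"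
    by (intro borel_measurable_prod measurable_compose[OF c h_meas] P) auto
  have eq: "(\<Prod>e\<in>A. h e (?s w (?P e))) = (\<Prod>p\<in>?P ` A. k p (w p))" for w
    unfolding prod.reindex[OF inj] o_def using P by (intro prod.cong refl) (simp add: k)
  have sub: "?P ` A \<subseteq> wigner_index n" using P by blast
  have ik: "integrable (wigner_entry p) (k p)" if "p \<in> ?P ` A" for p
    using that P(2) k h by auto
  note PP = PiM_prod_subset[OF prob_space_wigner_entry finite_wigner_index sub ik]
  show "integrable (wigner n) (\<lambda>W. \<Prod>e\<in>A. h e (W (?P e)))"
    unfolding wigner_eq integrable_distr_eq[OF measurable_symmetrize meas] eq by (rule PP(1))
  have "(\<integral>W. (\<Prod>e\<in>A. h e (W (Min e, Max e))) \<partial>wigner n) = (\<Prod>p\<in>?P ` A. \<integral>x. k p x \<partial>wigner_entry p)"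
    unfolding wigner_eq integral_distr[OF measurable_symmetrize meas] eq by (rule PP(2))
  also have "\<dots> = (\<Prod>e\<in>A. \<integral>x. h e x \<partial>std_normal)"
    unfolding prod.reindex[OF inj] o_def using P(2) k by (intro prod.cong refl) simp
  finally show "(\<integral>W. (\<Prod>e\<in>A. h e (W (Min e, Max e))) \<partial>wigner n) = (\<Prod>e\<in>A. \<integral>x. h e x \<partial>std_normal)" .
qed

section \<open>Entries of the pair of matrices, indexed by slots\<close>

definition entry :: "rmat \<times> rmat \<Rightarrow> decoration \<times> nat set \<Rightarrow> real" where
  "entry XY s = (case fst s of Bullet \<Rightarrow> fst XY | Circ \<Rightarrow> snd XY) (Min (snd s), Max (snd s))"

abbreviation kslots :: "nat \<Rightarrow> (decoration \<times> nat set) set" where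
  "kslots n \<equiv> UNIV \<times> kedges n"

lemma finite_kslots: "finite (kslots n)"
  using finite_kedges by simp

lemma prod_slots_split:
  fixes f :: "decoration \<times> 'b \<Rightarrow> real"
  assumes "finite A"
  shows "(\<Prod>s\<in>A. f s) = (\<Prod>e\<in>{e. (Bullet, e) \<in> A}. f (Bullet, e)) * (\<Prod>e\<in>{e. (Circ, e) \<in> A}. f (Circ, e))"
proof -
  have A: "A = Pair Bullet ` {e. (Bullet, e) \<in> A} \<union> Pair Circ ` {e. (Circ, e) \<in> A}" (is "_ = ?B \<union> ?C")
  proof
    show "A \<subseteq> ?B \<union> ?C"
    proof
      fix s assume "s \<in> A"
      then show "s \<in> ?B \<union> ?C" by (cases s; cases "fst s") auto
    qed
  qed auto
  have "finite ?B" "finite ?C" using assms by (auto intro: finite_subset[of _ A])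
  then have "(\<Prod>s\<in>?B \<union> ?C. f s) = (\<Prod>s\<in>?B. f s) * (\<Prod>s\<in>?C. f s)"
    by (intro prod.union_disjoint) auto
  then show ?thesis by (subst A) (simp add: prod.reindex inj_on_def)
qed

lemma f_sub_eq:
  assumes "S \<in> subgraphs_K n"
  shows "f_sub S XY = (\<Prod>s\<in>slots S. entry XY s)" "slots S \<subseteq> kslots n"
proof -
  have e: "e \<in> kedges n" if "e \<in> edges_of d S" for d e
    using assms that by (auto simp: subgraphs_K_def decorated_graph_def edges_of_def edges_def kedges_def)
  then show sub: "slots S \<subseteq> kslots n" by (auto simp: slots_def edges_of_def)
  have *: "(\<Prod>(i, j)\<in>{(i, j). i < j \<and> {i, j} \<in> edges_of d S}. X (i, j)) = (\<Prod>e\<in>edges_of d S. X (Min e, Max e))"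
    for d and X :: rmat
  proof (rule prod.reindex_bij_witness[of _ "\<lambda>e. (Min e, Max e)" "\<lambda>(i, j). {i, j}"])
    fix f assume f: "f \<in> edges_of d S"
    with e have "f \<in> kedges n" by blast
    then obtain i j where "i < j" "f = {i, j}" "Min f = i" "Max f = j" by (rule kedgesE)
    with f show "(case (Min f, Max f) of (i, j) \<Rightarrow> {i, j}) = f"
      "(Min f, Max f) \<in> {(i, j). i < j \<and> {i, j} \<in> edges_of d S}" by auto
  qed auto
  have "finite (slots S)" using sub finite_kslots finite_subset by blast
  from prod_slots_split[OF this, of "entry XY"] show "f_sub S XY = (\<Prod>s\<in>slots S. entry XY s)"
    unfolding f_sub_def * by (simp add: case_prod_unfold entry_def slots_def edges_of_def *[unfolded case_prod_unfold])
qed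

lemma measurable_entry:
  assumes "s \<in> kslots n"
  shows "(\<lambda>XY. entry XY s) \<in> borel_measurable (mat_space n \<Otimes>\<^sub>M mat_space n)"
proof -
  obtain d e where s: "s = (d, e)" and e: "e \<in> kedges n" using assms by auto
  obtain i j where "i < j" "j < n" "Min e = i" "Max e = j" using e by (rule kedgesE)
  then have "(\<lambda>W. W (Min e, Max e)) \<in> borel_measurable (mat_space n)"
    unfolding mat_space_def by (intro measurable_component_singleton) auto
  note [measurable] = this
  show ?thesis by (cases d) (simp_all add: entry_def s)
qed

lemma prod_Un_if:
  fixes f g :: "'a \<Rightarrow> real"
  assumes "finite A" "finite B"
  shows "(\<Prod>s\<in>A \<union> B. if s \<in> A \<inter> B then f s else g s) =
    (\<Prod>s\<in>A \<inter> B. f s) * (\<Prod>s\<in>(A \<union> B) - (A \<inter> B). g s)"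
  using assms by (subst prod.If_cases) (auto intro!: arg_cong2[where f = "(*)"] prod.cong)

lemma prod_mult_prod:
  fixes f :: "'a \<Rightarrow> real"
  assumes fin: "finite A" "finite B"
  shows "(\<Prod>s\<in>A. f s) * (\<Prod>s\<in>B. f s) = (\<Prod>s\<in>A \<inter> B. (f s)\<^sup>2) * (\<Prod>s\<in>(A \<union> B) - (A \<inter> B). f s)"
proof -
  have 1: "(\<Prod>s\<in>A. f s) = (\<Prod>s\<in>A \<inter> B. f s) * (\<Prod>s\<in>A - B. f s)"
    using fin by (subst prod.union_disjoint[symmetric]) (auto intro!: prod.cong)
  have 2: "(\<Prod>s\<in>B. f s) = (\<Prod>s\<in>A \<inter> B. f s) * (\<Prod>s\<in>B - A. f s)"
    using fin by (subst prod.union_disjoint[symmetric]) (auto intro!: prod.cong)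
  have 3: "(\<Prod>s\<in>(A \<union> B) - (A \<inter> B). f s) = (\<Prod>s\<in>A - B. f s) * (\<Prod>s\<in>B - A. f s)"
    using fin by (subst prod.union_disjoint[symmetric]) (auto intro!: prod.cong)
  show ?thesis unfolding 3 by (simp add: 1 2 power2_eq_square prod.distrib)
qed

text \<open>Given the spike, a planted entry is a noise entry plus a constant; \<open>a\<close>
  collects these constants, and \<open>a = 0\<close> is the null law.\<close>

definition shifted :: "(decoration \<times> nat set) set \<Rightarrow> (decoration \<times> nat set \<Rightarrow> real) \<Rightarrow> rmat \<times> rmat \<Rightarrow> real" where
  "shifted A a WZ = (\<Prod>s\<in>A. a s + entry WZ s)"

text \<open>What remains of the product over \<open>A\<close> times the product over \<open>B\<close> of the noisy entries
  \<open>a s + G s\<close> after integrating out the standard normals \<open>G s\<close>.\<close>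
definition mixed :: "'s set \<Rightarrow> 's set \<Rightarrow> ('s \<Rightarrow> real) \<Rightarrow> real" where
  "mixed A B a = (\<Prod>s\<in>A \<inter> B. 1 + (a s)\<^sup>2) * (\<Prod>s\<in>(A \<union> B) - (A \<inter> B). a s)"

text \<open>A slot in both sets contributes a second moment, a slot in only one contributes a mean.
  With \<open>a = 0\<close> this gives orthonormality under the null law; with \<open>a\<close> the
  spike it integrates out the noise of the planted law.\<close>

lemma null_law_shifted:
  assumes A: "A \<subseteq> kslots n" and B: "B \<subseteq> kslots n"
  shows "integrable (null_law n) (\<lambda>WZ. shifted A a WZ * shifted B a WZ)"
    and "(\<integral>WZ. shifted A a WZ * shifted B a WZ \<partial>null_law n) = mixed A B a"
proof -
  have fin: "finite A" "finite B" using A B finite_kslots finite_subset by blast+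
  define h where "h s x = (if s \<in> A \<inter> B then (a s + x)\<^sup>2 else a s + x)" for s x
  define \<Omega> where "\<Omega> d = {e. (d, e) \<in> A \<union> B}" for d
  have \<Omega>: "\<Omega> d \<subseteq> kedges n" for d using A B by (auto simp: \<Omega>_def)
  have hs: "h s = (if s \<in> A \<inter> B then (\<lambda>x. (a s + x)\<^sup>2) else (\<lambda>x. a s + x))" for s
    by (auto simp: h_def[abs_def])
  have hi: "integrable std_normal (h s)" for s
    unfolding hs using std_normal_shift(1)[of "a s"] std_normal_shift(3)[of "a s"] by simp
  have hv: "(\<integral>x. h s x \<partial>std_normal) = (if s \<in> A \<inter> B then 1 + (a s)\<^sup>2 else a s)" for s
    unfolding hs using std_normal_shift(2)[of "a s"] std_normal_shift(4)[of "a s"] by simp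
  note split = prod_Un_if[OF fin]
  have eq: "(\<lambda>WZ. shifted A a WZ * shifted B a WZ) =
      (\<lambda>(W, Z). (\<Prod>e\<in>\<Omega> Bullet. h (Bullet, e) (W (Min e, Max e))) * (\<Prod>e\<in>\<Omega> Circ. h (Circ, e) (Z (Min e, Max e))))"
  proof
    fix WZ :: "rmat \<times> rmat"
    have "shifted A a WZ * shifted B a WZ = (\<Prod>s\<in>A \<union> B. h s (entry WZ s))"
      unfolding shifted_def prod_mult_prod[OF fin] split h_def ..
    also have "\<dots> = (\<Prod>e\<in>\<Omega> Bullet. h (Bullet, e) (fst WZ (Min e, Max e))) * (\<Prod>e\<in>\<Omega> Circ. h (Circ, e) (snd WZ (Min e, Max e)))"
      unfolding \<Omega>_def using fin by (subst prod_slots_split) (simp_all add: entry_def)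
    finally show "shifted A a WZ * shifted B a WZ = (case WZ of (W, Z) \<Rightarrow>
      (\<Prod>e\<in>\<Omega> Bullet. h (Bullet, e) (W (Min e, Max e))) * (\<Prod>e\<in>\<Omega> Circ. h (Circ, e) (Z (Min e, Max e))))"
      by (simp add: case_prod_unfold)
  qed
  have w: "integrable (wigner n) (\<lambda>W. \<Prod>e\<in>\<Omega> d. h (d, e) (W (Min e, Max e)))"
    "(\<integral>W. (\<Prod>e\<in>\<Omega> d. h (d, e) (W (Min e, Max e))) \<partial>wigner n) = (\<Prod>e\<in>\<Omega> d. \<integral>x. h (d, e) x \<partial>std_normal)" for d
    using wigner_prod[OF \<Omega>, of d "\<lambda>e. h (d, e)"] hi by auto
  note pp = pair_prod_integral[OF prob_space_wigner prob_space_wigner w(1)[of Bullet] w(1)[of Circ]]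
  show "integrable (null_law n) (\<lambda>WZ. shifted A a WZ * shifted B a WZ)"
    unfolding eq null_law_def by (rule pp(1))
  have "(\<integral>WZ. shifted A a WZ * shifted B a WZ \<partial>null_law n)
    = (\<Prod>e\<in>\<Omega> Bullet. \<integral>x. h (Bullet, e) x \<partial>std_normal) * (\<Prod>e\<in>\<Omega> Circ. \<integral>x. h (Circ, e) x \<partial>std_normal)"
    unfolding eq null_law_def pp(2) w(2) ..
  also have "\<dots> = (\<Prod>s\<in>A \<union> B. \<integral>x. h s x \<partial>std_normal)"
    unfolding \<Omega>_def using prod_slots_split[of "A \<union> B" "\<lambda>s. \<integral>x. h s x \<partial>std_normal"] fin by simp
  also have "\<dots> = mixed A B a"
    unfolding hv split mixed_def ..
  finally show "(\<integral>WZ. shifted A a WZ * shifted B a WZ \<partial>null_law n) = mixed A B a" .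
qed

section \<open>The planted law\<close>

definition component :: "decoration \<Rightarrow> real \<times> real \<Rightarrow> real" where
  "component d p = (case d of Bullet \<Rightarrow> fst p | Circ \<Rightarrow> snd p)"

definition spike :: "real \<Rightarrow> real \<Rightarrow> nat \<Rightarrow> (nat \<Rightarrow> real \<times> real) \<Rightarrow> decoration \<times> nat set \<Rightarrow> real" where
  "spike lam mu n xy s = coef lam mu (fst s) / sqrt (real n) * (\<Prod>v\<in>snd s. component (fst s) (xy v))"

definition plant :: "real \<Rightarrow> real \<Rightarrow> nat \<Rightarrow> (nat \<Rightarrow> real \<times> real) \<times> rmat \<times> rmat \<Rightarrow> rmat \<times> rmat" where
  "plant lam mu n = (\<lambda>(xy, W, Z). (add_spike lam n (\<lambda>i. fst (xy i)) W, add_spike mu n (\<lambda>i. snd (xy i)) Z))"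

lemma entry_plant:
  assumes "s \<in> kslots n"
  shows "entry (plant lam mu n (xy, WZ)) s = spike lam mu n xy s + entry WZ s"
proof -
  obtain d e where s: "s = (d, e)" and e: "e \<in> kedges n" using assms by auto
  obtain i j where "i < j" "j < n" "e = {i, j}" "Min e = i" "Max e = j" using e by (rule kedgesE)
  then show ?thesis
    by (cases d; cases WZ) (simp_all add: s entry_def plant_def spike_def add_spike_def coef_def component_def)
qed

lemma prod_entry_plant:
  assumes "A \<subseteq> kslots n"
  shows "(\<Prod>s\<in>A. entry (plant lam mu n (xy, WZ)) s) = shifted A (spike lam mu n xy) WZ"
  unfolding shifted_def using assms by (intro prod.cong refl entry_plant) auto

lemma mixed_self: "mixed A A a = (\<Prod>s\<in>A. 1 + (a s)\<^sup>2)"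
  by (simp add: mixed_def)

text \<open>As a function of \<open>t\<close> the product is a polynomial with nonnegative
  coefficients, hence convex on \<open>[0, 1]\<close> and below its chord. Used with
  \<open>t = 1 / n\<close>, it leaves the leading 1 untouched and puts the factor
  \<open>1 / n\<close> on everything that involves moments of the prior.\<close>

lemma prod_one_plus_scaled_le:
  fixes w :: "'a \<Rightarrow> real"
  assumes "\<And>s. s \<in> A \<Longrightarrow> w s \<ge> 0" "0 \<le> t" "t \<le> 1"
  shows "(\<Prod>s\<in>A. 1 + t * w s) \<le> 1 + t * ((\<Prod>s\<in>A. 1 + w s) - 1)"
  using assms(1)
proof (induction A rule: infinite_finite_induct)
  case (insert x A)
  let ?P = "\<Prod>s\<in>A. 1 + w s"
  have P: "?P \<ge> 1" using insert.prems by (intro prod_ge_1) auto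
  have w: "w x \<ge> 0" using insert.prems by simp
  have "(\<Prod>s\<in>insert x A. 1 + t * w s) \<le> (1 + t * w x) * (1 + t * (?P - 1))"
    using insert assms(2) by (auto intro!: mult_left_mono)
  also have "\<dots> = 1 + t * (?P - 1) + t * w x + t * (t * (w x * (?P - 1)))"
    by (simp add: algebra_simps)
  also have "t * (t * (w x * (?P - 1))) \<le> t * (1 * (w x * (?P - 1)))"
    using P w assms by (intro mult_left_mono mult_right_mono) auto
  also have "1 + t * (?P - 1) + t * w x + t * (1 * (w x * (?P - 1))) = 1 + t * ((1 + w x) * ?P - 1)"
    by (simp add: algebra_simps)
  finally show ?case using insert by simp
qed (use assms in auto)

section \<open>Priors with finite fourth moments\<close>

locale correlated_prior = prior: prob_space prior for prior :: "(real \<times> real) measure" +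
  fixes lam mu rho :: real
  assumes lam: "lam \<in> {0..1}" and mu: "mu \<in> {0..1}"
    and sets_prior [measurable_cong]: "sets prior = sets borel"
    and integrable_fourth: "integrable prior (\<lambda>p. (1 + (fst p)\<^sup>2 + (snd p)\<^sup>2)\<^sup>2)"
    and second_moments: "(\<integral>p. (fst p)\<^sup>2 \<partial>prior) = 1" "(\<integral>p. (snd p)\<^sup>2 \<partial>prior) = 1"
      "(\<integral>p. fst p * snd p \<partial>prior) = rho"
begin

text \<open>A common envelope for both decorations: it dominates \<open>1 + x^2\<close> for either
  component \<open>x\<close>, and being at least 1 it may be multiplied in freely to make bounds
  uniform over vertices.\<close>

definition r :: "real \<times> real \<Rightarrow> real" where
  "r p = 1 + (fst p)\<^sup>2 + (snd p)\<^sup>2"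

definition K :: real where
  "K = (\<integral>p. (r p)\<^sup>2 \<partial>prior)"

abbreviation PX :: "nat \<Rightarrow> (nat \<Rightarrow> real \<times> real) measure" where
  "PX n \<equiv> Pi\<^sub>M {..<n} (\<lambda>_. prior)"

abbreviation sp :: "nat \<Rightarrow> (nat \<Rightarrow> real \<times> real) \<Rightarrow> decoration \<times> nat set \<Rightarrow> real" where
  "sp n \<equiv> spike lam mu n"

lemma measurable_fst_prior [measurable]: "fst \<in> borel_measurable prior" "snd \<in> borel_measurable prior"
proof -
  have "fst \<in> borel_measurable (borel :: (real \<times> real) measure)" "snd \<in> borel_measurable (borel :: (real \<times> real) measure)"
    by (auto intro!: borel_measurable_continuous_onI continuous_intros)
  then show "fst \<in> borel_measurable prior" "snd \<in> borel_measurable prior"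
    unfolding measurable_cong_sets[OF sets_prior refl] .
qed

lemma r_ge_1: "r p \<ge> 1"
  by (simp add: r_def)

lemma integrable_r2: "integrable prior (\<lambda>p. (r p)\<^sup>2)"
  using integrable_fourth by (simp add: r_def)

lemma K_ge_1: "K \<ge> 1"
proof -
  have "(\<integral>p. 1 \<partial>prior) \<le> K"
    unfolding K_def using r_ge_1 by (intro integral_mono integrable_r2) (auto intro: one_le_power)
  then show ?thesis by (simp add: prior.prob_space)
qed

lemma prob_space_PX: "prob_space (PX n)"
  by (intro prob_space_PiM prior.prob_space_axioms)

lemma PX_prod:
  fixes h :: "nat \<Rightarrow> real \<times> real \<Rightarrow> real"
  assumes "V \<subseteq> {..<n}" "\<And>v. v \<in> V \<Longrightarrow> integrable prior (h v)"
  shows "integrable (PX n) (\<lambda>xy. \<Prod>v\<in>V. h v (xy v))"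
    "(\<integral>xy. (\<Prod>v\<in>V. h v (xy v)) \<partial>PX n) = (\<Prod>v\<in>V. \<integral>p. h v p \<partial>prior)"
  using PiM_prod_subset[of "\<lambda>_. prior" "{..<n}" V h] assms prior.prob_space_axioms by auto

lemma PX_prod_r2:
  assumes "V \<subseteq> {..<n}"
  shows "integrable (PX n) (\<lambda>xy. \<Prod>v\<in>V. (r (xy v))\<^sup>2)"
    "(\<integral>xy. (\<Prod>v\<in>V. (r (xy v))\<^sup>2) \<partial>PX n) = K ^ card V"
  using PX_prod[OF assms, of "\<lambda>_ p. (r p)\<^sup>2"] integrable_r2 by (auto simp: K_def)

lemma measurable_spike:
  assumes "s \<in> kslots n"
  shows "(\<lambda>xy. sp n xy s) \<in> borel_measurable (PX n)"
proof -
  have "(\<lambda>xy. component d (xy v)) \<in> borel_measurable (PX n)" if "v < n" for d v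
  proof -
    have [measurable]: "(\<lambda>xy. xy v) \<in> PX n \<rightarrow>\<^sub>M prior" using that by (intro measurable_component_singleton) simp
    show ?thesis by (cases d) (simp_all add: component_def)
  qed
  then show ?thesis
    unfolding spike_def using assms
    by (intro borel_measurable_times borel_measurable_const borel_measurable_prod) (auto simp: kedges_def)
qed

lemma measurable_mixed:
  assumes "A \<subseteq> kslots n" "B \<subseteq> kslots n"
  shows "(\<lambda>xy. mixed A B (sp n xy)) \<in> borel_measurable (PX n)"
  unfolding mixed_def using assms
  by (intro borel_measurable_times borel_measurable_prod borel_measurable_add borel_measurable_const
      borel_measurable_power measurable_spike) auto

lemma measurable_plant: "plant lam mu n \<in> PX n \<Otimes>\<^sub>M null_law n \<rightarrow>\<^sub>M mat_space n \<Otimes>\<^sub>M mat_space n"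
proof -
  have add: "(\<lambda>\<omega>. add_spike c n (\<lambda>i. f (fst \<omega> i)) (g (snd \<omega>))) \<in> PX n \<Otimes>\<^sub>M null_law n \<rightarrow>\<^sub>M mat_space n"
    if f: "f \<in> borel_measurable prior" and g: "g \<in> null_law n \<rightarrow>\<^sub>M mat_space n" for c f g
    unfolding add_spike_def mat_space_def
  proof (rule measurable_restrict)
    fix p assume "p \<in> {..<n} \<times> {..<n}"
    then obtain i j where p: "p = (i, j)" "i < n" "j < n" by auto
    have fk: "(\<lambda>\<omega>. f (fst \<omega> k)) \<in> borel_measurable (PX n \<Otimes>\<^sub>M null_law n)" if "k < n" for k
    proof -
      have "(\<lambda>xy. xy k) \<in> PX n \<rightarrow>\<^sub>M prior" using that by (intro measurable_component_singleton) simp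
      from measurable_compose[OF measurable_compose[OF measurable_fst this] f] show ?thesis .
    qed
    have "(\<lambda>W. W (i, j)) \<in> borel_measurable (mat_space n)"
      unfolding mat_space_def using p(2,3) by (intro measurable_component_singleton) simp
    from measurable_compose[OF measurable_compose[OF measurable_snd g] this]
    have gp: "(\<lambda>\<omega>. g (snd \<omega>) (i, j)) \<in> borel_measurable (PX n \<Otimes>\<^sub>M null_law n)" .
    show "(\<lambda>\<omega>. case p of (i, j) \<Rightarrow> c / sqrt (real n) * (f (fst \<omega> i) * f (fst \<omega> j)) + g (snd \<omega>) (i, j))
      \<in> borel_measurable (PX n \<Otimes>\<^sub>M null_law n)"
      unfolding p(1) prod.case
      by (intro borel_measurable_add borel_measurable_times borel_measurable_const fk gp p)
  qed
  have m: "fst \<in> null_law n \<rightarrow>\<^sub>M mat_space n" "snd \<in> null_law n \<rightarrow>\<^sub>M mat_space n"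
    by measurable
  show ?thesis
    using measurable_Pair[OF add[OF measurable_fst_prior(1) m(1), of lam] add[OF measurable_fst_prior(2) m(2), of mu]]
    by (simp add: plant_def case_prod_unfold)
qed

lemma planted_law_eq:
  "planted_law lam mu prior n = distr (PX n \<Otimes>\<^sub>M null_law n) (mat_space n \<Otimes>\<^sub>M mat_space n) (plant lam mu n)"
  by (simp add: planted_law_def plant_def null_law_def)

lemma prob_space_planted: "prob_space (planted_law lam mu prior n)"
  unfolding planted_law_eq
  by (intro prob_space.prob_space_distr prob_space_pair prob_space_PX prob_space_null_law measurable_plant)

lemma measurable_prod_entry:
  "A \<subseteq> kslots n \<Longrightarrow> (\<lambda>XY. \<Prod>s\<in>A. entry XY s) \<in> borel_measurable (mat_space n \<Otimes>\<^sub>M mat_space n)"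
  by (intro borel_measurable_prod measurable_entry) auto

lemma measurable_shifted:
  assumes "A \<subseteq> kslots n"
  shows "(\<lambda>(xy, WZ). shifted A (sp n xy) WZ) \<in> borel_measurable (PX n \<Otimes>\<^sub>M null_law n)"
  using measurable_compose[OF measurable_plant measurable_prod_entry[OF assms]] assms
  by (simp add: case_prod_unfold flip: prod_entry_plant)

text \<open>\<open>mixed A A\<close> is the second moment of the product over \<open>A\<close> given
  the spike, so the condition expresses square integrability under the planted law.\<close>

definition spike_integrable :: "nat \<Rightarrow> (decoration \<times> nat set) set \<Rightarrow> bool" where
  "spike_integrable n A \<longleftrightarrow> A \<subseteq> kslots n \<and> integrable (PX n) (\<lambda>xy. mixed A A (sp n xy))"

lemma spike_integrable_empty: "spike_integrable n {}"
proof -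
  interpret prob_space "PX n" by (rule prob_space_PX)
  show ?thesis by (simp add: spike_integrable_def mixed_def)
qed

lemma integrable_shifted_square:
  assumes "spike_integrable n A"
  shows "integrable (PX n \<Otimes>\<^sub>M null_law n) (\<lambda>(xy, WZ). (shifted A (sp n xy) WZ)\<^sup>2)"
proof -
  interpret P: prob_space "PX n" by (rule prob_space_PX)
  interpret N: prob_space "null_law n" by (rule prob_space_null_law)
  interpret pair_sigma_finite "PX n" "null_law n" ..
  have A: "A \<subseteq> kslots n" using assms by (simp add: spike_integrable_def)
  note i = null_law_shifted[OF A A, folded power2_eq_square]
  show ?thesis
  proof (rule Fubini_integrable)
    show "(\<lambda>(xy, WZ). (shifted A (sp n xy) WZ)\<^sup>2) \<in> borel_measurable (PX n \<Otimes>\<^sub>M null_law n)"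
      using borel_measurable_power[OF measurable_shifted[OF A], of 2] by (simp add: case_prod_unfold)
  qed (use i assms in \<open>simp_all add: spike_integrable_def\<close>)
qed

text \<open>The product is integrable because \<open>|x y| \<le> x^2 + y^2\<close>; Fubini then
  integrates the noise first and leaves an expectation over the prior.\<close>

lemma planted_prod_entry:
  assumes "spike_integrable n A" "spike_integrable n B"
  shows "integrable (planted_law lam mu prior n) (\<lambda>XY. (\<Prod>s\<in>A. entry XY s) * (\<Prod>s\<in>B. entry XY s))"
    and "(\<integral>XY. (\<Prod>s\<in>A. entry XY s) * (\<Prod>s\<in>B. entry XY s) \<partial>planted_law lam mu prior n)
      = (\<integral>xy. mixed A B (sp n xy) \<partial>PX n)"
    and "integrable (PX n) (\<lambda>xy. mixed A B (sp n xy))"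
proof -
  interpret P: prob_space "PX n" by (rule prob_space_PX)
  interpret N: prob_space "null_law n" by (rule prob_space_null_law)
  interpret pair_sigma_finite "PX n" "null_law n" ..
  have A: "A \<subseteq> kslots n" and B: "B \<subseteq> kslots n" using assms by (simp_all add: spike_integrable_def)
  let ?g = "\<lambda>XY. (\<Prod>s\<in>A. entry XY s) * (\<Prod>s\<in>B. entry XY s)"
  let ?h = "\<lambda>(xy, WZ). shifted A (sp n xy) WZ * shifted B (sp n xy) WZ"
  have gm: "?g \<in> borel_measurable (mat_space n \<Otimes>\<^sub>M mat_space n)"
    by (intro borel_measurable_times measurable_prod_entry A B)
  have gh: "?g (plant lam mu n \<omega>) = ?h \<omega>" for \<omega>
    by (cases \<omega>) (simp only: prod_entry_plant[OF A] prod_entry_plant[OF B] prod.case)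
  have int: "integrable (PX n \<Otimes>\<^sub>M null_law n) ?h"
  proof (rule Bochner_Integration.integrable_bound)
    show "integrable (PX n \<Otimes>\<^sub>M null_law n)
      (\<lambda>\<omega>. (case \<omega> of (xy, WZ) \<Rightarrow> (shifted A (sp n xy) WZ)\<^sup>2) + (case \<omega> of (xy, WZ) \<Rightarrow> (shifted B (sp n xy) WZ)\<^sup>2))"
      by (intro Bochner_Integration.integrable_add integrable_shifted_square assms)
    show "?h \<in> borel_measurable (PX n \<Otimes>\<^sub>M null_law n)"
      using borel_measurable_times[OF measurable_shifted[OF A] measurable_shifted[OF B]]
      by (simp add: case_prod_unfold)
    have *: "\<bar>x * y\<bar> \<le> x\<^sup>2 + y\<^sup>2" for x y :: real
    proof -
      have "2 * (\<bar>x\<bar> * \<bar>y\<bar>) \<le> x\<^sup>2 + y\<^sup>2"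
        using zero_le_power2[of "\<bar>x\<bar> - \<bar>y\<bar>"] by (simp add: power2_diff)
      moreover have "\<bar>x\<bar> * \<bar>y\<bar> \<ge> 0" by simp
      ultimately have "\<bar>x\<bar> * \<bar>y\<bar> \<le> x\<^sup>2 + y\<^sup>2" by linarith
      then show ?thesis by (simp add: abs_mult)
    qed
    show "AE \<omega> in PX n \<Otimes>\<^sub>M null_law n. norm (?h \<omega>) \<le> norm ((case \<omega> of (xy, WZ) \<Rightarrow> (shifted A (sp n xy) WZ)\<^sup>2)
      + (case \<omega> of (xy, WZ) \<Rightarrow> (shifted B (sp n xy) WZ)\<^sup>2))"
      using * by (intro AE_I2) (auto simp: case_prod_unfold)
  qed
  show "integrable (planted_law lam mu prior n) ?g"
    unfolding planted_law_eq integrable_distr_eq[OF measurable_plant gm] gh by (rule int)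
  have "(\<integral>XY. ?g XY \<partial>planted_law lam mu prior n) = (\<integral>\<omega>. ?h \<omega> \<partial>(PX n \<Otimes>\<^sub>M null_law n))"
    unfolding planted_law_eq integral_distr[OF measurable_plant gm] gh ..
  also have "\<dots> = (\<integral>xy. \<integral>WZ. ?h (xy, WZ) \<partial>null_law n \<partial>PX n)"
    by (rule integral_fst'[OF int, symmetric])
  also have "\<dots> = (\<integral>xy. mixed A B (sp n xy) \<partial>PX n)"
    using null_law_shifted(2)[OF A B] by simp
  finally show "(\<integral>XY. ?g XY \<partial>planted_law lam mu prior n) = (\<integral>xy. mixed A B (sp n xy) \<partial>PX n)" .
  show "integrable (PX n) (\<lambda>xy. mixed A B (sp n xy))"
    using integrable_fst'[OF int] null_law_shifted(2)[OF A B] by simp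
qed

text \<open>The square root makes the product of \<open>q\<close> over the edges of a cycle contribute one factor \<open>r\<close> per
  vertex, so that two overlapping cycles need only fourth moments of the prior.\<close>
definition q :: "(nat \<Rightarrow> real \<times> real) \<Rightarrow> decoration \<times> nat set \<Rightarrow> real" where
  "q xy s = (\<Prod>v\<in>snd s. sqrt (r (xy v)))"

lemma q_ge_1: "q xy s \<ge> 1"
  unfolding q_def using r_ge_1 by (intro prod_ge_1) auto

text \<open>The first bound is for a slot in one cycle, which gains \<open>n^(-1/2)\<close>; the
  second is for a shared slot, which gains no power of \<open>n\<close>. In both cases
  \<open>q\<close> enters once for each cycle using the slot.\<close>

lemma spike_bounds:
  assumes "s \<in> kslots n" "1 \<le> n"
  shows "\<bar>sp n xy s\<bar> \<le> q xy s / sqrt (real n)" "1 + (sp n xy s)\<^sup>2 \<le> (q xy s)\<^sup>2"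
proof -
  obtain d e where s: "s = (d, e)" and e: "e \<in> kedges n" using assms by auto
  obtain i j where ij: "i < j" "j < n" "e = {i, j}" using e by (rule kedgesE)
  define a b where "a = component d (xy i)" and "b = component d (xy j)"
  have ab: "1 + a\<^sup>2 \<le> r (xy i)" "1 + b\<^sup>2 \<le> r (xy j)"
    by (cases d; simp add: a_def b_def component_def r_def)+
  have c: "\<bar>coef lam mu d\<bar> \<le> 1" using lam mu by (cases d) (auto simp: coef_def)
  have q: "q xy s = sqrt (r (xy i)) * sqrt (r (xy j))" using ij by (simp add: q_def s)
  have sp: "sp n xy s = coef lam mu d / sqrt (real n) * (a * b)" using ij by (simp add: spike_def s a_def b_def)
  have "\<bar>a\<bar> \<le> sqrt (r (xy i))" "\<bar>b\<bar> \<le> sqrt (r (xy j))"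
    using ab by (auto intro!: real_le_rsqrt)
  then have "\<bar>coef lam mu d\<bar> * (\<bar>a\<bar> * \<bar>b\<bar>) \<le> 1 * q xy s"
    unfolding q using c r_ge_1[of "xy i"] by (intro mult_mono) auto
  then show "\<bar>sp n xy s\<bar> \<le> q xy s / sqrt (real n)"
    unfolding sp by (simp add: abs_mult divide_right_mono)
  have "\<bar>coef lam mu d / sqrt (real n)\<bar> \<le> 1"
    using c assms(2) by (simp add: divide_le_eq order_trans[OF c])
  then have "(coef lam mu d / sqrt (real n))\<^sup>2 \<le> 1" by (simp add: abs_square_le_1)
  then have "(sp n xy s)\<^sup>2 \<le> 1 * (a * b)\<^sup>2"
    unfolding sp power_mult_distrib[of _ "a * b"] by (intro mult_right_mono) auto
  then have "1 + (sp n xy s)\<^sup>2 \<le> (1 + a\<^sup>2) * (1 + b\<^sup>2)"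
    using zero_le_power2[of a] zero_le_power2[of b]
    by (simp only: power_mult_distrib distrib_left distrib_right mult_1_left mult_1_right)
  also have "\<dots> \<le> r (xy i) * r (xy j)" using ab r_ge_1[of "xy i"] by (intro mult_mono) auto
  also have "\<dots> = (q xy s)\<^sup>2" using r_ge_1[of "xy i"] r_ge_1[of "xy j"] by (simp add: q power_mult_distrib)
  finally show "1 + (sp n xy s)\<^sup>2 \<le> (q xy s)\<^sup>2" .
qed

end

section \<open>Products along a cycle, regrouped by vertices\<close>

lemma prod_cycle_verts:
  fixes f :: "nat \<Rightarrow> 'b::comm_monoid_mult"
  assumes "distinct vs" "length vs = l" "0 < l"
  shows "(\<Prod>i<l. f (vs ! i)) = (\<Prod>v\<in>set vs. f v)" "(\<Prod>i<l. f (vs ! (Suc i mod l))) = (\<Prod>v\<in>set vs. f v)"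
proof -
  show *: "(\<Prod>i<l. f (vs ! i)) = (\<Prod>v\<in>set vs. f v)"
    using assms by (intro prod.reindex_bij_betw bij_betw_nth) auto
  show "(\<Prod>i<l. f (vs ! (Suc i mod l))) = (\<Prod>v\<in>set vs. f v)"
    using prod.reindex_bij_betw[OF bij_betw_Suc_mod[of l], of "\<lambda>i. f (vs ! i)"] * by simp
qed

lemma prod_slots_verts:
  fixes f :: "nat \<Rightarrow> real"
  assumes "S \<in> cycles n l" "3 \<le> l"
  shows "(\<Prod>s\<in>slots S. \<Prod>v\<in>snd s. f v) = (\<Prod>v\<in>verts S. (f v)\<^sup>2)"
proof -
  obtain vs ds where v: "distinct vs" "length vs = l" "length ds = l" and S: "S = cyc vs ds"
    using cyclesE[OF assms] by metis
  have "vs ! i \<noteq> vs ! (Suc i mod l)" if "i < l" for i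
    using card_cyc_edge[OF v(1), of i] v(2) assms(2) that by (auto simp: cyc_edge_def)
  then have "(\<Prod>s\<in>slots S. \<Prod>v\<in>snd s. f v) = (\<Prod>i<l. f (vs ! i) * f (vs ! (Suc i mod l)))"
    unfolding S slots_cyc[OF v assms(2)] prod.reindex[OF inj_on_slot[OF v assms(2)]]
    by (intro prod.cong refl) (simp add: cyc_edge_def v(2))
  also have "\<dots> = (\<Prod>v\<in>set vs. f v) * (\<Prod>v\<in>set vs. f v)"
    using prod_cycle_verts[OF v(1,2), of f] assms(2) by (simp add: prod.distrib)
  finally show ?thesis by (simp add: S power2_eq_square prod.distrib)
qed

context correlated_prior
begin

lemma component_integrable: "integrable prior (\<lambda>p. component d p * component d' p)"
proof (rule Bochner_Integration.integrable_bound[OF integrable_r2])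
  have [measurable]: "component d \<in> borel_measurable prior" for d
    by (cases d) (simp_all add: component_def[abs_def])
  show "(\<lambda>p. component d p * component d' p) \<in> borel_measurable prior" by measurable
  have "\<bar>component d p * component d' p\<bar> \<le> (r p)\<^sup>2" for p
  proof -
    have "\<bar>component d p\<bar> \<le> r p" for d
    proof -
      have "\<bar>x\<bar> \<le> 1 + x\<^sup>2" for x :: real
        using zero_le_power2[of "\<bar>x\<bar> - 1"] by (simp add: power2_diff)
      from this[of "fst p"] this[of "snd p"]
      have "\<bar>fst p\<bar> \<le> r p" "\<bar>snd p\<bar> \<le> r p"
        using zero_le_power2[of "fst p"] zero_le_power2[of "snd p"] unfolding r_def by linarith+
      then show ?thesis by (cases d) (simp_all add: component_def)
    qed
    then show ?thesis unfolding abs_mult power2_eq_square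
      using r_ge_1[of p] by (intro mult_mono) auto
  qed
  then show "AE p in prior. norm (component d p * component d' p) \<le> norm ((r p)\<^sup>2)"
    by (intro AE_I2) simp
qed

lemma component_integral: "(\<integral>p. component d p * component d' p \<partial>prior) = (if d = d' then 1 else rho)"
  using second_moments by (cases d; cases d') (simp_all add: component_def power2_eq_square mult.commute)

text \<open>Every vertex meets two edges, so its factor \<open>h v\<close> is a product of two
  components, with mean 1 or \<open>rho\<close> according as the decorations agree. Keeping
  \<open>h\<close> explicit allows \<open>planted_disjoint\<close> to combine two cycles before
  integrating.\<close>

lemma prod_spike_slots:
  assumes S: "S \<in> cycles n l" and l: "3 \<le> l"
  obtains h where "\<And>v. integrable prior (h v)"
    "\<And>xy. (\<Prod>s\<in>slots S. sp n xy s) = (\<Prod>v\<in>verts S. h v (xy v)) * ((1 / sqrt (real n)) ^ l * (\<Prod>s\<in>slots S. coef lam mu (fst s)))"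
    "(\<Prod>s\<in>slots S. coef lam mu (fst s)) * (\<Prod>v\<in>verts S. \<integral>p. h v p \<partial>prior) = Xi lam mu rho S"
proof -
  obtain vs ds where v: "distinct vs" "length vs = l" "length ds = l" and Sc: "S = cyc vs ds"
    using cyclesE[OF S l] by metis
  \<comment> \<open>The position of the edge that enters a given vertex, inverse to the shifted
    indexing of vertices.\<close>
  define idx where "idx = inv_into {..<l} (\<lambda>i. vs ! (Suc i mod l))"
  have idx: "idx (vs ! (Suc i mod l)) = i" if "i < l" for i
    unfolding idx_def using that by (intro inv_into_f_f inj_on_nth_Suc_mod[OF v l]) auto
  define h where "h w p = component (ds ! idx w) p * component (ds ! (Suc (idx w) mod l)) p" for w p
  have ne: "vs ! i \<noteq> vs ! (Suc i mod l)" if "i < l" for i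
    using card_cyc_edge[OF v(1), of i] v(2) l that by (auto simp: cyc_edge_def)
  have co: "(\<Prod>s\<in>slots S. coef lam mu (fst s)) = (\<Prod>i<l. coef lam mu (ds ! i))"
    unfolding Sc slots_cyc[OF v l] prod.reindex[OF inj_on_slot[OF v l]] by simp
  have "(\<Prod>s\<in>slots S. sp n xy s) =
    (\<Prod>v\<in>verts S. h v (xy v)) * ((1 / sqrt (real n)) ^ l * (\<Prod>s\<in>slots S. coef lam mu (fst s)))" for xy
  proof -
    have "(\<Prod>s\<in>slots S. sp n xy s) = (\<Prod>i<l. coef lam mu (ds ! i) * (1 / sqrt (real n)) *
        (component (ds ! i) (xy (vs ! i)) * component (ds ! i) (xy (vs ! (Suc i mod l)))))"
      unfolding Sc slots_cyc[OF v l] prod.reindex[OF inj_on_slot[OF v l]] using ne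
      by (intro prod.cong refl) (simp add: spike_def cyc_edge_def v(2))
    also have "\<dots> = (\<Prod>i<l. coef lam mu (ds ! i)) * (1 / sqrt (real n)) ^ l *
      ((\<Prod>i<l. component (ds ! i) (xy (vs ! i))) * (\<Prod>i<l. component (ds ! i) (xy (vs ! (Suc i mod l)))))"
      by (simp add: prod.distrib prod_dividef power_one_over)
    \<comment> \<open>Rotating this product by one position brings the two components at
      \<open>vs ! (Suc i mod l)\<close> to the same index.\<close>
    also have "(\<Prod>i<l. component (ds ! i) (xy (vs ! i))) = (\<Prod>i<l. component (ds ! (Suc i mod l)) (xy (vs ! (Suc i mod l))))"
      using prod.reindex_bij_betw[OF bij_betw_Suc_mod[of l], of "\<lambda>i. component (ds ! i) (xy (vs ! i))"] by simp
    also have "\<dots> * (\<Prod>i<l. component (ds ! i) (xy (vs ! (Suc i mod l)))) =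
        (\<Prod>i<l. h (vs ! (Suc i mod l)) (xy (vs ! (Suc i mod l))))"
      unfolding prod.distrib[symmetric] by (intro prod.cong refl) (simp add: h_def idx mult.commute)
    also have "\<dots> = (\<Prod>v\<in>verts S. h v (xy v))"
      unfolding Sc verts_cyc using l by (intro prod_cycle_verts[OF v(1,2)]) auto
    finally show ?thesis by (simp add: co)
  qed
  moreover have "(\<Prod>s\<in>slots S. coef lam mu (fst s)) * (\<Prod>v\<in>verts S. \<integral>p. h v p \<partial>prior) = Xi lam mu rho S"
  proof -
    have "(\<Prod>v\<in>verts S. \<integral>p. h v p \<partial>prior) = (\<Prod>i<l. \<integral>p. h (vs ! (Suc i mod l)) p \<partial>prior)"
      unfolding Sc verts_cyc using l by (intro prod_cycle_verts(2)[OF v(1,2), symmetric]) auto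
    also have "\<dots> = (\<Prod>i<l. if ds ! i = ds ! (Suc i mod l) then 1 else rho)"
      by (intro prod.cong refl) (simp add: h_def component_integral idx)
    finally show ?thesis unfolding co by (simp add: Sc Xi_cyc[OF v l])
  qed
  ultimately show thesis using that[of h] component_integrable by (simp add: h_def[abs_def])
qed

lemma prod_q_slots:
  assumes "S \<in> cycles n l" "3 \<le> l"
  shows "(\<Prod>s\<in>slots S. q xy s) = (\<Prod>v\<in>verts S. r (xy v))"
proof -
  have "(sqrt (r p))\<^sup>2 = r p" for p using r_ge_1[of p] by simp
  then show ?thesis unfolding q_def prod_slots_verts[OF assms] by simp
qed

lemma cycles_kslots: "S \<in> cycles n l \<Longrightarrow> slots S \<subseteq> kslots n"
  using f_sub_eq(2) by (auto simp: cycles_def)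

lemma verts_cycles: "S \<in> cycles n l \<Longrightarrow> verts S \<subseteq> {..<n}"
  by (auto simp: cycles_def subgraphs_K_def)

text \<open>On the diagonal no slot gains \<open>n^(-1/2)\<close>, so bounding each factor by
  \<open>q^2\<close> would leave \<open>K^l\<close> after integration. Here the convexity bound is
  applied with weights \<open>q^2\<close> and \<open>t = 1 / n\<close>.\<close>

lemma mixed_self_le:
  assumes S: "S \<in> cycles n l" and l: "3 \<le> l" and n: "1 \<le> n"
  shows "mixed (slots S) (slots S) (sp n xy) \<le> 1 + 2 ^ l / real n * (\<Prod>v\<in>verts S. (r (xy v))\<^sup>2)"
proof -
  let ?A = "slots S"
  have A: "s \<in> kslots n" if "s \<in> ?A" for s using that cycles_kslots[OF S] by blast
  have "mixed ?A ?A (sp n xy) = (\<Prod>s\<in>?A. 1 + (sp n xy s)\<^sup>2)" by (rule mixed_self)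
  also have "\<dots> \<le> (\<Prod>s\<in>?A. 1 + 1 / real n * (q xy s)\<^sup>2)"
  proof (intro prod_mono conjI add_left_mono)
    fix s assume "s \<in> ?A"
    from power_mono[OF spike_bounds(1)[OF A[OF this] n], of xy 2]
    show "(sp n xy s)\<^sup>2 \<le> 1 / real n * (q xy s)\<^sup>2" by (simp add: power_divide)
  qed (simp add: add_nonneg_nonneg)
  also have "\<dots> \<le> 1 + 1 / real n * ((\<Prod>s\<in>?A. 1 + (q xy s)\<^sup>2) - 1)"
    using n by (intro prod_one_plus_scaled_le) auto
  also have "\<dots> \<le> 1 + 1 / real n * (\<Prod>s\<in>?A. 2 * (q xy s)\<^sup>2)"
  proof -
    \<comment> \<open>\<open>1 + q^2 \<le> 2 q^2\<close> since \<open>q \<ge> 1\<close>; this is the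
      origin of \<open>2 ^ l\<close>.\<close>
    have "(\<Prod>s\<in>?A. 1 + (q xy s)\<^sup>2) \<le> (\<Prod>s\<in>?A. 2 * (q xy s)\<^sup>2)"
      using one_le_power[OF q_ge_1, of xy _ 2] by (intro prod_mono) (auto simp: add_nonneg_nonneg)
    then show ?thesis by (intro add_left_mono mult_left_mono) auto
  qed
  also have "(\<Prod>s\<in>?A. 2 * (q xy s)\<^sup>2) = 2 ^ l * (\<Prod>v\<in>verts S. (r (xy v))\<^sup>2)"
    by (simp add: prod.distrib card_slots[OF S l] prod_power_distrib[symmetric] prod_q_slots[OF S l])
  finally show ?thesis by simp
qed

lemma spike_integrable_slots:
  assumes S: "S \<in> cycles n l" and l: "3 \<le> l" and n: "1 \<le> n"
  shows "spike_integrable n (slots S)"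
  unfolding spike_integrable_def
proof
  show A: "slots S \<subseteq> kslots n" by (rule cycles_kslots[OF S])
  interpret prob_space "PX n" by (rule prob_space_PX)
  show "integrable (PX n) (\<lambda>xy. mixed (slots S) (slots S) (sp n xy))"
  proof (rule Bochner_Integration.integrable_bound)
    show "integrable (PX n) (\<lambda>xy. 1 + 2 ^ l / real n * (\<Prod>v\<in>verts S. (r (xy v))\<^sup>2))"
      using PX_prod_r2[OF verts_cycles[OF S]] by simp
    show "(\<lambda>xy. mixed (slots S) (slots S) (sp n xy)) \<in> borel_measurable (PX n)"
      by (rule measurable_mixed[OF A A])
    have "\<bar>mixed (slots S) (slots S) (sp n xy)\<bar> \<le> \<bar>1 + 2 ^ l / real n * (\<Prod>v\<in>verts S. (r (xy v))\<^sup>2)\<bar>" for xy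
    proof -
      have "mixed (slots S) (slots S) (sp n xy) \<ge> 0"
        unfolding mixed_self by (intro prod_nonneg) (simp add: add_nonneg_nonneg)
      then show ?thesis using mixed_self_le[OF S l n, of xy] by linarith
    qed
    then show "AE xy in PX n. norm (mixed (slots S) (slots S) (sp n xy))
        \<le> norm (1 + 2 ^ l / real n * (\<Prod>v\<in>verts S. (r (xy v))\<^sup>2))"
      by (intro AE_I2) simp
  qed
qed

text \<open>Only slots lying in exactly one of the cycles gain \<open>n^(-1/2)\<close>. Shared slots
  carry \<open>q\<close> twice, so the \<open>q\<close> factors multiply to those of the two cycles
  taken separately, that is, one \<open>r\<close> per vertex and cycle.\<close>

lemma mixed_le:
  assumes S: "S \<in> cycles n l" and T: "T \<in> cycles n l" and l: "3 \<le> l" and n: "1 \<le> n"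
  shows "mixed (slots S) (slots T) (sp n xy)
    \<le> real n ^ card (slots S \<inter> slots T) / real n ^ l * (\<Prod>v\<in>verts S \<union> verts T. (r (xy v))\<^sup>2)"
proof -
  let ?A = "slots S" and ?B = "slots T"
  let ?D = "(?A \<union> ?B) - (?A \<inter> ?B)"
  have fin: "finite ?A" "finite ?B" using finite_slots S T l by auto
  have finV: "finite (verts S)" "finite (verts T)"
    using verts_cycles S T finite_subset finite_lessThan by metis+
  have AB: "s \<in> kslots n" if "s \<in> ?A \<union> ?B" for s using that cycles_kslots S T by blast
  have cA: "card ?A = l" "card ?B = l" using card_slots S T l by auto
  have "card ?A + card ?B = card (?A \<union> ?B) + card (?A \<inter> ?B)" by (rule card_Un_Int[OF fin])
  moreover have "card ?D = card (?A \<union> ?B) - card (?A \<inter> ?B)" using fin by (intro card_Diff_subset) auto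
  moreover have "card (?A \<inter> ?B) \<le> card (?A \<union> ?B)" using fin by (intro card_mono) auto
  moreover have al: "card (?A \<inter> ?B) \<le> l" using cA fin card_mono[of ?A "?A \<inter> ?B"] by simp
  \<comment> \<open>Each cycle has \<open>l\<close> slots and loses the common ones, so the exponent
    is even and the square root of \<open>n\<close> disappears.\<close>
  ultimately have cD: "card ?D = 2 * (l - card (?A \<inter> ?B))" using cA by simp
  have pow: "(1 / sqrt (real n)) ^ card ?D = real n ^ card (?A \<inter> ?B) / real n ^ l"
    unfolding cD power_mult using n al by (simp add: power_one_over power_diff power_divide)
  have "mixed ?A ?B (sp n xy) \<le> \<bar>mixed ?A ?B (sp n xy)\<bar>" by simp
  also have "\<dots> = (\<Prod>s\<in>?A \<inter> ?B. \<bar>1 + (sp n xy s)\<^sup>2\<bar>) * (\<Prod>s\<in>?D. \<bar>sp n xy s\<bar>)"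
    unfolding mixed_def abs_mult abs_prod ..
  also have "\<dots> \<le> (\<Prod>s\<in>?A \<inter> ?B. (q xy s)\<^sup>2) * (\<Prod>s\<in>?D. q xy s / sqrt (real n))"
  proof (intro mult_mono prod_mono conjI prod_nonneg)
    fix s assume "s \<in> ?A \<inter> ?B"
    then have "s \<in> kslots n" using AB by blast
    from spike_bounds(2)[OF this n, of xy] show "\<bar>1 + (sp n xy s)\<^sup>2\<bar> \<le> (q xy s)\<^sup>2" by simp
  next
    fix s assume "s \<in> ?D"
    then have "s \<in> kslots n" using AB by blast
    from spike_bounds(1)[OF this n] show "\<bar>sp n xy s\<bar> \<le> q xy s / sqrt (real n)" .
  qed auto
  also have "\<dots> = (1 / sqrt (real n)) ^ card ?D * ((\<Prod>s\<in>?A \<inter> ?B. (q xy s)\<^sup>2) * (\<Prod>s\<in>?D. q xy s))"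
    by (simp add: prod_dividef power_one_over)
  also have "(\<Prod>s\<in>?A \<inter> ?B. (q xy s)\<^sup>2) * (\<Prod>s\<in>?D. q xy s) = (\<Prod>v\<in>verts S. r (xy v)) * (\<Prod>v\<in>verts T. r (xy v))"
    unfolding prod_mult_prod[OF fin, symmetric] prod_q_slots[OF S l] prod_q_slots[OF T l] ..
  \<comment> \<open>A common vertex already carries \<open>r^2\<close>; at the others
    \<open>r \<le> r^2\<close>.\<close>
  also have "(1 / sqrt (real n)) ^ card ?D * ((\<Prod>v\<in>verts S. r (xy v)) * (\<Prod>v\<in>verts T. r (xy v)))
    \<le> (1 / sqrt (real n)) ^ card ?D * (\<Prod>v\<in>verts S \<union> verts T. (r (xy v))\<^sup>2)"
    unfolding prod_mult_prod[OF finV] prod_Un_if[OF finV, symmetric]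
    using r_ge_1 order_trans[OF zero_le_one r_ge_1]
    by (intro prod_mono mult_left_mono) (auto simp: power2_eq_square mult_le_cancel_left1)
  finally show ?thesis unfolding pow .
qed

section \<open>Planted and null moments of cycle monomials\<close>

abbreviation PL :: "nat \<Rightarrow> (rmat \<times> rmat) measure" where
  "PL n \<equiv> planted_law lam mu prior n"

lemma f_sub_slots: "S \<in> cycles n l \<Longrightarrow> f_sub S XY = (\<Prod>s\<in>slots S. entry XY s)"
  using f_sub_eq(1)[of S n] by (simp add: cycles_def)

lemma planted_integrable_f_sub2:
  assumes "S \<in> cycles n l" "T \<in> cycles n l" "3 \<le> l" "1 \<le> n"
  shows "integrable (PL n) (\<lambda>XY. f_sub S XY * f_sub T XY)"
    "(\<integral>XY. f_sub S XY * f_sub T XY \<partial>PL n) = (\<integral>xy. mixed (slots S) (slots T) (sp n xy) \<partial>PX n)"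
  using planted_prod_entry[OF spike_integrable_slots[OF assms(1,3,4)] spike_integrable_slots[OF assms(2,3,4)]]
  unfolding f_sub_slots[OF assms(1)] f_sub_slots[OF assms(2)] by auto

lemma planted_f_sub:
  assumes S: "S \<in> cycles n l" and l: "3 \<le> l" and n: "1 \<le> n"
  shows "integrable (PL n) (f_sub S)" "(\<integral>XY. f_sub S XY \<partial>PL n) = (1 / sqrt (real n)) ^ l * Xi lam mu rho S"
proof -
  \<comment> \<open>With the empty set as second factor, \<open>mixed\<close> is the plain product
    of the spike entries, so the first moment is a special case of the second.\<close>
  note p = planted_prod_entry[OF spike_integrable_slots[OF S l n] spike_integrable_empty]
  show "integrable (PL n) (f_sub S)"
    using p(1) unfolding f_sub_slots[OF S, abs_def] by simp
  obtain h where h: "\<And>v. integrable prior (h v)"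
    "\<And>xy. (\<Prod>s\<in>slots S. sp n xy s) = (\<Prod>v\<in>verts S. h v (xy v)) * ((1 / sqrt (real n)) ^ l * (\<Prod>s\<in>slots S. coef lam mu (fst s)))"
    "(\<Prod>s\<in>slots S. coef lam mu (fst s)) * (\<Prod>v\<in>verts S. \<integral>p. h v p \<partial>prior) = Xi lam mu rho S"
    by (rule prod_spike_slots[OF S l], rule that)
  have "(\<integral>XY. f_sub S XY \<partial>PL n) = (\<integral>xy. (\<Prod>s\<in>slots S. sp n xy s) \<partial>PX n)"
    using p(2) by (simp add: f_sub_slots[OF S] mixed_def)
  also have "\<dots> = (\<Prod>v\<in>verts S. \<integral>p. h v p \<partial>prior) * ((1 / sqrt (real n)) ^ l * (\<Prod>s\<in>slots S. coef lam mu (fst s)))"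
    unfolding h(2) using PX_prod[OF verts_cycles[OF S], of h] h(1) by simp
  also have "\<dots> = (1 / sqrt (real n)) ^ l * Xi lam mu rho S"
    unfolding h(3)[symmetric] by (simp add: ac_simps)
  finally show "(\<integral>XY. f_sub S XY \<partial>PL n) = (1 / sqrt (real n)) ^ l * Xi lam mu rho S" .
qed

lemma planted_disjoint:
  assumes S: "S \<in> cycles n l" and T: "T \<in> cycles n l" and l: "3 \<le> l" and n: "1 \<le> n"
    and dis: "verts S \<inter> verts T = {}"
  shows "(\<integral>XY. f_sub S XY * f_sub T XY \<partial>PL n)
    = ((1 / sqrt (real n)) ^ l * Xi lam mu rho S) * ((1 / sqrt (real n)) ^ l * Xi lam mu rho T)"
proof -
  obtain h where h: "\<And>v. integrable prior (h v)"
    "\<And>xy. (\<Prod>s\<in>slots S. sp n xy s) = (\<Prod>v\<in>verts S. h v (xy v)) * ((1 / sqrt (real n)) ^ l * (\<Prod>s\<in>slots S. coef lam mu (fst s)))"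
    "(\<Prod>s\<in>slots S. coef lam mu (fst s)) * (\<Prod>v\<in>verts S. \<integral>p. h v p \<partial>prior) = Xi lam mu rho S"
    by (rule prod_spike_slots[OF S l], rule that)
  obtain k where k: "\<And>v. integrable prior (k v)"
    "\<And>xy. (\<Prod>s\<in>slots T. sp n xy s) = (\<Prod>v\<in>verts T. k v (xy v)) * ((1 / sqrt (real n)) ^ l * (\<Prod>s\<in>slots T. coef lam mu (fst s)))"
    "(\<Prod>s\<in>slots T. coef lam mu (fst s)) * (\<Prod>v\<in>verts T. \<integral>p. k v p \<partial>prior) = Xi lam mu rho T"
    by (rule prod_spike_slots[OF T l], rule that)
  \<comment> \<open>Gluing the two vertex families makes independence over the union of the vertex
    sets applicable at once.\<close>
  define g where "g v = (if v \<in> verts S then h v else k v)" for v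
  have finV: "finite (verts S)" "finite (verts T)"
    using verts_cycles S T finite_subset finite_lessThan by metis+
  \<comment> \<open>The functional \<open>c\<close> is arbitrary because the regrouping is needed
    for evaluation at a point and again for integration.\<close>
  have gU: "(\<Prod>v\<in>verts S. c v (h v)) * (\<Prod>v\<in>verts T. c v (k v)) = (\<Prod>v\<in>verts S \<union> verts T. c v (g v))"
    for c :: "nat \<Rightarrow> (real \<times> real \<Rightarrow> real) \<Rightarrow> real"
    unfolding prod.union_disjoint[OF finV dis] using dis
    by (intro arg_cong2[where f = "(*)"] prod.cong) (auto simp: g_def)
  have "slots S \<inter> slots T = {}"
  proof (rule ccontr)
    assume "slots S \<inter> slots T \<noteq> {}"
    then obtain d e where "(d, e) \<in> slots S" "(d, e) \<in> slots T" by auto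
    then have "e \<subseteq> verts S \<inter> verts T" "card e = 2" using slots_edge S T by blast+
    then show False using dis by auto
  qed
  then have mx: "mixed (slots S) (slots T) (sp n xy) = (\<Prod>s\<in>slots S. sp n xy s) * (\<Prod>s\<in>slots T. sp n xy s)" for xy
    unfolding mixed_def using finite_slots[OF S l] finite_slots[OF T l] by (simp add: prod.union_disjoint)
  let ?cS = "(1 / sqrt (real n)) ^ l * (\<Prod>s\<in>slots S. coef lam mu (fst s))"
  let ?cT = "(1 / sqrt (real n)) ^ l * (\<Prod>s\<in>slots T. coef lam mu (fst s))"
  have "(\<integral>XY. f_sub S XY * f_sub T XY \<partial>PL n) = (\<integral>xy. (\<Prod>v\<in>verts S \<union> verts T. g v (xy v)) * (?cS * ?cT) \<partial>PX n)"
    unfolding planted_integrable_f_sub2(2)[OF S T l n] mx h(2) k(2) gU[of "\<lambda>v f. f (xy v)" for xy, symmetric]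
    by (simp add: ac_simps)
  also have "\<dots> = (\<Prod>v\<in>verts S \<union> verts T. \<integral>p. g v p \<partial>prior) * (?cS * ?cT)"
    using PX_prod[of "verts S \<union> verts T" n g] verts_cycles S T h(1) k(1) by (simp add: g_def)
  also have "\<dots> = ((1 / sqrt (real n)) ^ l * Xi lam mu rho S) * ((1 / sqrt (real n)) ^ l * Xi lam mu rho T)"
    unfolding gU[of "\<lambda>v f. \<integral>p. f p \<partial>prior", symmetric] h(3)[symmetric] k(3)[symmetric] by (simp add: ac_simps)
  finally show ?thesis .
qed

lemma planted_same:
  assumes S: "S \<in> cycles n l" and l: "3 \<le> l" and n: "1 \<le> n"
  shows "(\<integral>XY. f_sub S XY * f_sub S XY \<partial>PL n) \<le> 1 + (2 * K) ^ l / real n"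
proof -
  interpret P: prob_space "PX n" by (rule prob_space_PX)
  note V = PX_prod_r2[OF verts_cycles[OF S]]
  have "(\<integral>xy. mixed (slots S) (slots S) (sp n xy) \<partial>PX n)
      \<le> (\<integral>xy. 1 + 2 ^ l / real n * (\<Prod>v\<in>verts S. (r (xy v))\<^sup>2) \<partial>PX n)"
    using spike_integrable_slots[OF S l n] V(1) mixed_self_le[OF S l n]
    by (intro integral_mono) (auto simp: spike_integrable_def)
  also have "\<dots> = 1 + 2 ^ l / real n * K ^ l"
    using V by (simp add: P.prob_space card_verts_cycle[OF S l])
  finally show ?thesis
    unfolding planted_integrable_f_sub2(2)[OF S S l n] by (simp add: power_mult_distrib)
qed

text \<open>By \<open>card_common_slots\<close> the exponent of \<open>n\<close> in
  \<open>mixed_le\<close> is at most \<open>k - 1 - l\<close> for \<open>k\<close> common vertices.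
  It is written as \<open>k - (l + 1)\<close> to match the weights in
  \<open>sum_cycles_overlap_le\<close>.\<close>

lemma planted_overlap:
  assumes S: "S \<in> cycles n l" and T: "T \<in> cycles n l" and l: "3 \<le> l" and n: "1 \<le> n"
    and neq: "S \<noteq> T" and int: "verts S \<inter> verts T \<noteq> {}"
  shows "(\<integral>XY. f_sub S XY * f_sub T XY \<partial>PL n)
    \<le> K ^ (2 * l) / real n ^ Suc l * real n ^ card (verts S \<inter> verts T)"
proof -
  let ?V = "verts S \<union> verts T" and ?a = "card (slots S \<inter> slots T)" and ?k = "card (verts S \<inter> verts T)"
  have finV: "finite (verts S)" "finite (verts T)"
    using verts_cycles S T finite_subset finite_lessThan by metis+
  have V: "?V \<subseteq> {..<n}" using verts_cycles S T by auto
  note P = PX_prod_r2[OF V]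
  have "(\<integral>xy. mixed (slots S) (slots T) (sp n xy) \<partial>PX n)
      \<le> (\<integral>xy. real n ^ ?a / real n ^ l * (\<Prod>v\<in>?V. (r (xy v))\<^sup>2) \<partial>PX n)"
  proof (rule integral_mono)
    show "integrable (PX n) (\<lambda>xy. mixed (slots S) (slots T) (sp n xy))"
      by (rule planted_prod_entry(3)[OF spike_integrable_slots[OF S l n] spike_integrable_slots[OF T l n]])
  qed (use P(1) mixed_le[OF S T l n] in auto)
  also have "\<dots> = real n ^ ?a / real n ^ l * K ^ card ?V" using P by simp
  also have "\<dots> \<le> real n ^ (?k - 1) / real n ^ l * K ^ (2 * l)"
  proof (intro mult_mono divide_right_mono power_increasing)
    show "?a \<le> ?k - 1" using card_common_slots[OF S T l neq int] by simp
    show "card ?V \<le> 2 * l" using card_Un_le[of "verts S" "verts T"] card_verts_cycle S T l by simp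
  qed (use n K_ge_1 in auto)
  also have "real n ^ (?k - 1) / real n ^ l = real n ^ ?k / real n ^ Suc l"
  proof -
    have "?k \<noteq> 0" using int finV by simp
    then obtain j where "?k = Suc j" using not0_implies_Suc by blast
    then show ?thesis using n by simp
  qed
  finally show ?thesis
    unfolding planted_integrable_f_sub2(2)[OF S T l n] by (simp add: mult.commute)
qed

text \<open>Distinct cycles differ in some slot, whose centred normal then occurs only once and
  kills the expectation.\<close>

lemma null_f_sub2:
  assumes S: "S \<in> cycles n l" and T: "T \<in> cycles n l" and l: "3 \<le> l"
  shows "integrable (null_law n) (\<lambda>XY. f_sub S XY * f_sub T XY)"
    "(\<integral>XY. f_sub S XY * f_sub T XY \<partial>null_law n) = (if S = T then 1 else 0)"
proof -
  note p = null_law_shifted[OF cycles_kslots[OF S] cycles_kslots[OF T], of "\<lambda>_. 0"]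
  have e: "f_sub S XY = shifted (slots S) (\<lambda>_. 0) XY" "f_sub T XY = shifted (slots T) (\<lambda>_. 0) XY" for XY
    using f_sub_slots S T by (simp_all add: shifted_def)
  show "integrable (null_law n) (\<lambda>XY. f_sub S XY * f_sub T XY)" unfolding e by (rule p(1))
  have fin: "finite (slots S)" "finite (slots T)" using finite_slots S T l by auto
  have "mixed (slots S) (slots T) (\<lambda>_. 0) = (if S = T then 1 else 0)"
  proof (cases "S = T")
    case False
    then have "slots S \<noteq> slots T" using slots_eqD[OF S T l] by blast
    then obtain s where "s \<in> (slots S \<union> slots T) - (slots S \<inter> slots T)" by blast
    then have "(\<Prod>s\<in>(slots S \<union> slots T) - (slots S \<inter> slots T). 0 :: real) = 0"
      using fin by (intro prod_zero bexI[of _ s]) simp_all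
    then show ?thesis using False unfolding mixed_def by (simp only: mult_zero_right if_False)
  qed (simp add: mixed_def)
  then show "(\<integral>XY. f_sub S XY * f_sub T XY \<partial>null_law n) = (if S = T then 1 else 0)"
    unfolding e p(2) .
qed

end

section \<open>The cycle statistic and its test errors\<close>

lemma square_sum: "(\<Sum>i\<in>A. f i)\<^sup>2 = (\<Sum>i\<in>A. \<Sum>j\<in>A. f i * (f j :: real))"
  by (simp add: power2_eq_square sum_product)

lemma measurable_f_cycle: "f_cycle lam mu rho l n \<in> borel_measurable (mat_space n \<Otimes>\<^sub>M mat_space n)"
proof -
  have "f_sub S \<in> borel_measurable (mat_space n \<Otimes>\<^sub>M mat_space n)" if "S \<in> subgraphs_K n" for S
  proof -
    have "(\<lambda>XY. \<Prod>s\<in>slots S. entry XY s) \<in> borel_measurable (mat_space n \<Otimes>\<^sub>M mat_space n)"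
      using f_sub_eq(2)[OF that] by (intro borel_measurable_prod measurable_entry) auto
    then show ?thesis unfolding f_sub_eq(1)[OF that, abs_def] .
  qed
  then show ?thesis
    unfolding f_cycle_def[abs_def]
    by (intro borel_measurable_times borel_measurable_sum borel_measurable_const) auto
qed

context correlated_prior
begin

context
  fixes n l :: nat
  assumes l: "3 \<le> l" and n: "1 \<le> n" and beta: "beta lam mu rho l > 0" and rho: "rho \<in> {0..1}"
begin

abbreviation "b \<equiv> beta lam mu rho l"
abbreviation "f \<equiv> f_cycle lam mu rho l n"
abbreviation "N \<equiv> real (card (dlists n l))"
abbreviation "x \<equiv> Xi lam mu rho"
abbreviation "Cy \<equiv> cycles n l"

text \<open>The total of the overlapping pairs, before division by \<open>beta\<close>: moments give
  \<open>K^(2 l)\<close>, the choice of \<open>S\<close> gives \<open>(2 n)^l\<close>, the weighted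
  sum over \<open>T\<close> gives \<open>(2 n (l + 1))^l\<close>, and the normalisations divide by
  \<open>n^(2 l + 1)\<close>.\<close>

definition overlap_error :: real where
  "overlap_error = (4 * K\<^sup>2 * (real l + 1)) ^ l / real n"

lemma Xi_bounds: "0 \<le> x S" "x S \<le> 1"
proof -
  show "0 \<le> x S" using lam mu rho by (simp add: Xi_def)
  have "x S \<le> 1 * 1 * 1"
    unfolding Xi_def using lam mu rho by (intro mult_mono power_le_one) auto
  then show "x S \<le> 1" by simp
qed

lemma f_square: "(f XY)\<^sup>2 = 1 / (real n ^ l * b) * (\<Sum>S\<in>Cy. \<Sum>T\<in>Cy. x S * x T * (f_sub S XY * f_sub T XY))"
proof -
  have "(f XY)\<^sup>2 = (1 / sqrt (real n ^ l * b))\<^sup>2 * (\<Sum>S\<in>Cy. x S * f_sub S XY)\<^sup>2"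
    unfolding f_cycle_eq[OF l] by (rule power_mult_distrib)
  also have "(1 / sqrt (real n ^ l * b))\<^sup>2 = 1 / (real n ^ l * b)"
    using beta n by (simp add: power_divide)
  finally show ?thesis unfolding square_sum by (simp add: ac_simps)
qed

lemma sum_Xi2: "(\<Sum>S\<in>Cy. (x S)\<^sup>2) = b * N"
  using beta_times_card[OF l, of lam mu rho n] by simp

lemma N_le: "N \<le> real n ^ l"
  using card_dlists_le[of n l] by (simp flip: of_nat_power)

lemma null_second_moment: "integrable (null_law n) (\<lambda>XY. (f XY)\<^sup>2)" "(\<integral>XY. (f XY)\<^sup>2 \<partial>null_law n) \<le> 1"
proof -
  show "integrable (null_law n) (\<lambda>XY. (f XY)\<^sup>2)"
    unfolding f_square using null_f_sub2(1) l by (intro integrable_mult_right integrable_sum) auto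
  have "(\<integral>XY. (f XY)\<^sup>2 \<partial>null_law n)
      = 1 / (real n ^ l * b) * (\<Sum>S\<in>Cy. \<Sum>T\<in>Cy. x S * x T * (\<integral>XY. f_sub S XY * f_sub T XY \<partial>null_law n))"
    unfolding f_square using null_f_sub2(1) l by (simp add: Bochner_Integration.integral_sum)
  also have "(\<Sum>S\<in>Cy. \<Sum>T\<in>Cy. x S * x T * (\<integral>XY. f_sub S XY * f_sub T XY \<partial>null_law n)) = (\<Sum>S\<in>Cy. (x S)\<^sup>2)"
    using finite_cycles[OF l, of n]
    by (intro sum.cong refl) (simp add: null_f_sub2(2) l power2_eq_square if_distrib[of "(*) _"] cong: if_cong)
  also have "1 / (real n ^ l * b) * (\<Sum>S\<in>Cy. (x S)\<^sup>2) = N / real n ^ l"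
    unfolding sum_Xi2 using beta by simp
  also have "\<dots> \<le> 1" using N_le n by simp
  finally show "(\<integral>XY. (f XY)\<^sup>2 \<partial>null_law n) \<le> 1" .
qed

text \<open>The closed form is for estimating the mean; the plain sum over cycles is what the
  product terms of \<open>planted_pair_le\<close> add up to.\<close>

lemma planted_mean:
  "integrable (PL n) f" "(\<integral>XY. f XY \<partial>PL n) = N / real n ^ l * sqrt b"
  "(\<integral>XY. f XY \<partial>PL n) = 1 / sqrt (real n ^ l * b) * (\<Sum>S\<in>Cy. x S * ((1 / sqrt (real n)) ^ l * x S))"
proof -
  show "integrable (PL n) f"
    unfolding f_cycle_eq[OF l, abs_def] using planted_f_sub(1) l n by (intro integrable_mult_right integrable_sum) auto
  show *: "(\<integral>XY. f XY \<partial>PL n) = 1 / sqrt (real n ^ l * b) * (\<Sum>S\<in>Cy. x S * ((1 / sqrt (real n)) ^ l * x S))"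
    unfolding f_cycle_eq[OF l, abs_def] using planted_f_sub l n by (simp add: Bochner_Integration.integral_sum)
  have "(\<Sum>S\<in>Cy. x S * ((1 / sqrt (real n)) ^ l * x S)) = (1 / sqrt (real n)) ^ l * (\<Sum>S\<in>Cy. (x S)\<^sup>2)"
    unfolding sum_distrib_left by (intro sum.cong) (simp_all add: power2_eq_square ac_simps)
  also have "\<dots> = (1 / sqrt (real n ^ l)) * (b * N)"
    unfolding sum_Xi2 by (simp add: power_one_over real_sqrt_power)
  also have "1 / sqrt (real n ^ l * b) * \<dots> = N / real n ^ l * sqrt b"
    using beta n by (simp add: real_sqrt_mult field_simps)
  finally show "(\<integral>XY. f XY \<partial>PL n) = N / real n ^ l * sqrt b" unfolding * .
qed

text \<open>All three summands are nonnegative, so each kind of pair keeps its own and adds the rest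
  for free. Including \<open>m S * m T\<close> for overlapping pairs as well makes the first summand
  add up to exactly the squared mean, which the variance removes.\<close>

lemma planted_pair_le:
  assumes S: "S \<in> Cy" and T: "T \<in> Cy"
  defines "m \<equiv> \<lambda>S :: nat dgraph. x S * ((1 / sqrt (real n)) ^ l * x S)"
  shows "x S * x T * (\<integral>XY. f_sub S XY * f_sub T XY \<partial>PL n) \<le>
    m S * m T + (if S = T then (x S)\<^sup>2 * (1 + (2 * K) ^ l / real n) else 0)
      + K ^ (2 * l) / real n ^ Suc l * real n ^ card (verts S \<inter> verts T)"
proof -
  let ?B = "K ^ (2 * l) / real n ^ Suc l * real n ^ card (verts S \<inter> verts T)"
  have B: "?B \<ge> 0" using K_ge_1 by simp
  have m: "m S \<ge> 0" for S :: "nat dgraph" using Xi_bounds(1)[of S] by (simp add: m_def)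
  consider "verts S \<inter> verts T = {}" | "S = T" "verts S \<inter> verts T \<noteq> {}" | "S \<noteq> T" "verts S \<inter> verts T \<noteq> {}" by blast
  then show ?thesis
  proof cases
    case 1
    have "x S * x T * (\<integral>XY. f_sub S XY * f_sub T XY \<partial>PL n) = m S * m T"
      unfolding planted_disjoint[OF S T l n 1] m_def by (simp add: ac_simps)
    moreover have "(if S = T then (x S)\<^sup>2 * (1 + (2 * K) ^ l / real n) else 0) \<ge> 0"
      using K_ge_1 by simp
    ultimately show ?thesis using B by linarith
  next
    case 2
    have "(x S)\<^sup>2 * (\<integral>XY. f_sub S XY * f_sub S XY \<partial>PL n) \<le> (x S)\<^sup>2 * (1 + (2 * K) ^ l / real n)"
      by (intro mult_left_mono planted_same[OF S l n]) simp
    moreover have "m S * m T \<ge> 0" using m by simp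
    moreover have "x S * x T * (\<integral>XY. f_sub S XY * f_sub T XY \<partial>PL n) = (x S)\<^sup>2 * (\<integral>XY. f_sub S XY * f_sub S XY \<partial>PL n)"
      by (simp add: 2(1) power2_eq_square)
    moreover have "(if S = T then (x S)\<^sup>2 * (1 + (2 * K) ^ l / real n) else 0) = (x S)\<^sup>2 * (1 + (2 * K) ^ l / real n)"
      using 2(1) by simp
    ultimately show ?thesis using B by linarith
  next
    case 3
    have "x S * x T \<le> 1 * 1" using Xi_bounds by (intro mult_mono) auto
    then have "x S * x T * (\<integral>XY. f_sub S XY * f_sub T XY \<partial>PL n) \<le> x S * x T * ?B"
      using mult_nonneg_nonneg[OF Xi_bounds(1) Xi_bounds(1)] by (intro mult_left_mono planted_overlap[OF S T l n 3]) auto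
    also have "\<dots> \<le> 1 * ?B" using \<open>x S * x T \<le> 1 * 1\<close> B by (intro mult_right_mono) auto
    finally have "x S * x T * (\<integral>XY. f_sub S XY * f_sub T XY \<partial>PL n) \<le> ?B" by simp
    moreover have "m S * m T \<ge> 0" using m by simp
    ultimately show ?thesis using 3(1) by simp
  qed
qed

lemma planted_second_moment:
  "integrable (PL n) (\<lambda>XY. (f XY)\<^sup>2)"
  "(\<integral>XY. (f XY)\<^sup>2 \<partial>PL n) \<le> (\<integral>XY. f XY \<partial>PL n)\<^sup>2 + (1 + overlap_error + overlap_error / b)"
proof -
  let ?E = "\<lambda>S T. \<integral>XY. f_sub S XY * f_sub T XY \<partial>PL n"
  define m where "m S = x S * ((1 / sqrt (real n)) ^ l * x S)" for S :: "nat dgraph"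
  define B where "B = K ^ (2 * l) / real n ^ Suc l"
  have B: "B \<ge> 0" using K_ge_1 by (simp add: B_def)
  have nb: "real n ^ l * b > 0" using n beta by simp
  have split: "a * (\<Sum>S\<in>Cy. \<Sum>T\<in>Cy. m S * m T + (if S = T then g S * w else 0) + B * h S T)
    = a * (\<Sum>S\<in>Cy. m S)\<^sup>2 + a * ((\<Sum>S\<in>Cy. g S) * w) + a * (B * (\<Sum>S\<in>Cy. \<Sum>T\<in>Cy. h S T))"
    for a w :: real and g :: "nat dgraph \<Rightarrow> real" and h
    using finite_cycles[OF l, of n]
    by (simp add: sum.distrib square_sum distrib_left sum_distrib_right sum_distrib_left)
  note i = planted_integrable_f_sub2(1)[OF _ _ l n]
  show "integrable (PL n) (\<lambda>XY. (f XY)\<^sup>2)"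
    unfolding f_square using i by (intro integrable_mult_right integrable_sum) auto
  have "(\<integral>XY. (f XY)\<^sup>2 \<partial>PL n) = 1 / (real n ^ l * b) * (\<Sum>S\<in>Cy. \<Sum>T\<in>Cy. x S * x T * ?E S T)"
    unfolding f_square using i by (simp add: Bochner_Integration.integral_sum)
  also have "\<dots> \<le> 1 / (real n ^ l * b) * (\<Sum>S\<in>Cy. \<Sum>T\<in>Cy.
      m S * m T + (if S = T then (x S)\<^sup>2 * (1 + (2 * K) ^ l / real n) else 0) + B * real n ^ card (verts S \<inter> verts T))"
    using nb unfolding m_def B_def by (intro mult_left_mono sum_mono planted_pair_le) auto
  also have "\<dots> = 1 / (real n ^ l * b) * (\<Sum>S\<in>Cy. m S)\<^sup>2
      + 1 / (real n ^ l * b) * ((\<Sum>S\<in>Cy. (x S)\<^sup>2) * (1 + (2 * K) ^ l / real n))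
      + 1 / (real n ^ l * b) * (B * (\<Sum>S\<in>Cy. \<Sum>T\<in>Cy. real n ^ card (verts S \<inter> verts T)))"
    by (rule split)
  also have "1 / (real n ^ l * b) * (\<Sum>S\<in>Cy. m S)\<^sup>2 = (\<integral>XY. f XY \<partial>PL n)\<^sup>2"
    unfolding planted_mean(3) m_def power_mult_distrib using nb by (simp add: power_divide)
  also have "1 / (real n ^ l * b) * ((\<Sum>S\<in>Cy. (x S)\<^sup>2) * (1 + (2 * K) ^ l / real n)) \<le> 1 + overlap_error"
  proof -
    \<comment> \<open>The diagonal error is absorbed into \<open>overlap_error\<close>, so that a
      single quantity has to be shown small.\<close>
    have "(2 * K) ^ l \<le> (4 * K\<^sup>2 * (real l + 1)) ^ l"
    proof (intro power_mono)
      have "2 * K * 1 \<le> 4 * K * (K * (real l + 1))"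
        using K_ge_1 by (intro mult_mono) (auto intro: mult_ge1_I)
      then show "2 * K \<le> 4 * K\<^sup>2 * (real l + 1)" by (simp add: power2_eq_square ac_simps)
    qed (use K_ge_1 in auto)
    then have e: "(2 * K) ^ l / real n \<le> overlap_error"
      unfolding overlap_error_def by (intro divide_right_mono) auto
    have "1 / (real n ^ l * b) * ((\<Sum>S\<in>Cy. (x S)\<^sup>2) * (1 + (2 * K) ^ l / real n)) = N / real n ^ l * (1 + (2 * K) ^ l / real n)"
      unfolding sum_Xi2 using beta by simp
    also have "\<dots> \<le> 1 * (1 + overlap_error)"
      using e N_le n K_ge_1 by (intro mult_mono add_left_mono) auto
    finally show ?thesis by simp
  qed
  also have "1 / (real n ^ l * b) * (B * (\<Sum>S\<in>Cy. \<Sum>T\<in>Cy. real n ^ card (verts S \<inter> verts T))) \<le> overlap_error / b"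
  proof -
    \<comment> \<open>For fixed \<open>S\<close> the weighted count of \<open>T\<close> is uniform,
      since \<open>S\<close> has \<open>l\<close> vertices; only the number of cycles
      \<open>S\<close> remains to be multiplied in.\<close>
    have "(\<Sum>S\<in>Cy. \<Sum>T\<in>Cy. real n ^ card (verts S \<inter> verts T)) \<le> (\<Sum>S\<in>Cy. (2 * real n * (real l + 1)) ^ l)"
    proof (intro sum_mono sum_cycles_overlap_le l n)
      fix S assume S: "S \<in> Cy"
      show "finite (verts S)" using verts_cycles[OF S] finite_subset by blast
      show "card (verts S) \<le> l" using card_verts_cycle[OF S l] by simp
    qed
    also have "\<dots> \<le> (2 * real n) ^ l * (2 * real n * (real l + 1)) ^ l"
      using card_cycles_le[OF l, of n] by (simp add: mult_right_mono)
    also have "\<dots> = (4 * (real l + 1)) ^ l * (real n ^ l * real n ^ l)"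
      unfolding power_mult_distrib[symmetric] by (rule arg_cong[where f = "\<lambda>x. x ^ l"]) simp
    finally have "1 / (real n ^ l * b) * (B * (\<Sum>S\<in>Cy. \<Sum>T\<in>Cy. real n ^ card (verts S \<inter> verts T)))
        \<le> 1 / (real n ^ l * b) * (B * ((4 * (real l + 1)) ^ l * (real n ^ l * real n ^ l)))"
      using nb B by (intro mult_left_mono) auto
    also have "\<dots> = overlap_error / b"
    proof -
      have "4 * K\<^sup>2 * (real l + 1) = K\<^sup>2 * (4 * (real l + 1))" by simp
      then show ?thesis
        unfolding B_def overlap_error_def using n beta
        by (simp only: power_mult_distrib[of "K\<^sup>2"] power_mult) simp
    qed
    finally show ?thesis .
  qed
  finally show "(\<integral>XY. (f XY)\<^sup>2 \<partial>PL n) \<le> (\<integral>XY. f XY \<partial>PL n)\<^sup>2 + (1 + overlap_error + overlap_error / b)"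
    by linarith
qed

text \<open>The bound on \<open>N\<close> makes the planted mean \<open>e\<close> at least
  \<open>sqrt b / 2\<close>, while the planted variance is at most 3 and the null second moment at
  most 1. The threshold lies at distance \<open>(1 - c) * e\<close> from the planted mean and
  \<open>c * e\<close> from 0; with \<open>e^2 \<ge> b / 4\<close>, Chebyshev gives the constants
  \<open>12 = 3 * 4\<close> and 4.\<close>

lemma test_errors:
  assumes c: "0 < c" "c < 1" and b1: "b \<ge> 1" and err: "overlap_error \<le> 1" and N: "N \<ge> real n ^ l / 2"
  defines "tau \<equiv> c * (\<integral>XY. f XY \<partial>PL n)"
  shows "measure (PL n) {XY \<in> space (PL n). f XY \<le> tau} + measure (null_law n) {XY \<in> space (null_law n). f XY \<ge> tau}
    \<le> (12 / (1 - c)\<^sup>2 + 4 / c\<^sup>2) / b"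
proof -
  interpret P: prob_space "PL n" by (rule prob_space_planted)
  interpret Q: prob_space "null_law n" by (rule prob_space_null_law)
  have sets: "sets (PL n) = sets (mat_space n \<Otimes>\<^sub>M mat_space n)" by (simp add: planted_law_def)
  have fm: "f \<in> borel_measurable (PL n)" "f \<in> borel_measurable (null_law n)"
    using measurable_f_cycle measurable_cong_sets[OF sets refl] measurable_cong_sets[OF sets_null_law refl] by blast+
  note [measurable] = fm
  define e where "e = (\<integral>XY. f XY \<partial>PL n)"
  have N2: "N / real n ^ l \<ge> 1 / 2" using N n by (simp add: field_simps)
  have e: "e = N / real n ^ l * sqrt b" unfolding e_def by (rule planted_mean(2))
  have "0 < N / real n ^ l" using N2 by linarith
  then have e0: "e > 0" unfolding e using beta by (intro mult_pos_pos) auto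
  have "(1 / 2)\<^sup>2 * b \<le> (N / real n ^ l)\<^sup>2 * b"
    using N2 beta by (intro mult_right_mono power_mono) auto
  then have e2: "e\<^sup>2 \<ge> b / 4" using beta by (simp add: e power_mult_distrib power_divide)
  have err0: "overlap_error \<ge> 0" using K_ge_1 by (simp add: overlap_error_def)
  have var: "P.variance f \<le> 3"
  proof -
    have "P.variance f = (\<integral>XY. (f XY)\<^sup>2 \<partial>PL n) - e\<^sup>2"
      unfolding e_def by (rule P.variance_eq[OF planted_mean(1) planted_second_moment(1)])
    also have "\<dots> \<le> 1 + overlap_error + overlap_error / b" using planted_second_moment(2) by (simp add: e_def)
    also have "\<dots> \<le> 1 + 1 + 1" using err err0 b1 by (intro add_mono) (auto simp: divide_le_eq)
    finally show ?thesis by simp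
  qed
  have "P.prob {XY \<in> space (PL n). f XY \<le> tau} \<le> P.prob {XY \<in> space (PL n). (1 - c) * e \<le> \<bar>f XY - e\<bar>}"
    by (intro P.finite_measure_mono) (auto simp: tau_def e_def[symmetric] algebra_simps abs_if)
  also have "\<dots> \<le> P.variance f / ((1 - c) * e)\<^sup>2"
    using P.Chebyshev_inequality[OF fm(1) planted_second_moment(1), of "(1 - c) * e"] c e0 by (simp add: e_def)
  also have "\<dots> \<le> 3 / ((1 - c)\<^sup>2 * (b / 4))"
    unfolding power_mult_distrib using var e2 c beta
    by (intro frac_le mult_left_mono mult_pos_pos) auto
  finally have 1: "P.prob {XY \<in> space (PL n). f XY \<le> tau} \<le> 12 / (1 - c)\<^sup>2 / b" by (simp add: field_simps)
  have "Q.prob {XY \<in> space (null_law n). f XY \<ge> tau} \<le> Q.prob {XY \<in> space (null_law n). c * e \<le> \<bar>f XY\<bar>}"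
    by (intro Q.finite_measure_mono) (auto simp: tau_def e_def[symmetric])
  also have "\<dots> \<le> (\<integral>XY. (f XY)\<^sup>2 \<partial>null_law n) / (c * e)\<^sup>2"
    by (rule Q.second_moment_method[OF fm(2) null_second_moment(1)]) (use c e0 in simp)
  also have "\<dots> \<le> 1 / (c\<^sup>2 * (b / 4))"
    unfolding power_mult_distrib using null_second_moment(2) e2 c beta
    by (intro frac_le mult_left_mono mult_pos_pos) auto
  finally have 2: "Q.prob {XY \<in> space (null_law n). f XY \<ge> tau} \<le> 4 / c\<^sup>2 / b" by (simp add: field_simps)
  show ?thesis using 1 2 by (simp add: add_divide_distrib)
qed

end

end

section \<open>Asymptotics in the cycle length\<close>

lemma growth_at_top:
  fixes \<kappa> \<theta> :: real
  assumes "\<kappa> > 0" "\<theta> > 1"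
  shows "filterlim (\<lambda>l::nat. \<kappa> * \<theta> ^ l / real l ^ 2) at_top at_top"
  using assms by real_asymp

text \<open>Write \<open>L = ln n\<close>. Eventually \<open>4 l ln L \<le> L\<close> and
  \<open>D (l + 1) \<le> L^2\<close>, so the power is at most
  \<open>L^(2 l) = exp (2 l ln L) \<le> n\<close>; this uses the scale
  \<open>ln n / ln (ln n)\<close>. The second claim is Bernoulli's inequality for
  \<open>(1 - l / n)^l\<close> and needs only \<open>2 l^2 \<le> n\<close>.\<close>

lemma cycle_length_asymptotics:
  fixes l :: "nat \<Rightarrow> nat" and D :: real
  assumes small: "(\<lambda>n. real (l n)) \<in> o(\<lambda>n. ln (real n) / ln (ln (real n)))" and D: "D \<ge> 1"
  shows "eventually (\<lambda>n. (D * (real (l n) + 1)) ^ l n / real n \<le> 1) sequentially"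
    and "eventually (\<lambda>n. real (card (dlists n (l n))) \<ge> real n ^ l n / 2) sequentially"
proof -
  have "eventually (\<lambda>n. norm (real (l n)) \<le> 1 / 4 * norm (ln (real n) / ln (ln (real n)))) sequentially"
    using small by (rule landau_o.smallD) simp
  moreover have "eventually (\<lambda>n::nat. ln (ln (real n)) \<ge> 1) sequentially" by real_asymp
  \<comment> \<open>Together with \<open>4 l \<le> ln n\<close> this yields
    \<open>D \<le> ln n\<close> and \<open>l + 1 \<le> ln n\<close> below.\<close>
  moreover have "eventually (\<lambda>n::nat. ln (real n) \<ge> D + 4) sequentially" by real_asymp
  ultimately have A: "eventually (\<lambda>n. 4 * real (l n) * ln (ln (real n)) \<le> ln (real n) \<and> ln (ln (real n)) \<ge> 1 \<and> ln (real n) \<ge> D + 4) sequentially"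
  proof eventually_elim
    case (elim n)
    then show ?case using D by (simp add: field_simps)
  qed
  moreover have "eventually (\<lambda>n::nat. n \<ge> 1) sequentially" by (rule eventually_ge_at_top)
  ultimately show "eventually (\<lambda>n. (D * (real (l n) + 1)) ^ l n / real n \<le> 1) sequentially"
  proof eventually_elim
    case (elim n)
    let ?L = "ln (real n)"
    have "real (l n) * 1 \<le> real (l n) * ln ?L" using elim by (intro mult_left_mono) auto
    then have "4 * real (l n) \<le> ?L" using elim by linarith
    then have "real (l n) + 1 \<le> ?L" "D \<le> ?L" "?L > 0" using elim D by linarith+
    then have "D * (real (l n) + 1) \<le> ?L * ?L" using D by (intro mult_mono) auto
    then have "(D * (real (l n) + 1)) ^ l n \<le> (?L * ?L) ^ l n" using D by (intro power_mono) auto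
    also have "\<dots> = exp (real (l n) * ln (?L * ?L))"
      using \<open>?L > 0\<close> by (simp add: exp_of_nat_mult)
    also have "\<dots> = exp (2 * real (l n) * ln ?L)" using \<open>?L > 0\<close> by (simp add: ln_mult)
    also have "\<dots> \<le> exp ?L"
    proof -
      have "real (l n) * ln ?L \<ge> 0" using elim by simp
      then have "2 * real (l n) * ln ?L \<le> ?L" using elim by linarith
      then show ?thesis by (simp only: exp_le_cancel_iff)
    qed
    also have "\<dots> = real n" using elim by simp
    finally show ?case using elim by simp
  qed
  have "eventually (\<lambda>n::nat. 2 * (ln (real n))\<^sup>2 \<le> real n) sequentially" by real_asymp
  moreover have "eventually (\<lambda>n::nat. n \<ge> 1) sequentially" by (rule eventually_ge_at_top)
  ultimately show "eventually (\<lambda>n. real (card (dlists n (l n))) \<ge> real n ^ l n / 2) sequentially"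
    using A
  proof eventually_elim
    case (elim n)
    let ?L = "ln (real n)" and ?l = "real (l n)"
    have "?l * 1 \<le> ?l * ln ?L" using elim by (intro mult_left_mono) auto
    then have "4 * ?l \<le> ?L" using elim by linarith
    then have lL: "?l \<le> ?L" by simp
    have "?l\<^sup>2 \<le> ?L\<^sup>2" using lL by (intro power_mono) auto
    then have l2: "2 * ?l\<^sup>2 \<le> real n" using elim by linarith
    have "?l \<le> ?l\<^sup>2" by (cases "l n") (auto simp: power2_eq_square)
    then have ln: "l n \<le> n" using l2 by (simp flip: of_nat_power of_nat_mult)
    have "1 / 2 \<le> 1 + ?l * (- (?l / real n))" using l2 elim by (simp add: power2_eq_square field_simps)
    also have "\<dots> \<le> (1 + - (?l / real n)) ^ l n"
      using ln elim by (intro Bernoulli_inequality) simp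
    also have "1 + - (?l / real n) = real (n - l n) / real n"
      using ln elim by (simp add: field_simps of_nat_diff)
    finally have "real n ^ l n / 2 \<le> real (n - l n) ^ l n"
      using elim by (simp add: power_divide field_simps)
    also have "\<dots> \<le> real (card (dlists n (l n)))"
      using card_dlists_ge[OF ln] by (simp flip: of_nat_power)
    finally show ?case by simp
  qed
qed

theorem theorem2p4:
  fixes lam mu rho eps c C :: real
    and M :: "'a measure" and X Y :: "'a \<Rightarrow> real"
    and prior :: "(real \<times> real) measure"
    and l :: "nat \<Rightarrow> nat" and tau :: "nat \<Rightarrow> real"
  assumes "lam \<in> {0..1}" and "mu \<in> {0..1}" and "rho \<in> {0<..<1}"
    and "eps > 0" and "F lam mu rho 1 > 1 + eps"
    and "prob_space M" and "X \<in> borel_measurable M" and "Y \<in> borel_measurable M"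
    and "prior = distr M borel (\<lambda>\<omega>. (X \<omega>, Y \<omega>))"
    and "(\<integral>\<omega>. X \<omega> \<partial>M) = 0" and "(\<integral>\<omega>. Y \<omega> \<partial>M) = 0"
    and "(\<integral>\<omega>. (X \<omega>)\<^sup>2 \<partial>M) = 1" and "(\<integral>\<omega>. (Y \<omega>)\<^sup>2 \<partial>M) = 1"
    and "(\<integral>\<omega>. X \<omega> * Y \<omega> \<partial>M) = rho"
    and "integrable M (\<lambda>\<omega>. X \<omega> ^ 4)" and "(\<integral>\<omega>. X \<omega> ^ 4 \<partial>M) \<le> C"
    and "integrable M (\<lambda>\<omega>. Y \<omega> ^ 4)" and "(\<integral>\<omega>. Y \<omega> ^ 4 \<partial>M) \<le> C"
    and "filterlim l at_top sequentially"
    and "(\<lambda>n. real (l n)) \<in> o(\<lambda>n. ln (real n) / ln (ln (real n)))"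
    and "0 < c" and "c < 1"
    and "\<And>n. tau n = c * (\<integral>XY. f_cycle lam mu rho (l n) n XY \<partial>planted_law lam mu prior n)"
  shows "(\<lambda>n. measure (planted_law lam mu prior n)
                {XY \<in> space (planted_law lam mu prior n). f_cycle lam mu rho (l n) n XY \<le> tau n}
            + measure (null_law n)
                {XY \<in> space (null_law n). f_cycle lam mu rho (l n) n XY \<ge> tau n}) \<longlonglongrightarrow> 0
       \<and> strong_detection (planted_law lam mu prior) null_law
           (\<lambda>n XY. if f_cycle lam mu rho (l n) n XY \<ge> tau n then 1 else 0)"
proof -
  have lam: "lam \<in> {0..1}" and mu: "mu \<in> {0..1}" and rho: "rho \<in> {0<..<1}" by fact+
  interpret M: prob_space M by fact
  note [measurable] = \<open>X \<in> borel_measurable M\<close> \<open>Y \<in> borel_measurable M\<close>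
  have prior: "prior = distr M borel (\<lambda>\<omega>. (X \<omega>, Y \<omega>))" by fact
  have XY: "(\<lambda>\<omega>. (X \<omega>, Y \<omega>)) \<in> M \<rightarrow>\<^sub>M borel" by measurable
  have fst_snd [measurable]: "fst \<in> borel_measurable (borel :: (real \<times> real) measure)"
    "snd \<in> borel_measurable (borel :: (real \<times> real) measure)"
    by (auto intro!: borel_measurable_continuous_onI continuous_intros)
  interpret correlated_prior prior lam mu rho
  proof (intro correlated_prior.intro correlated_prior_axioms.intro lam mu)
    show "prob_space prior" unfolding prior by (rule M.prob_space_distr[OF XY])
    show "sets prior = sets borel" by (simp add: prior)
    have "integrable M (\<lambda>\<omega>. (1 + (X \<omega>)\<^sup>2 + (Y \<omega>)\<^sup>2)\<^sup>2)"
    proof (rule Bochner_Integration.integrable_bound)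
      show "integrable M (\<lambda>\<omega>. 3 * (1 + X \<omega> ^ 4 + Y \<omega> ^ 4))"
        using \<open>integrable M (\<lambda>\<omega>. X \<omega> ^ 4)\<close> \<open>integrable M (\<lambda>\<omega>. Y \<omega> ^ 4)\<close> by simp
      \<comment> \<open>The difference of the two sides is the sum of the squares of
        \<open>a - 1\<close>, \<open>b - 1\<close> and \<open>a - b\<close>.\<close>
      have "(1 + a + b)\<^sup>2 \<le> 3 * (1 + a\<^sup>2 + b\<^sup>2)" for a b :: real
        using zero_le_power2[of "a - 1"] zero_le_power2[of "b - 1"] zero_le_power2[of "a - b"]
        by (simp add: power2_eq_square algebra_simps)
      from this[of "(X \<omega>)\<^sup>2" "(Y \<omega>)\<^sup>2" for \<omega>]
      show "AE \<omega> in M. norm ((1 + (X \<omega>)\<^sup>2 + (Y \<omega>)\<^sup>2)\<^sup>2) \<le> norm (3 * (1 + X \<omega> ^ 4 + Y \<omega> ^ 4))"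
        by (intro AE_I2) (simp flip: power_mult)
    qed measurable
    then show "integrable prior (\<lambda>p. (1 + (fst p)\<^sup>2 + (snd p)\<^sup>2)\<^sup>2)"
      unfolding prior by (subst integrable_distr_eq[OF XY]) simp_all
    show "(\<integral>p. (fst p)\<^sup>2 \<partial>prior) = 1" "(\<integral>p. (snd p)\<^sup>2 \<partial>prior) = 1" "(\<integral>p. fst p * snd p \<partial>prior) = rho"
      unfolding prior using assms by (simp_all add: integral_distr[OF XY])
  qed
  let ?P = "\<lambda>n. planted_law lam mu prior n" and ?f = "\<lambda>n. f_cycle lam mu rho (l n) n"
  let ?b = "\<lambda>n. beta lam mu rho (l n)"
  have sets: "sets (?P n) = sets (mat_space n \<Otimes>\<^sub>M mat_space n)" for n by (simp add: planted_law_def)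
  have fm: "?f n \<in> borel_measurable (?P n)" "?f n \<in> borel_measurable (null_law n)" for n
    using measurable_f_cycle measurable_cong_sets[OF sets refl] measurable_cong_sets[OF sets_null_law refl] by blast+
  note [measurable] = fm
  have tau: "tau n = c * (\<integral>XY. ?f n XY \<partial>?P n)" for n by fact
  have F: "F lam mu rho 1 > 1" using \<open>F lam mu rho 1 > 1 + eps\<close> \<open>eps > 0\<close> by linarith
  obtain \<kappa> \<theta> where k: "\<kappa> > 0" "\<theta> > 1" "\<And>l. 3 \<le> l \<Longrightarrow> beta lam mu rho l \<ge> \<kappa> * \<theta> ^ l / real l ^ 2"
    using beta_ge[OF lam mu rho F] by metis
  have l_top: "filterlim l at_top sequentially" by fact
  have l3: "eventually (\<lambda>n. 3 \<le> l n) sequentially"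
    using l_top by (simp add: filterlim_at_top)
  have b_top: "filterlim ?b at_top sequentially"
  proof (rule filterlim_at_top_mono)
    show "filterlim (\<lambda>n. \<kappa> * \<theta> ^ l n / real (l n) ^ 2) at_top sequentially"
      by (rule filterlim_compose[OF growth_at_top[OF k(1,2)] l_top])
    show "eventually (\<lambda>n. \<kappa> * \<theta> ^ l n / real (l n) ^ 2 \<le> ?b n) sequentially"
      using l3 by eventually_elim (rule k(3))
  qed
  let ?err = "\<lambda>n. measure (?P n) {XY \<in> space (?P n). ?f n XY \<le> tau n}
    + measure (null_law n) {XY \<in> space (null_law n). ?f n XY \<ge> tau n}"
  let ?C = "12 / (1 - c)\<^sup>2 + 4 / c\<^sup>2"
  \<comment> \<open>With \<open>D = 4 K^2\<close>, the first claim of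
    \<open>cycle_length_asymptotics\<close> becomes \<open>overlap_error \<le> 1\<close>.\<close>
  have K1: "4 * K\<^sup>2 \<ge> 1" using one_le_power[OF K_ge_1, of 2] by simp
  have lo: "(\<lambda>n. real (l n)) \<in> o(\<lambda>n. ln (real n) / ln (ln (real n)))" by fact
  have "eventually (\<lambda>n. ?b n \<ge> 1) sequentially" using b_top by (simp add: filterlim_at_top)
  moreover have "eventually (\<lambda>n::nat. 1 \<le> n) sequentially" by (rule eventually_ge_at_top)
  ultimately have bound: "eventually (\<lambda>n. ?err n \<le> ?C / ?b n) sequentially"
    using l3 cycle_length_asymptotics[OF lo K1]
  proof eventually_elim
    case (elim n)
    show ?case unfolding tau
      by (rule test_errors) (use elim rho \<open>0 < c\<close> \<open>c < 1\<close> in \<open>auto simp: overlap_error_def\<close>)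
  qed
  have lim0: "(\<lambda>n. ?C / ?b n) \<longlonglongrightarrow> 0"
    by (rule real_tendsto_divide_at_top[OF tendsto_const b_top])
  have lim: "?err \<longlonglongrightarrow> 0"
    by (rule tendsto_sandwich[OF _ bound tendsto_const lim0]) simp
  have "strong_detection ?P null_law (\<lambda>n XY. if ?f n XY \<ge> tau n then 1 else 0)"
    unfolding strong_detection_def
  proof (intro conjI allI)
    fix n
    show "(\<lambda>XY. if ?f n XY \<ge> tau n then 1 else 0) \<in> ?P n \<rightarrow>\<^sub>M count_space {0, 1}"
      "(\<lambda>XY. if ?f n XY \<ge> tau n then 1 else 0) \<in> null_law n \<rightarrow>\<^sub>M count_space {0, 1}"
      by (rule measurable_If; simp)+
  next
    let ?e = "\<lambda>n. measure (?P n) {\<omega> \<in> space (?P n). (if ?f n \<omega> \<ge> tau n then 1 else 0 :: nat) = 0}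
      + measure (null_law n) {\<omega> \<in> space (null_law n). (if ?f n \<omega> \<ge> tau n then 1 else 0 :: nat) = 1}"
    \<comment> \<open>The test answers 0 exactly when the statistic is below \<open>tau n\<close>,
      an event contained in the one with the weak inequality.\<close>
    have "?e n \<le> ?err n" for n
    proof (intro add_mono)
      interpret P: prob_space "?P n" by (rule prob_space_planted)
      interpret Q: prob_space "null_law n" by (rule prob_space_null_law)
      show "P.prob {\<omega> \<in> space (?P n). (if ?f n \<omega> \<ge> tau n then 1 else 0 :: nat) = 0}
        \<le> P.prob {XY \<in> space (?P n). ?f n XY \<le> tau n}"
        by (intro P.finite_measure_mono) auto
      show "Q.prob {\<omega> \<in> space (null_law n). (if ?f n \<omega> \<ge> tau n then 1 else 0 :: nat) = 1}
        \<le> Q.prob {XY \<in> space (null_law n). ?f n XY \<ge> tau n}"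
        by (intro Q.finite_measure_mono) auto
    qed
    then show "?e \<longlonglongrightarrow> 0"
      by (intro tendsto_sandwich[OF _ _ tendsto_const lim]) (auto intro!: always_eventually)
  qed
  with lim show ?thesis by simp
qed

end
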